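(* Let $\mathbf{E}$ be a set of topological spaces and $\mathbf{C}$ a set of linear spaces. Define $\mathcal{F}(A,E,C)=(A,\mathrm{Triv}(E),\mathrm{Triv}^k(C))$ on objects of $\mathrm{Atl}^{k}(\mathbf{E},\mathbf{C})$ and $$\mathcal{F}\bigl((f_0,f_1),(A^1,E^1,C^1),(A^2,E^2,C^2)\bigr)=\bigl((f_0,f_1),(A^1,\mathrm{Triv}(E^1),\mathrm{Triv}^k(C^1)),(A^2,\mathrm{Triv}(E^2),\mathrm{Triv}^k(C^2))\bigr)$$ on morphisms. Then $\mathcal{F}$ is a functor from $\mathrm{Atl}^{k}(\mathbf{E},\mathbf{C})$ to $\mathrm{Atl}(\mathrm{Triv}(\mathbf{E}),\mathrm{Triv}^k(\mathbf{C}))$, where $\mathrm{Triv}(\mathbf{E})=\{\mathrm{Triv}(E)\mid E\in\mathbf{E}\}$ and $\mathrm{Triv}^k(\mathbf{C})=\{\mathrm{Triv}^k(C)\mid C\in\mathbf{C}\}$.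
   Context: Here $k\in\mathbb{N}\cup\{\infty,\omega\}$. **Model spaces.** A model space is a pair $(S,\mathcal{S})$ where $S$ is a topological space and $\mathcal{S}$ is a small category whose objects are open subsets of $S$ and whose morphisms are continuous functions (composed as functions), such that: (1) $\mathrm{Ob}(\mathcal{S})$ is an open cover of $S$; (2) $\mathrm{Ob}(\mathcal{S})$ is closed under finite intersections; (3) if $f:A\to B$ is a morphism, $A'\subseteq A$ and $B'\subseteq B$ are objects and $f[A']\subseteq B'$, then $f|_{A'}:A'\to B'$ is a morphism; (4) inclusions $A'\hookrightarrow A$ of objects are morphisms; (5) if $f_\alpha:U_\alpha\to V_\alpha$ are morphisms, $U=\bigcup_\alpha U_\alpha$ and $V=\bigcup_\alpha V_\alpha$ are objects, and $f:U\to V$ is continuous and agrees with $f_\alpha$ on each $U_\alpha$, then $f$ is a morphism. Objects of $\mathcal{S}$ are called model neighborhoods; each is itself regarded as a model space with the full subcategory of the model neighborhoods it contains. A model function is a continuous function such that inverse images of model neighborhoods are model neighborhoods and the image of every model neighborhood is contained in a model neighborhood; a model homeomorphism is an invertible model function whose inverse is a model function. **Linear spaces and trivial model spaces.** A linear space is a locally arcwise connected topological subspace, with non-void interior, of a real (or complex) Banach or Fréchet space. $\mathrm{Triv}(E)=(E,\text{all continuous functions between open sets of }E)$; for a linear space $C$, $\mathrm{Triv}^k(C)=(C,\text{all }C^k\text{ functions between open sets of }C)$. **$C^k$-atlases and $\mathrm{Atl}^k$.** A $C^k$ chart of $E$ in $C$ is $(U,V,\phi)$ with $U\subseteq E$,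 $V\subseteq C$ open and $\phi:U\to V$ a homeomorphism. Charts $(U,V,\phi),(U',V',\phi')$ are $C^k$ compatible iff $U\cap U'=\emptyset$ or $\phi'\circ\phi^{-1}:\phi[U\cap U']\to\phi'[U\cap U']$ is a $C^k$ diffeomorphism. A $C^k$-atlas of $E$ in $C$ is a set of mutually $C^k$ compatible charts whose domains cover $E$ and such that for at least one chart $(U,V,\phi)$, $V$ contains a ball of the underlying Banach or Fréchet space. A $C^k$-morphism from a $C^k$-atlas $A^1$ (of $E^1$ in $C^1$) to a $C^k$-atlas $A^2$ (of $E^2$ in $C^2$) is a pair ($f_0:E^1\to E^2$ continuous, $f_1:C^1\to C^2$ $C^k$) such that for all $(U^i,V^i,\phi^i)\in A^i$ and $x\in I:=U^1\cap f_0^{-1}[U^2]$ there are open sets $U'^1\subseteq I$, $V'^1\subseteq V^1$, $U'^2\subseteq U^2$, $V'^2\subseteq V^2$, $\hat V'^2\subseteq C^2$ and a $C^k$ diffeomorphism $\hat f:V'^2\to\hat V'^2$ with ( * ) $x\in U'^1$, $f_1(\phi^1(x))\in\hat V'^2$, $f_0[U'^1]\subseteq U'^2$, $\phi^1[U'^1]\subseteq V'^1$, $f_1[V'^1]\subseteq\hat V'^2$, $\phi^2[U'^2]\subseteq V'^2$, $\hat f\circ\phi^2\circ f_0=f_1\circ\phi^1$ on $U'^1$. $\mathrm{Atl}^k(\mathbf{E},\mathbf{C})$ has objects $(A,E,C)$ with $E\in\mathbf{E}$, $C\in\mathbf{C}$, $A$ a $C^k$-atlas of $E$ in $C$, and morphisms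 $((f_0,f_1),(A^1,E^1,C^1),(A^2,E^2,C^2))$ with $(f_0,f_1)$ a $C^k$-morphism. **m-atlases and $\mathrm{Atl}$.** For model spaces $E=(|E|,\mathcal{E})$, $C=(|C|,\mathcal{C})$, an m-chart of $E$ in $C$ is $(U,V,\phi)$ with $U\in\mathrm{Ob}(\mathcal{E})$, $V\in\mathrm{Ob}(\mathcal{C})$, $\phi:U\to V$ a model homeomorphism; m-charts are m-compatible iff their domains are disjoint or $\phi'\circ\phi^{-1}:\phi[U\cap U']\to\phi'[U\cap U']$ is an isomorphism of $\mathcal{C}$; an m-atlas is a set of mutually m-compatible m-charts whose domains cover $|E|$. An m-atlas morphism from $A^1$ to $A^2$ (atlases of $E^i$ in $C^i$) is a pair of model functions $(f_0:E^1\to E^2,f_1:C^1\to C^2)$ such that for all charts $(U^i,V^i,\phi^i)\in A^i$ and $x\in I:=U^1\cap f_0^{-1}[U^2]$ there are model neighborhoods $U'^1\subseteq I$, $V'^1\subseteq V^1$, $U'^2\subseteq U^2$, $V'^2\subseteq V^2$, $\hat V'^2\subseteq|C^2|$ and an isomorphism $\hat f:V'^2\to\hat V'^2$ of the category of $C^2$ satisfying ( * ). For sets of model spaces $\mathbf{E}',\mathbf{C}'$, $\mathrm{Atl}(\mathbf{E}',\mathbf{C}')$ has objects $(A,E,C)$ with $E\in\mathbf{E}'$, $C\in\mathbf{C}'$, $A$ an m-atlas of $E$ in $C$, and morphisms $((f_0,f_1),o_1,o_2)$ with $(f_0,f_1)$ an m-atlas morphism. In both categories composition is $(g,o_2,o_3)\circ(f,o_1,o_2)=((g_0\circ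 f_0,g_1\circ f_1),o_1,o_3)$ and the identity of $o=(A,E,C)$ is $((\mathrm{Id}_E,\mathrm{Id}_C),o,o)$.
   Formalization: With the morphisms as given, Atl^k and Atl need not be closed under composition (E=(0,1), C=R, chart id: (id,x+5) followed by (id,(x-11/2)^2)); so "functor" here means all category and functor laws except that composites of arrows are again arrows. *)

theory Defs
  imports "HOL-Analysis.Analysis" "HOL-Library.Extended_Nat" "HOL-Library.FuncSet"
begin

text \<open>
  Throughout, a function between sets \<open>A\<close> and \<open>B\<close> is represented by a HOL function that is
  \<^const>\<open>extensional\<close> on \<open>A\<close>; the composite is \<^const>\<open>compose\<close> and the identity of \<open>A\<close> is
  \<^term>\<open>restrict id A\<close>.
\<close>


section \<open>Categories and functors\<close>

record ('o, 'm) cat =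
  Ob :: "'o set"
  Arr :: "'m set"
  src :: "'m \<Rightarrow> 'o"
  tgt :: "'m \<Rightarrow> 'o"
  ident :: "'o \<Rightarrow> 'm"
  comp :: "'m \<Rightarrow> 'm \<Rightarrow> 'm"

text \<open>
  The category axioms, except that \<open>comp K g f\<close> need not be an arrow for all composable arrows
  \<open>f\<close>, \<open>g\<close>. Atlas morphisms as defined below are not closed under composition: on the open unit
  interval with the single chart \<open>id\<close> in the real line, \<open>(id, \<lambda>x. x + 5)\<close> and
  \<open>(id, \<lambda>x. (x - 11/2)^2)\<close> are \<open>C\<^sup>k\<close>-morphisms for every \<open>k\<close>, and their composite
  \<open>(id, \<lambda>x. (x - 1/2)^2)\<close> is not, since near \<open>1/2\<close> it would have to be injective.
\<close>
definition cat_axioms :: "('o, 'm, 'z) cat_scheme \<Rightarrow> bool" where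
  "cat_axioms K \<longleftrightarrow>
     (\<forall>f\<in>Arr K. src K f \<in> Ob K \<and> tgt K f \<in> Ob K) \<and>
     (\<forall>a\<in>Ob K. ident K a \<in> Arr K \<and> src K (ident K a) = a \<and> tgt K (ident K a) = a) \<and>
     (\<forall>f\<in>Arr K. comp K f (ident K (src K f)) = f \<and> comp K (ident K (tgt K f)) f = f) \<and>
     (\<forall>f\<in>Arr K. \<forall>g\<in>Arr K. tgt K f = src K g \<longrightarrow>
        src K (comp K g f) = src K f \<and> tgt K (comp K g f) = tgt K g) \<and>
     (\<forall>f\<in>Arr K. \<forall>g\<in>Arr K. \<forall>h\<in>Arr K. tgt K f = src K g \<longrightarrow> tgt K g = src K h \<longrightarrow>
        comp K h (comp K g f) = comp K (comp K h g) f)"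

definition is_functor ::
  "('o, 'm, 'z) cat_scheme \<Rightarrow> ('p, 'n, 'y) cat_scheme \<Rightarrow> ('o \<Rightarrow> 'p) \<Rightarrow> ('m \<Rightarrow> 'n) \<Rightarrow> bool" where
  "is_functor K L F\<^sub>o F\<^sub>m \<longleftrightarrow>
     cat_axioms K \<and> cat_axioms L \<and>
     (\<forall>a\<in>Ob K. F\<^sub>o a \<in> Ob L) \<and>
     (\<forall>f\<in>Arr K. F\<^sub>m f \<in> Arr L \<and> src L (F\<^sub>m f) = F\<^sub>o (src K f) \<and> tgt L (F\<^sub>m f) = F\<^sub>o (tgt K f)) \<and>
     (\<forall>a\<in>Ob K. F\<^sub>m (ident K a) = ident L (F\<^sub>o a)) \<and>
     (\<forall>f\<in>Arr K. \<forall>g\<in>Arr K. tgt K f = src K g \<longrightarrow> F\<^sub>m (comp K g f) = comp L (F\<^sub>m g) (F\<^sub>m f))"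


section \<open>Model spaces\<close>

record 'p model =
  mtop :: "'p topology"
  nbds :: "'p set set"
  mor :: "'p set \<Rightarrow> 'p set \<Rightarrow> ('p \<Rightarrow> 'p) set"

definition model_space :: "'p model \<Rightarrow> bool" where
  "model_space S \<longleftrightarrow>
     (\<forall>A\<in>nbds S. openin (mtop S) A) \<and>
     (\<forall>A B. \<forall>f\<in>mor S A B. A \<in> nbds S \<and> B \<in> nbds S \<and> f \<in> extensional A \<and>
        continuous_map (subtopology (mtop S) A) (subtopology (mtop S) B) f) \<and>
     (\<forall>A\<in>nbds S. restrict id A \<in> mor S A A) \<and>
     (\<forall>A B D. \<forall>f\<in>mor S A B. \<forall>g\<in>mor S B D. compose A g f \<in> mor S A D) \<and>
     \<Union>(nbds S) = topspace (mtop S) \<and>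
     (\<forall>A\<in>nbds S. \<forall>B\<in>nbds S. A \<inter> B \<in> nbds S) \<and>
     (\<forall>A B. \<forall>f\<in>mor S A B. \<forall>A'\<in>nbds S. \<forall>B'\<in>nbds S.
        A' \<subseteq> A \<longrightarrow> B' \<subseteq> B \<longrightarrow> f ` A' \<subseteq> B' \<longrightarrow> restrict f A' \<in> mor S A' B') \<and>
     (\<forall>A\<in>nbds S. \<forall>A'\<in>nbds S. A' \<subseteq> A \<longrightarrow> restrict id A' \<in> mor S A' A) \<and>
     (\<forall>\<F> U V f. (\<forall>(A, B, h)\<in>\<F>. h \<in> mor S A B) \<longrightarrow>
        U = (\<Union>(A, B, h)\<in>\<F>. A) \<longrightarrow> V = (\<Union>(A, B, h)\<in>\<F>. B) \<longrightarrow>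
        U \<in> nbds S \<longrightarrow> V \<in> nbds S \<longrightarrow> f \<in> extensional U \<longrightarrow>
        continuous_map (subtopology (mtop S) U) (subtopology (mtop S) V) f \<longrightarrow>
        (\<forall>(A, B, h)\<in>\<F>. \<forall>x\<in>A. f x = h x) \<longrightarrow> f \<in> mor S U V)"

definition restrict_model :: "'p model \<Rightarrow> 'p set \<Rightarrow> 'p model" where
  "restrict_model S U =
     \<lparr>mtop = subtopology (mtop S) U,
      nbds = {A \<in> nbds S. A \<subseteq> U},
      mor = (\<lambda>A B. if A \<subseteq> U \<and> B \<subseteq> U then mor S A B else {})\<rparr>"

definition model_function :: "'p model \<Rightarrow> 'q model \<Rightarrow> ('p \<Rightarrow> 'q) \<Rightarrow> bool" where
  "model_function S T f \<longleftrightarrow>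
     f \<in> extensional (topspace (mtop S)) \<and>
     continuous_map (mtop S) (mtop T) f \<and>
     (\<forall>B\<in>nbds T. {x \<in> topspace (mtop S). f x \<in> B} \<in> nbds S) \<and>
     (\<forall>A\<in>nbds S. \<exists>B\<in>nbds T. f ` A \<subseteq> B)"

definition model_homeo :: "'p model \<Rightarrow> 'q model \<Rightarrow> ('p \<Rightarrow> 'q) \<Rightarrow> bool" where
  "model_homeo S T f \<longleftrightarrow>
     model_function S T f \<and>
     (\<exists>g. model_function T S g \<and>
        (\<forall>x\<in>topspace (mtop S). g (f x) = x) \<and> (\<forall>y\<in>topspace (mtop T). f (g y) = y))"

definition model_iso :: "'p model \<Rightarrow> 'p set \<Rightarrow> 'p set \<Rightarrow> ('p \<Rightarrow> 'p) \<Rightarrow> bool" where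
  "model_iso S A B f \<longleftrightarrow>
     f \<in> mor S A B \<and>
     (\<exists>g\<in>mor S B A. compose A g f = restrict id A \<and> compose B f g = restrict id B)"


section \<open>Frechet spaces and linear spaces\<close>

text \<open>
  A real or complex Banach or Frechet space lives on a linear subspace \<open>mspace (fmetric X)\<close> of some
  real vector space, with its own metric. As any set of real vector spaces embeds in their
  direct sum, sets of such spaces are covered in full generality.
  \<open>imul X = None\<close> for a real space; \<open>imul X = Some J\<close> for a complex one, with \<open>J\<close> the
  multiplication by the imaginary unit.
\<close>
record 'v frechet =
  fmetric :: "'v metric"
  imul :: "('v \<Rightarrow> 'v) option"

abbreviation pts :: "('v, 'z) frechet_scheme \<Rightarrow> 'v set" where
  "pts X \<equiv> mspace (fmetric X)"

abbreviation ftop :: "('v, 'z) frechet_scheme \<Rightarrow> 'v topology" where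
  "ftop X \<equiv> mtopology_of (fmetric X)"

definition complex_structure :: "'v::real_vector frechet \<Rightarrow> ('v \<Rightarrow> 'v) \<Rightarrow> bool" where
  "complex_structure X J \<longleftrightarrow>
     (\<forall>x\<in>pts X. J x \<in> pts X \<and> J (J x) = - x) \<and>
     (\<forall>x\<in>pts X. \<forall>y\<in>pts X. J (x + y) = J x + J y) \<and>
     (\<forall>a. \<forall>x\<in>pts X. J (a *\<^sub>R x) = a *\<^sub>R J x) \<and>
     continuous_map (ftop X) (ftop X) J"

text \<open>
  Complete translation-invariant metric, locally convex. Banach spaces are the case where the
  metric is that of a norm, which \<open>norm_metric\<close> singles out.
\<close>
definition frechet_space :: "'v::real_vector frechet \<Rightarrow> bool" where
  "frechet_space X \<longleftrightarrow>
     subspace (pts X) \<and>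
     mcomplete_of (fmetric X) \<and>
     (\<forall>x\<in>pts X. \<forall>y\<in>pts X. \<forall>z\<in>pts X. mdist (fmetric X) (x + z) (y + z) = mdist (fmetric X) x y) \<and>
     continuous_map (prod_topology euclideanreal (ftop X)) (ftop X) (\<lambda>(a, x). a *\<^sub>R x) \<and>
     (\<forall>r>0. \<exists>K. openin (ftop X) K \<and> convex K \<and> 0 \<in> K \<and> K \<subseteq> mball_of (fmetric X) 0 r) \<and>
     (\<forall>J. imul X = Some J \<longrightarrow> complex_structure X J)"

definition norm_metric :: "'v::real_vector frechet \<Rightarrow> bool" where
  "norm_metric X \<longleftrightarrow>
     (\<forall>a. \<forall>x\<in>pts X. mdist (fmetric X) (a *\<^sub>R x) 0 = \<bar>a\<bar> * mdist (fmetric X) x 0)"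

record 'v linspace =
  ambient :: "'v frechet"
  points :: "'v set"

abbreviation ltop :: "'v linspace \<Rightarrow> 'v topology" where
  "ltop C \<equiv> subtopology (ftop (ambient C)) (points C)"

definition linear_space :: "'v::real_vector linspace \<Rightarrow> bool" where
  "linear_space C \<longleftrightarrow>
     frechet_space (ambient C) \<and>
     points C \<subseteq> pts (ambient C) \<and>
     locally_path_connected_space (ltop C) \<and>
     ftop (ambient C) interior_of points C \<noteq> {}"


section \<open>Functions of class \<open>C\<^sup>k\<close>\<close>

datatype smoothness = Diff enat | Analytic

text \<open>
  Class \<open>C\<^sup>k\<close>, \<open>k \<le> \<infinity>\<close>, on an open subset \<open>W\<close> of a Frechet space: \<open>D [h\<^sub>n, \<dots>, h\<^sub>1] x\<close> is the iterated
  directional derivative of \<open>g\<close> at \<open>x\<close>, first in direction \<open>h\<^sub>1\<close> and last in direction \<open>h\<^sub>n\<close>.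
  It has to exist for \<open>n \<le> k\<close> and be jointly continuous in \<open>x\<close> and the directions (the usual
  notion for Frechet spaces, due to Michal and Bastiani). Between Banach spaces it has in
  addition to depend on \<open>x\<close> continuously in the norm of bounded multilinear maps, which gives
  \<open>C\<^sup>k\<close> in the sense of the Frechet derivative. Between complex spaces the first
  derivative (and with it all others) has to be complex linear.
\<close>
definition diff_on ::
  "enat \<Rightarrow> 'v::real_vector frechet \<Rightarrow> 'v set \<Rightarrow> 'w::real_vector frechet \<Rightarrow> ('v \<Rightarrow> 'w) \<Rightarrow> bool" where
  "diff_on k X W Y g \<longleftrightarrow>
     (\<exists>D :: 'v list \<Rightarrow> 'v \<Rightarrow> 'w.
        (\<forall>x\<in>W. D [] x = g x) \<and>
        (\<forall>hs\<in>lists (pts X). \<forall>h\<in>pts X. \<forall>x\<in>W. enat (length hs) < k \<longrightarrow>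
           limitin (ftop Y) (\<lambda>t. (1 / t) *\<^sub>R (D hs (x + t *\<^sub>R h) - D hs x)) (D (h # hs) x) (at 0)) \<and>
        (\<forall>n. enat n \<le> k \<longrightarrow>
           continuous_map
             (prod_topology (subtopology (ftop X) W) (product_topology (\<lambda>_. ftop X) {..<n}))
             (ftop Y) (\<lambda>(x, h). D (map h [0..<n]) x)) \<and>
        (norm_metric X \<and> norm_metric Y \<longrightarrow>
           (\<forall>n. enat n \<le> k \<longrightarrow> (\<forall>x\<in>W. \<forall>\<epsilon>>0. \<exists>\<delta>>0. \<forall>y\<in>W. mdist (fmetric X) x y < \<delta> \<longrightarrow>
              (\<forall>hs\<in>lists (mcball_of (fmetric X) 0 1). length hs = n \<longrightarrow>
                 mdist (fmetric Y) (D hs x) (D hs y) \<le> \<epsilon>)))) \<and>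
        (\<forall>I J. imul X = Some I \<longrightarrow> imul Y = Some J \<longrightarrow> 1 \<le> k \<longrightarrow>
           (\<forall>x\<in>W. \<forall>h\<in>pts X. D [I h] x = J (D [h] x))))"

definition complexify :: "'v::real_vector frechet \<Rightarrow> ('v \<times> 'v) frechet" where
  "complexify X =
     \<lparr>fmetric = prod_metric (fmetric X) (fmetric X), imul = Some (\<lambda>(u, v). (- v, u))\<rparr>"

text \<open>
  Class \<open>C\<^sup>\<omega>\<close>: between complex spaces, holomorphic, that is \<open>C\<^sup>1\<close> with complex linear derivative;
  otherwise real analytic, that is locally extending to a holomorphic map between the
  complexifications (Milnor, Neeb).
\<close>
fun smooth_on ::
  "smoothness \<Rightarrow> 'v::real_vector frechet \<Rightarrow> 'v set \<Rightarrow> 'w::real_vector frechet \<Rightarrow> ('v \<Rightarrow> 'w) \<Rightarrow> bool"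
where
  "smooth_on (Diff k) X W Y g \<longleftrightarrow> diff_on k X W Y g"
| "smooth_on Analytic X W Y g \<longleftrightarrow>
     (if imul X \<noteq> None \<and> imul Y \<noteq> None then diff_on 1 X W Y g
      else \<forall>x\<in>W. \<exists>W' G. openin (ftop (complexify X)) W' \<and> (x, 0) \<in> W' \<and>
             diff_on 1 (complexify X) W' (complexify Y) G \<and>
             (\<forall>y\<in>W. (y, 0) \<in> W' \<longrightarrow> G (y, 0) = (g y, 0)))"

text \<open>
  A linear space need not be open in its ambient space. As usual for functions on such sets, \<open>C\<^sup>k\<close>
  with \<open>k \<ge> 1\<close> means that the function locally extends to a \<open>C\<^sup>k\<close> function on an open set of the
  ambient space; \<open>C\<^sup>0\<close> is continuity.
\<close>
definition Ck_fun ::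
  "smoothness \<Rightarrow> 'v::real_vector linspace \<Rightarrow> 'v set \<Rightarrow> 'w::real_vector linspace \<Rightarrow> 'w set \<Rightarrow> ('v \<Rightarrow> 'w) \<Rightarrow> bool"
where
  "Ck_fun k C A C' B f \<longleftrightarrow>
     openin (ltop C) A \<and> openin (ltop C') B \<and> f \<in> extensional A \<and>
     continuous_map (subtopology (ltop C) A) (subtopology (ltop C') B) f \<and>
     (k \<noteq> Diff 0 \<longrightarrow>
        (\<forall>x\<in>A. \<exists>W g. openin (ftop (ambient C)) W \<and> x \<in> W \<and>
           smooth_on k (ambient C) W (ambient C') g \<and> (\<forall>y\<in>A \<inter> W. g y = f y)))"

definition Ck_diffeo ::
  "smoothness \<Rightarrow> 'v::real_vector linspace \<Rightarrow> 'v set \<Rightarrow> 'w::real_vector linspace \<Rightarrow> 'w set \<Rightarrow> ('v \<Rightarrow> 'w) \<Rightarrow> bool"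
where
  "Ck_diffeo k C A C' B f \<longleftrightarrow>
     Ck_fun k C A C' B f \<and>
     (\<exists>g. Ck_fun k C' B C A g \<and> (\<forall>x\<in>A. g (f x) = x) \<and> (\<forall>y\<in>B. f (g y) = y))"


section \<open>Trivial model spaces\<close>

definition Triv :: "'e topology \<Rightarrow> 'e model" where
  "Triv E =
     \<lparr>mtop = E,
      nbds = {A. openin E A},
      mor = (\<lambda>A B. {f. openin E A \<and> openin E B \<and> f \<in> extensional A \<and>
                       continuous_map (subtopology E A) (subtopology E B) f})\<rparr>"

definition Trivk :: "smoothness \<Rightarrow> 'v::real_vector linspace \<Rightarrow> 'v model" where
  "Trivk k C =
     \<lparr>mtop = ltop C,
      nbds = {A. openin (ltop C) A},
      mor = (\<lambda>A B. {f. Ck_fun k C A C B f})\<rparr>"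


section \<open>Charts and atlases\<close>

type_synonym ('e, 'c) chart = "'e set \<times> 'c set \<times> ('e \<Rightarrow> 'c)"

text \<open>\<open>\<phi>' \<circ> \<phi>\<^sup>-\<^sup>1\<close> on \<open>\<phi>[U \<inter> U']\<close>\<close>
definition transition ::
  "('e, 'c) chart \<Rightarrow> ('e, 'c) chart \<Rightarrow> 'c \<Rightarrow> 'c" where
  "transition = (\<lambda>(U, V, \<phi>) (U', V', \<phi>').
     restrict (\<lambda>y. \<phi>' (inv_into U \<phi> y)) (\<phi> ` (U \<inter> U')))"

definition Ck_chart :: "'e topology \<Rightarrow> 'v::real_vector linspace \<Rightarrow> ('e, 'v) chart \<Rightarrow> bool" where
  "Ck_chart E C = (\<lambda>(U, V, \<phi>).
     openin E U \<and> openin (ltop C) V \<and> \<phi> \<in> extensional U \<and>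
     homeomorphic_map (subtopology E U) (subtopology (ltop C) V) \<phi>)"

definition Ck_compatible ::
  "smoothness \<Rightarrow> 'v::real_vector linspace \<Rightarrow> ('e, 'v) chart \<Rightarrow> ('e, 'v) chart \<Rightarrow> bool" where
  "Ck_compatible k C = (\<lambda>(U, V, \<phi>) (U', V', \<phi>').
     U \<inter> U' = {} \<or>
     Ck_diffeo k C (\<phi> ` (U \<inter> U')) C (\<phi>' ` (U \<inter> U')) (transition (U, V, \<phi>) (U', V', \<phi>')))"

definition Ck_atlas ::
  "smoothness \<Rightarrow> 'e topology \<Rightarrow> 'v::real_vector linspace \<Rightarrow> ('e, 'v) chart set \<Rightarrow> bool" where
  "Ck_atlas k E C \<A> \<longleftrightarrow>
     (\<forall>c\<in>\<A>. Ck_chart E C c) \<and>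
     (\<forall>c\<in>\<A>. \<forall>c'\<in>\<A>. Ck_compatible k C c c') \<and>
     (\<Union>(U, V, \<phi>)\<in>\<A>. U) = topspace E \<and>
     (\<exists>(U, V, \<phi>)\<in>\<A>. \<exists>x\<in>pts (ambient C). \<exists>r>0. mball_of (fmetric (ambient C)) x r \<subseteq> V)"

definition m_chart :: "'e model \<Rightarrow> 'c model \<Rightarrow> ('e, 'c) chart \<Rightarrow> bool" where
  "m_chart E C = (\<lambda>(U, V, \<phi>).
     U \<in> nbds E \<and> V \<in> nbds C \<and> model_homeo (restrict_model E U) (restrict_model C V) \<phi>)"

definition m_compatible :: "'c model \<Rightarrow> ('e, 'c) chart \<Rightarrow> ('e, 'c) chart \<Rightarrow> bool" where
  "m_compatible C = (\<lambda>(U, V, \<phi>) (U', V', \<phi>').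
     U \<inter> U' = {} \<or>
     model_iso C (\<phi> ` (U \<inter> U')) (\<phi>' ` (U \<inter> U')) (transition (U, V, \<phi>) (U', V', \<phi>')))"

definition m_atlas :: "'e model \<Rightarrow> 'c model \<Rightarrow> ('e, 'c) chart set \<Rightarrow> bool" where
  "m_atlas E C \<A> \<longleftrightarrow>
     model_space E \<and> model_space C \<and>
     (\<forall>c\<in>\<A>. m_chart E C c) \<and>
     (\<forall>c\<in>\<A>. \<forall>c'\<in>\<A>. m_compatible C c c') \<and>
     (\<Union>(U, V, \<phi>)\<in>\<A>. U) = topspace (mtop E)"


section \<open>Atlas morphisms\<close>

text \<open>
  The condition on a pair of charts and a point \<open>x\<close> that the two kinds of atlas morphisms share.
  \<open>OE\<^sub>1\<close>, \<open>OC\<^sub>1\<close>, \<open>OE\<^sub>2\<close>, \<open>OC\<^sub>2\<close> are the admissible sets (open sets or model neighborhoods) and \<open>isom\<close>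
  the admissible isomorphisms.
\<close>
definition local_morphism ::
  "'e set set \<Rightarrow> 'c set set \<Rightarrow> 'f set set \<Rightarrow> 'd set set \<Rightarrow> ('d set \<Rightarrow> 'd set \<Rightarrow> ('d \<Rightarrow> 'd) \<Rightarrow> bool) \<Rightarrow>
   'e set \<Rightarrow> ('e \<Rightarrow> 'f) \<Rightarrow> ('c \<Rightarrow> 'd) \<Rightarrow> ('e, 'c) chart \<Rightarrow> ('f, 'd) chart \<Rightarrow> bool" where
  "local_morphism OE\<^sub>1 OC\<^sub>1 OE\<^sub>2 OC\<^sub>2 isom E\<^sub>1 f\<^sub>0 f\<^sub>1 = (\<lambda>(U\<^sub>1, V\<^sub>1, \<phi>\<^sub>1) (U\<^sub>2, V\<^sub>2, \<phi>\<^sub>2).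
     let I = U\<^sub>1 \<inter> {x \<in> E\<^sub>1. f\<^sub>0 x \<in> U\<^sub>2} in
     \<forall>x\<in>I. \<exists>U\<^sub>1'\<in>OE\<^sub>1. \<exists>V\<^sub>1'\<in>OC\<^sub>1. \<exists>U\<^sub>2'\<in>OE\<^sub>2. \<exists>V\<^sub>2'\<in>OC\<^sub>2. \<exists>V\<^sub>2''\<in>OC\<^sub>2. \<exists>f'.
       U\<^sub>1' \<subseteq> I \<and> V\<^sub>1' \<subseteq> V\<^sub>1 \<and> U\<^sub>2' \<subseteq> U\<^sub>2 \<and> V\<^sub>2' \<subseteq> V\<^sub>2 \<and> isom V\<^sub>2' V\<^sub>2'' f' \<and>
       x \<in> U\<^sub>1' \<and> f\<^sub>1 (\<phi>\<^sub>1 x) \<in> V\<^sub>2'' \<and> f\<^sub>0 ` U\<^sub>1' \<subseteq> U\<^sub>2' \<and> \<phi>\<^sub>1 ` U\<^sub>1' \<subseteq> V\<^sub>1' \<and> f\<^sub>1 ` V\<^sub>1' \<subseteq> V\<^sub>2'' \<and>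
       \<phi>\<^sub>2 ` U\<^sub>2' \<subseteq> V\<^sub>2' \<and> (\<forall>u\<in>U\<^sub>1'. f' (\<phi>\<^sub>2 (f\<^sub>0 u)) = f\<^sub>1 (\<phi>\<^sub>1 u)))"

definition Ck_morphism ::
  "smoothness \<Rightarrow>
   ('e, 'v::real_vector) chart set \<times> 'e topology \<times> 'v linspace \<Rightarrow>
   ('f, 'w::real_vector) chart set \<times> 'f topology \<times> 'w linspace \<Rightarrow> ('e \<Rightarrow> 'f) \<times> ('v \<Rightarrow> 'w) \<Rightarrow> bool" where
  "Ck_morphism k = (\<lambda>(\<A>\<^sub>1, E\<^sub>1, C\<^sub>1) (\<A>\<^sub>2, E\<^sub>2, C\<^sub>2) (f\<^sub>0, f\<^sub>1).
     f\<^sub>0 \<in> extensional (topspace E\<^sub>1) \<and> continuous_map E\<^sub>1 E\<^sub>2 f\<^sub>0 \<and>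
     Ck_fun k C\<^sub>1 (points C\<^sub>1) C\<^sub>2 (points C\<^sub>2) f\<^sub>1 \<and>
     (\<forall>c\<^sub>1\<in>\<A>\<^sub>1. \<forall>c\<^sub>2\<in>\<A>\<^sub>2.
        local_morphism {U. openin E\<^sub>1 U} {V. openin (ltop C\<^sub>1) V} {U. openin E\<^sub>2 U} {V. openin (ltop C\<^sub>2) V}
          (\<lambda>V V'. Ck_diffeo k C\<^sub>2 V C\<^sub>2 V') (topspace E\<^sub>1) f\<^sub>0 f\<^sub>1 c\<^sub>1 c\<^sub>2))"

definition m_morphism ::
  "('e, 'c) chart set \<times> 'e model \<times> 'c model \<Rightarrow>
   ('f, 'd) chart set \<times> 'f model \<times> 'd model \<Rightarrow> ('e \<Rightarrow> 'f) \<times> ('c \<Rightarrow> 'd) \<Rightarrow> bool" where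
  "m_morphism = (\<lambda>(\<A>\<^sub>1, E\<^sub>1, C\<^sub>1) (\<A>\<^sub>2, E\<^sub>2, C\<^sub>2) (f\<^sub>0, f\<^sub>1).
     model_function E\<^sub>1 E\<^sub>2 f\<^sub>0 \<and> model_function C\<^sub>1 C\<^sub>2 f\<^sub>1 \<and>
     (\<forall>c\<^sub>1\<in>\<A>\<^sub>1. \<forall>c\<^sub>2\<in>\<A>\<^sub>2.
        local_morphism (nbds E\<^sub>1) (nbds C\<^sub>1) (nbds E\<^sub>2) (nbds C\<^sub>2) (model_iso C\<^sub>2)
          (topspace (mtop E\<^sub>1)) f\<^sub>0 f\<^sub>1 c\<^sub>1 c\<^sub>2))"


section \<open>The categories of atlases\<close>

type_synonym ('e, 'c, 'x, 'y) atlas = "('e, 'c) chart set \<times> 'x \<times> 'y"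

type_synonym ('e, 'c, 'x, 'y) atlas_arrow =
  "(('e \<Rightarrow> 'e) \<times> ('c \<Rightarrow> 'c)) \<times> ('e, 'c, 'x, 'y) atlas \<times> ('e, 'c, 'x, 'y) atlas"

text \<open>
  Objects \<open>(\<A>, E, C)\<close> and arrows \<open>((f\<^sub>0, f\<^sub>1), o\<^sub>1, o\<^sub>2)\<close>; \<open>pE\<close> and \<open>pC\<close> give the underlying point sets of the
  second and third component of an object.
\<close>
definition atlas_cat ::
  "('x \<Rightarrow> 'e set) \<Rightarrow> ('y \<Rightarrow> 'c set) \<Rightarrow> ('e, 'c, 'x, 'y) atlas set \<Rightarrow>
   (('e, 'c, 'x, 'y) atlas \<Rightarrow> ('e, 'c, 'x, 'y) atlas \<Rightarrow> ('e \<Rightarrow> 'e) \<times> ('c \<Rightarrow> 'c) \<Rightarrow> bool) \<Rightarrow>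
   (('e, 'c, 'x, 'y) atlas, ('e, 'c, 'x, 'y) atlas_arrow) cat" where
  "atlas_cat pE pC objs morph =
     \<lparr>Ob = objs,
      Arr = {(f, o\<^sub>1, o\<^sub>2). o\<^sub>1 \<in> objs \<and> o\<^sub>2 \<in> objs \<and> morph o\<^sub>1 o\<^sub>2 f},
      src = (\<lambda>(f, o\<^sub>1, o\<^sub>2). o\<^sub>1),
      tgt = (\<lambda>(f, o\<^sub>1, o\<^sub>2). o\<^sub>2),
      ident = (\<lambda>(\<A>, E, C). ((restrict id (pE E), restrict id (pC C)), (\<A>, E, C), (\<A>, E, C))),
      comp = (\<lambda>((g\<^sub>0, g\<^sub>1), o\<^sub>2, o\<^sub>3) ((f\<^sub>0, f\<^sub>1), (\<A>\<^sub>1, E\<^sub>1, C\<^sub>1), o\<^sub>2').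
        ((compose (pE E\<^sub>1) g\<^sub>0 f\<^sub>0, compose (pC C\<^sub>1) g\<^sub>1 f\<^sub>1), (\<A>\<^sub>1, E\<^sub>1, C\<^sub>1), o\<^sub>3))\<rparr>"

definition Atlk ::
  "smoothness \<Rightarrow> 'e topology set \<Rightarrow> 'v::real_vector linspace set \<Rightarrow>
   (('e, 'v, 'e topology, 'v linspace) atlas, ('e, 'v, 'e topology, 'v linspace) atlas_arrow) cat" where
  "Atlk k \<E> \<C> = atlas_cat topspace points
     {(\<A>, E, C). E \<in> \<E> \<and> C \<in> \<C> \<and> Ck_atlas k E C \<A>} (Ck_morphism k)"

definition Atl ::
  "'e model set \<Rightarrow> 'c model set \<Rightarrow>
   (('e, 'c, 'e model, 'c model) atlas, ('e, 'c, 'e model, 'c model) atlas_arrow) cat" where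
  "Atl \<E> \<C> = atlas_cat (\<lambda>E. topspace (mtop E)) (\<lambda>C. topspace (mtop C))
     {(\<A>, E, C). E \<in> \<E> \<and> C \<in> \<C> \<and> m_atlas E C \<A>} m_morphism"

definition F_ob ::
  "smoothness \<Rightarrow> ('e, 'v::real_vector, 'e topology, 'v linspace) atlas \<Rightarrow>
   ('e, 'v, 'e model, 'v model) atlas" where
  "F_ob k = (\<lambda>(\<A>, E, C). (\<A>, Triv E, Trivk k C))"

definition F_arr ::
  "smoothness \<Rightarrow> ('e, 'v::real_vector, 'e topology, 'v linspace) atlas_arrow \<Rightarrow>
   ('e, 'v, 'e model, 'v model) atlas_arrow" where
  "F_arr k = (\<lambda>((f\<^sub>0, f\<^sub>1), (\<A>\<^sub>1, E\<^sub>1, C\<^sub>1), (\<A>\<^sub>2, E\<^sub>2, C\<^sub>2)).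
     ((f\<^sub>0, f\<^sub>1), (\<A>\<^sub>1, Triv E\<^sub>1, Trivk k C\<^sub>1), (\<A>\<^sub>2, Triv E\<^sub>2, Trivk k C\<^sub>2)))"

end

theory Submission
  imports Defs
begin

text \<open>
  The functor changes no underlying data: it only reads a space \<open>E\<close> as \<open>Triv E\<close> and a
  linear space \<open>C\<close> as \<open>Trivk k C\<close>. Since the model neighborhoods of both are exactly the open sets,
  model functions between them are the continuous functions, and the isomorphisms of \<open>Trivk k C\<close>
  are the \<open>C\<^sup>k\<close> diffeomorphisms between open sets. So charts, compatibility and
  the local condition on morphisms translate word for word (\<open>m_atlas_Triv\<close>, \<open>m_morphism_Triv\<close>),
  and identities and composites are formed in the same way on both sides. Identities are
  morphisms because transition functions serve as the required local isomorphisms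
  (\<open>local_morphism_identity\<close>).

  The substance lies in the claim that \<open>Trivk k C\<close> is a model space at all (\<open>model_space_Trivk\<close>), and there
  in closure under composition: the chain rule for \<open>C\<^sup>k\<close> functions between Frechet spaces, with all three
  refinements of the definition: continuity in the norm between normed spaces, complex linearity
  between complex spaces, and real analyticity by complexification.

  The chain rule rests on three facts. First, a mean value theorem for convex sets
  (\<open>mean_value_convex\<close>), proved by bisection, turns joint continuity of the directional derivatives into joint
  convergence of difference quotients, in which points, directions and increments may all move
  (\<open>deriv_joint\<close>). Secondly, this makes the iterated derivatives multilinear (\<open>D_add\<close>,
  \<open>D_scale\<close>). Thirdly, the iterated derivatives of a composite can be written down explicitly: the formula of
  Faa di Bruno is a sum over set partitions of the list of directions, and the recursion
  that inserts a new direction into a partition is the Leibniz rule for one term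
  (\<open>deriv_summand\<close>). For norm continuity, each term is followed along moving bounded directions,
  using that continuous multilinear maps are bounded (\<open>norm_continuous_Dcomp\<close>). A real
  analytic composite is extended by the composite of the holomorphic extensions, to which the
  chain rule for \<open>C\<^sup>1\<close> functions applies (\<open>smooth_on_compose_locally\<close>).
\<close>


section \<open>Limits and the mean value theorem in locally convex spaces\<close>

text \<open>
  What the calculus below uses of a Frechet space. The notion is stable under passing to
  \<^const>\<open>complexify\<close>, which is how real analytic functions are reached.
\<close>
locale metrizable_lcs =
  fixes X :: "'v::real_vector frechet"
  assumes subspace_pts: "subspace (pts X)"
    and mdist_translate: "\<lbrakk>x \<in> pts X; y \<in> pts X; z \<in> pts X\<rbrakk> \<Longrightarrow>
      mdist (fmetric X) (x + z) (y + z) = mdist (fmetric X) x y"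
    and continuous_scale:
      "continuous_map (prod_topology euclideanreal (ftop X)) (ftop X) (\<lambda>(a, x). a *\<^sub>R x)"
    and small_convex: "r > 0 \<Longrightarrow>
      \<exists>K. openin (ftop X) K \<and> convex K \<and> 0 \<in> K \<and> K \<subseteq> mball_of (fmetric X) 0 r"
begin

sublocale M: Metric_space "pts X" "mdist (fmetric X)"
  by (rule Metric_space_mspace_mdist)

lemma zero_pts [simp, intro]: "0 \<in> pts X"
  and add_pts [simp, intro]: "x \<in> pts X \<Longrightarrow> y \<in> pts X \<Longrightarrow> x + y \<in> pts X"
  and scale_pts [simp, intro]: "x \<in> pts X \<Longrightarrow> a *\<^sub>R x \<in> pts X"
  and diff_pts [simp, intro]: "x \<in> pts X \<Longrightarrow> y \<in> pts X \<Longrightarrow> x - y \<in> pts X"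
  using subspace_pts by (auto simp: subspace_0 subspace_add subspace_scale subspace_diff)

lemma lim_iff:
  "limitin (ftop X) f l F \<longleftrightarrow>
     l \<in> pts X \<and> (\<forall>\<epsilon>>0. \<forall>\<^sub>F i in F. f i \<in> pts X \<and> mdist (fmetric X) (f i) l < \<epsilon>)"
  by (simp add: mtopology_of_def M.limitin_metric)

lemma lim_pts: "limitin (ftop X) f l F \<Longrightarrow> l \<in> pts X"
  and lim_eventually_pts: "limitin (ftop X) f l F \<Longrightarrow> \<forall>\<^sub>F i in F. f i \<in> pts X"
  using limitin_topspace[of "ftop X" f l F] limitinD[of "ftop X" f l F "pts X"]
    openin_topspace[of "ftop X"] by auto

lemma lim_unique:
  "\<lbrakk>limitin (ftop X) f l F; limitin (ftop X) f m F; F \<noteq> bot\<rbrakk> \<Longrightarrow> l = m"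
  by (metis M.limitin_metric_unique mtopology_of_def)

lemma lim_cong:
  "\<lbrakk>limitin (ftop X) f l F; \<forall>\<^sub>F i in F. f i = g i; l = m\<rbrakk> \<Longrightarrow> limitin (ftop X) g m F"
  using limitin_transform_eventually[of f g F] by simp

lemma mdist_add_le:
  assumes "x \<in> pts X" "y \<in> pts X" "a \<in> pts X" "b \<in> pts X"
  shows "mdist (fmetric X) (x + y) (a + b) \<le> mdist (fmetric X) x a + mdist (fmetric X) y b"
proof -
  have "mdist (fmetric X) (x + y) (a + b)
      \<le> mdist (fmetric X) (x + y) (a + y) + mdist (fmetric X) (a + y) (a + b)"
    using assms by (intro M.triangle) auto
  also have "mdist (fmetric X) (x + y) (a + y) = mdist (fmetric X) x a"
    using assms by (simp add: mdist_translate)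
  also have "mdist (fmetric X) (a + y) (a + b) = mdist (fmetric X) y b"
    using assms mdist_translate[of y b a] by (simp add: add.commute)
  finally show ?thesis by simp
qed

lemma lim_add:
  assumes f: "limitin (ftop X) f a F" and g: "limitin (ftop X) g b F"
  shows "limitin (ftop X) (\<lambda>i. f i + g i) (a + b) F"
proof -
  have "\<forall>\<^sub>F i in F. f i + g i \<in> pts X \<and> mdist (fmetric X) (f i + g i) (a + b) < \<epsilon>"
    if "\<epsilon> > 0" for \<epsilon>
  proof -
    have "\<forall>\<^sub>F i in F. f i \<in> pts X \<and> mdist (fmetric X) (f i) a < \<epsilon> / 2"
      and "\<forall>\<^sub>F i in F. g i \<in> pts X \<and> mdist (fmetric X) (g i) b < \<epsilon> / 2"
      using f g \<open>\<epsilon> > 0\<close> unfolding lim_iff by (meson half_gt_zero)+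
    then show ?thesis
    proof eventually_elim
      case (elim i)
      then show ?case
        using mdist_add_le[of "f i" "g i" a b] lim_pts[OF f] lim_pts[OF g] by auto
    qed
  qed
  then show ?thesis
    using lim_pts[OF f] lim_pts[OF g] by (simp add: lim_iff)
qed

lemma lim_scale:
  assumes c: "(c \<longlongrightarrow> c0) F" and f: "limitin (ftop X) f a F"
  shows "limitin (ftop X) (\<lambda>i. c i *\<^sub>R f i) (c0 *\<^sub>R a) F"
proof -
  have "limitin (prod_topology euclideanreal (ftop X)) (\<lambda>i. (c i, f i)) (c0, a) F"
    using c f by (simp add: limitin_pairwise o_def)
  from continuous_map_limit[OF continuous_scale this] show ?thesis
    by (simp add: o_def)
qed

lemma lim_minus: "limitin (ftop X) f a F \<Longrightarrow> limitin (ftop X) (\<lambda>i. - f i) (- a) F"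
  using lim_scale[OF tendsto_const, of f a F "-1"] by simp

lemma lim_diff:
  "\<lbrakk>limitin (ftop X) f a F; limitin (ftop X) g b F\<rbrakk> \<Longrightarrow>
    limitin (ftop X) (\<lambda>i. f i - g i) (a - b) F"
  using lim_add[OF _ lim_minus, of f a F g b] by simp

lemma lim_sum_list:
  "(\<And>B. B \<in> set Bs \<Longrightarrow> limitin (ftop X) (f B) (l B) F) \<Longrightarrow>
    limitin (ftop X) (\<lambda>i. \<Sum>B\<leftarrow>Bs. f B i) (\<Sum>B\<leftarrow>Bs. l B) F"
  by (induction Bs) (auto intro: lim_add)

lemma lim_diff_zero:
  assumes "limitin (ftop X) (\<lambda>i. f i - a) 0 F" "a \<in> pts X"
  shows "limitin (ftop X) f a F"
  using lim_add[OF assms(1), of "\<lambda>_. a" a] assms(2) by simp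

text \<open>
  Convergence may be tested on convex neighborhoods of zero, the form in which the mean value theorem
  delivers its estimates.
\<close>
lemma limI_convex:
  assumes l: "l \<in> pts X" and ev: "\<forall>\<^sub>F i in F. f i \<in> pts X"
    and K: "\<And>K. \<lbrakk>openin (ftop X) K; convex K; 0 \<in> K\<rbrakk> \<Longrightarrow> \<forall>\<^sub>F i in F. f i - l \<in> K"
  shows "limitin (ftop X) f l F"
proof (rule lim_diff_zero[OF _ l], unfold lim_iff, intro conjI allI impI)
  fix \<epsilon> :: real assume "\<epsilon> > 0"
  then obtain K where "openin (ftop X) K" "convex K" "0 \<in> K" "K \<subseteq> mball_of (fmetric X) 0 \<epsilon>"
    using small_convex by blast
  moreover from K[OF this(1-3)]
  show "\<forall>\<^sub>F i in F. f i - l \<in> pts X \<and> mdist (fmetric X) (f i - l) 0 < \<epsilon>"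
    by eventually_elim (use \<open>K \<subseteq> _\<close> in \<open>auto simp: M.commute\<close>)
qed simp

text \<open>
  The mean value theorem for convex sets, by bisection: if both halves of an interval have a
  difference quotient in the convex set \<open>y + K\<close>, then so has the interval, their average; and
  on small intervals around a point the quotient is an average of two quotients close to the
  derivative there. The point \<open>y\<close> is the value around which quotients are to be controlled; it is kept
  apart from \<open>K\<close> because convex neighborhoods are at hand only around zero.
\<close>
lemma mean_value_convex:
  fixes \<phi> :: "real \<Rightarrow> 'v"
  assumes K: "openin (ftop X) K" "convex K" and "a < b"
    and \<phi>: "\<And>\<tau>. \<tau> \<in> {a..b} \<Longrightarrow> limitin (ftop X) (\<lambda>t. (1 / t) *\<^sub>R (\<phi> (\<tau> + t) - \<phi> \<tau>)) (\<phi>' \<tau>) (at 0)"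
    and in_K: "\<And>\<tau>. \<tau> \<in> {a..b} \<Longrightarrow> \<phi>' \<tau> - y \<in> K" and y: "y \<in> pts X"
  shows "(1 / (b - a)) *\<^sub>R (\<phi> b - \<phi> a) - y \<in> K"
proof -
  define q where "q s t = (1 / (t - s)) *\<^sub>R (\<phi> t - \<phi> s) - y" for s t
  have join: "q r t \<in> K" if "q r s \<in> K" "q s t \<in> K" "r < s" "s < t" for r s t
  proof -
    have "q r t = ((s - r) / (t - r)) *\<^sub>R q r s + ((t - s) / (t - r)) *\<^sub>R q s t"
    proof -
      have "y = ((s - r) / (t - r)) *\<^sub>R y + ((t - s) / (t - r)) *\<^sub>R y"
        using that by (simp flip: scaleR_add_left add_divide_distrib)
      moreover have "(1 / (t - r)) *\<^sub>R (\<phi> t - \<phi> r) =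
          ((s - r) / (t - r)) *\<^sub>R (1 / (s - r)) *\<^sub>R (\<phi> s - \<phi> r) +
          ((t - s) / (t - r)) *\<^sub>R (1 / (t - s)) *\<^sub>R (\<phi> t - \<phi> s)"
        using that by (simp flip: scaleR_add_right)
      ultimately show ?thesis
        unfolding q_def scaleR_diff_right by (simp add: algebra_simps)
    qed
    then show ?thesis
      using convexD[OF K(2) that(1,2), of "(s - r) / (t - r)" "(t - s) / (t - r)"] that
      by (simp flip: add_divide_distrib)
  qed
  have "a \<le> s \<and> s < t \<and> t \<le> b \<longrightarrow> q s t \<in> K" if "s \<le> t" for s t
    using that
  proof (induction rule: Bolzano)
    case (trans r s t)
    then show ?case using join[of r s t] by (cases "r = s \<or> s = t") auto
  next
    case (local \<tau>)
    show ?case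
    proof (cases "\<tau> \<in> {a..b}")
      case True
      have "limitin (ftop X) (\<lambda>t. (1 / t) *\<^sub>R (\<phi> (\<tau> + t) - \<phi> \<tau>) - y) (\<phi>' \<tau> - y) (at 0)"
        using \<phi>[OF True] y by (intro lim_diff) auto
      then have "\<forall>\<^sub>F t in at 0. (1 / t) *\<^sub>R (\<phi> (\<tau> + t) - \<phi> \<tau>) - y \<in> K"
        using K(1) in_K[OF True] by (rule limitinD)
      then obtain d where "d > 0" and
        d: "\<And>t. t \<noteq> 0 \<Longrightarrow> \<bar>t\<bar> < d \<Longrightarrow> (1 / t) *\<^sub>R (\<phi> (\<tau> + t) - \<phi> \<tau>) - y \<in> K"
        by (auto simp: eventually_at)
      have right: "q \<tau> t \<in> K" if "\<tau> < t" "t - \<tau> < d" for t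
        using d[of "t - \<tau>"] that by (simp add: q_def)
      have left: "q t \<tau> \<in> K" if "t < \<tau>" "\<tau> - t < d" for t
      proof -
        have "(1 / (\<tau> - t)) *\<^sub>R (\<phi> \<tau> - \<phi> t) = (1 / (t - \<tau>)) *\<^sub>R (\<phi> t - \<phi> \<tau>)"
          by (metis (no_types, lifting) minus_diff_eq minus_divide_right scaleR_minus_left
              scaleR_minus_right)
        then show ?thesis using d[of "t - \<tau>"] that by (simp add: q_def)
      qed
      have "q s t \<in> K" if "s \<le> \<tau>" "\<tau> \<le> t" "t - s < d" "s < t" for s t
        using that join[OF left right, of s t] left[of s] right[of t]
        by (cases "s = \<tau>"; cases "t = \<tau>") auto
      with \<open>d > 0\<close> show ?thesis by blast
    next
      case False
      then show ?thesis by (intro exI[of _ 1]) auto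
    qed
  qed
  from this[of a b] \<open>a < b\<close> show ?thesis by (simp add: q_def)
qed

end

lemma frechet_space_metrizable_lcs: "frechet_space X \<Longrightarrow> metrizable_lcs X"
  by (simp add: frechet_space_def metrizable_lcs_def)


section \<open>Iterated directional derivatives\<close>

text \<open>
  A list of convergent families, each paired with its limit. Keeping a family and its limit together
  lets one list operation act on both at once; this is what makes the block structure of
  the higher chain rule commute with passing to the limit.
\<close>
definition lim_family :: "'v topology \<Rightarrow> 'i filter \<Rightarrow> (('i \<Rightarrow> 'v) \<times> 'v) list \<Rightarrow> bool" where
  "lim_family T F ps \<longleftrightarrow> (\<forall>(u, h)\<in>set ps. limitin T u h F)"

abbreviation vals :: "(('i \<Rightarrow> 'v) \<times> 'v) list \<Rightarrow> 'i \<Rightarrow> 'v list" where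
  "vals ps i \<equiv> map (\<lambda>p. fst p i) ps"

lemma lim_family_simps [simp]:
  "lim_family T F []"
  "lim_family T F (p # ps) \<longleftrightarrow> limitin T (fst p) (snd p) F \<and> lim_family T F ps"
  "lim_family T F (ps @ qs) \<longleftrightarrow> lim_family T F ps \<and> lim_family T F qs"
  by (auto simp: lim_family_def)

lemma lim_family_const: "set hs \<subseteq> topspace T \<Longrightarrow> lim_family T F (map (\<lambda>h. (\<lambda>_. h, h)) hs)"
  by (auto simp: lim_family_def)

lemma lim_family_nth:
  "lim_family T F ps \<Longrightarrow> j < length ps \<Longrightarrow> limitin T (fst (ps ! j)) (snd (ps ! j)) F"
  unfolding lim_family_def by (metis (no_types, lifting) case_prod_unfold nth_mem)

context metrizable_lcs
begin

lemma lim_line: "x \<in> pts X \<Longrightarrow> h \<in> pts X \<Longrightarrow> limitin (ftop X) (\<lambda>t. x + t *\<^sub>R h) x (at (0::real))"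
  using lim_add[of "\<lambda>_. x" x "at (0::real)", OF _ lim_scale[OF tendsto_ident_at, of "\<lambda>_. h" h]]
  by simp

lemma lim_family_pts: "lim_family (ftop X) F ps \<Longrightarrow> map snd ps \<in> lists (pts X)"
  by (induction ps) (auto dest: lim_pts)

lemma lim_family_eventually_pts:
  "lim_family (ftop X) F ps \<Longrightarrow> \<forall>\<^sub>F i in F. vals ps i \<in> lists (pts X)"
  by (induction ps) (auto dest: lim_eventually_pts intro: eventually_conj)

end

text \<open>
  The directional derivatives \<open>D [h\<^sub>n, \<dots>, h\<^sub>1]\<close> of all orders up to \<open>k\<close> of one function, with the
  conditions from \<^const>\<open>diff_on\<close> that make sense between arbitrary spaces.
\<close>
locale derivative_tower = X: metrizable_lcs X + Y: metrizable_lcs Y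
  for X :: "'v::real_vector frechet" and Y :: "'w::real_vector frechet" +
  fixes k :: enat and W :: "'v set" and D :: "'v list \<Rightarrow> 'v \<Rightarrow> 'w"
  assumes open_W: "openin (ftop X) W"
    and deriv: "\<lbrakk>hs \<in> lists (pts X); h \<in> pts X; x \<in> W; enat (length hs) < k\<rbrakk> \<Longrightarrow>
      limitin (ftop Y) (\<lambda>t. (1 / t) *\<^sub>R (D hs (x + t *\<^sub>R h) - D hs x)) (D (h # hs) x) (at 0)"
    and cont: "enat n \<le> k \<Longrightarrow> continuous_map
      (prod_topology (subtopology (ftop X) W) (product_topology (\<lambda>_. ftop X) {..<n}))
      (ftop Y) (\<lambda>(x, h). D (map h [0..<n]) x)"
begin

lemma W_pts: "x \<in> W \<Longrightarrow> x \<in> pts X"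
  using openin_subset[OF open_W] by auto

text \<open>
  Joint continuity, in the form in which it is used: along any filter, points and directions may move
  together.
\<close>
lemma D_lim:
  assumes ps: "lim_family (ftop X) F ps" and x: "limitin (ftop X) x' x F" "x \<in> W"
    and len: "enat (length ps) \<le> k"
  shows "limitin (ftop Y) (\<lambda>i. D (vals ps i) (x' i)) (D (map snd ps) x) F"
proof -
  define n where "n = length ps"
  have "limitin (product_topology (\<lambda>_. ftop X) {..<n})
      (\<lambda>i. restrict (\<lambda>j. vals ps i ! j) {..<n}) (restrict (\<lambda>j. map snd ps ! j) {..<n}) F"
    unfolding limitin_componentwise
  proof (intro conjI ballI)
    show "\<forall>\<^sub>F i in F. restrict (\<lambda>j. vals ps i ! j) {..<n}
        \<in> topspace (product_topology (\<lambda>_. ftop X) {..<n})"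
      using X.lim_family_eventually_pts[OF ps]
      by eventually_elim (auto simp: n_def)
    show "limitin (ftop X) (\<lambda>i. restrict (\<lambda>j. vals ps i ! j) {..<n} j)
        (restrict (\<lambda>j. map snd ps ! j) {..<n} j) F" if "j \<in> {..<n}" for j
      using that lim_family_nth[OF ps, of j] by (simp add: n_def)
  qed auto
  moreover have "limitin (subtopology (ftop X) W) x' x F"
    using x limitinD[OF x(1) open_W] by (simp add: limitin_subtopology)
  ultimately have "limitin
      (prod_topology (subtopology (ftop X) W) (product_topology (\<lambda>_. ftop X) {..<n}))
      (\<lambda>i. (x' i, restrict (\<lambda>j. vals ps i ! j) {..<n}))
      (x, restrict (\<lambda>j. map snd ps ! j) {..<n}) F"
    by (simp add: limitin_pairwise o_def)
  note lim = continuous_map_limit[OF cont this]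
  have restr: "map (restrict (\<lambda>j. xs ! j) {..<n}) [0..<n] = xs" if "length xs = n" for xs :: "'v list"
    using that by (intro nth_equalityI) auto
  show ?thesis
    using lim len by (simp add: o_def restr flip: n_def)
qed

lemma D_pts:
  assumes "hs \<in> lists (pts X)" "x \<in> W" "enat (length hs) \<le> k"
  shows "D hs x \<in> pts Y"
proof -
  have "lim_family (ftop X) (at (0::real)) (map (\<lambda>h. (\<lambda>_. h, h)) hs)"
    using assms by (intro lim_family_const) auto
  from D_lim[OF this, of "\<lambda>_. x" x] assms W_pts show ?thesis
    by (auto simp: o_def dest: Y.lim_pts)
qed

text \<open>
  Differentiability is uniform: base point, directions and increment may vary simultaneously.
  Along the segment from \<open>x'\<close> to \<open>x' + t h'\<close> the derivative stays close to its limit by joint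
  continuity, so the mean value theorem controls the difference quotient.
\<close>
lemma deriv_joint:
  assumes ps: "lim_family (ftop X) F ps" and x: "limitin (ftop X) x' x F" "x \<in> W"
    and h: "limitin (ftop X) h' h F" and t: "(t \<longlongrightarrow> 0) F" "\<forall>\<^sub>F i in F. t i \<noteq> 0"
    and len: "enat (length ps) < k"
  shows "limitin (ftop Y)
    (\<lambda>i. (1 / t i) *\<^sub>R (D (vals ps i) (x' i + t i *\<^sub>R h' i) - D (vals ps i) (x' i)))
    (D (h # map snd ps) x) F" (is "limitin _ ?q ?l F")
proof -
  have len': "enat (Suc (length ps)) \<le> k" and len'': "enat (length ps) \<le> k"
    using len Suc_ile_eq by (auto simp: less_imp_le)
  have hx: "limitin (ftop X) (\<lambda>i. x' i + \<tau> i *\<^sub>R h' i) x F" if "(\<tau> \<longlongrightarrow> 0) F" for \<tau>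
    using X.lim_add[OF x(1) X.lim_scale[OF that h]] by simp
  have hps: "lim_family (ftop X) F ((h', h) # ps)"
    using h ps by simp
  have l: "?l \<in> pts Y"
    using D_pts[of "h # map snd ps" x] X.lim_family_pts[OF ps] X.lim_pts[OF h] x len' by auto
  have xt: "\<forall>\<^sub>F i in F. x' i + t i *\<^sub>R h' i \<in> W" and x0: "\<forall>\<^sub>F i in F. x' i \<in> W"
    using limitinD[OF hx[OF t(1)] open_W] limitinD[OF x(1) open_W] x by auto
  note ev_pts = X.lim_family_eventually_pts[OF ps] X.lim_eventually_pts[OF h]
  show ?thesis
  proof (rule Y.limI_convex[OF l])
    show "\<forall>\<^sub>F i in F. ?q i \<in> pts Y"
      using xt x0 ev_pts(1)
    proof eventually_elim
      case (elim i)
      then show ?case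
        using D_pts[of "vals ps i"] len'' by (intro Y.scale_pts Y.diff_pts) auto
    qed
    fix K assume K: "openin (ftop Y) K" "convex K" "0 \<in> K"
    define good where "good i \<tau> \<longleftrightarrow> x' i + \<tau> *\<^sub>R h' i \<in> W \<and>
      D (h' i # vals ps i) (x' i + \<tau> *\<^sub>R h' i) - ?l \<in> K" for i \<tau>
    have good: "\<forall>\<^sub>F i in F. \<forall>\<tau>. \<bar>\<tau>\<bar> \<le> \<bar>t i\<bar> \<longrightarrow> good i \<tau>"
    proof -
      \<comment> \<open>A bad point on the segment, wherever there is one: such points cannot occur in the limit.\<close>
      define \<tau> where "\<tau> i = (if \<exists>\<tau>. \<bar>\<tau>\<bar> \<le> \<bar>t i\<bar> \<and> \<not> good i \<tau>
        then SOME \<tau>. \<bar>\<tau>\<bar> \<le> \<bar>t i\<bar> \<and> \<not> good i \<tau> else 0)" for i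
      have \<tau>: "\<bar>\<tau> i\<bar> \<le> \<bar>t i\<bar> \<and> ((\<exists>\<tau>. \<bar>\<tau>\<bar> \<le> \<bar>t i\<bar> \<and> \<not> good i \<tau>) \<longrightarrow> \<not> good i (\<tau> i))" for i
        unfolding \<tau>_def using someI_ex[of "\<lambda>\<tau>. \<bar>\<tau>\<bar> \<le> \<bar>t i\<bar> \<and> \<not> good i \<tau>"] by auto
      have "(\<tau> \<longlongrightarrow> 0) F"
        using t(1) \<tau> by (intro Lim_null_comparison[of \<tau> "\<lambda>i. \<bar>t i\<bar>"]) (auto intro: tendsto_rabs_zero)
      note xl = hx[OF this]
      have "limitin (ftop Y) (\<lambda>i. D (h' i # vals ps i) (x' i + \<tau> i *\<^sub>R h' i) - ?l) (?l - ?l) F"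
        using D_lim[OF hps xl x(2)] len' l by (intro Y.lim_diff) auto
      then have "\<forall>\<^sub>F i in F. D (h' i # vals ps i) (x' i + \<tau> i *\<^sub>R h' i) - ?l \<in> K"
        using K by (auto intro: limitinD)
      moreover have "\<forall>\<^sub>F i in F. x' i + \<tau> i *\<^sub>R h' i \<in> W"
        using limitinD[OF xl open_W] x by auto
      ultimately show ?thesis
      proof eventually_elim
        case (elim i)
        then have "good i (\<tau> i)" by (simp add: good_def)
        with \<tau>[of i] show ?case by blast
      qed
    qed
    show "\<forall>\<^sub>F i in F. ?q i - ?l \<in> K"
      using good t(2) ev_pts
    proof eventually_elim
      case (elim i)
      let ?\<phi> = "\<lambda>\<tau>. D (vals ps i) (x' i + \<tau> *\<^sub>R h' i)"
      have \<phi>: "limitin (ftop Y) (\<lambda>s. (1 / s) *\<^sub>R (?\<phi> (\<tau> + s) - ?\<phi> \<tau>))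
          (D (h' i # vals ps i) (x' i + \<tau> *\<^sub>R h' i)) (at 0)" if "\<bar>\<tau>\<bar> \<le> \<bar>t i\<bar>" for \<tau>
      proof -
        have "x' i + \<tau> *\<^sub>R h' i \<in> W"
          using elim that by (auto simp: good_def)
        from deriv[OF _ _ this, of "vals ps i" "h' i"] elim len show ?thesis
          by (simp add: algebra_simps)
      qed
      define a b where "a = min 0 (t i)" and "b = max 0 (t i)"
      have ab: "\<bar>\<tau>\<bar> \<le> \<bar>t i\<bar>" if "\<tau> \<in> {a..b}" for \<tau>
        using that by (auto simp: a_def b_def)
      have "a < b" using elim by (auto simp: a_def b_def)
      have "(1 / (b - a)) *\<^sub>R (?\<phi> b - ?\<phi> a) - ?l \<in> K"
        using \<phi>[OF ab] elim(1) ab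
        by (intro Y.mean_value_convex[OF K(1,2) \<open>a < b\<close> _ _ l,
              where \<phi>' = "\<lambda>\<tau>. D (h' i # vals ps i) (x' i + \<tau> *\<^sub>R h' i)"])
           (auto simp: good_def)
      moreover have "(1 / (b - a)) *\<^sub>R (?\<phi> b - ?\<phi> a) = ?q i"
      proof (cases "t i > 0")
        case True
        then show ?thesis by (simp add: a_def b_def)
      next
        case False
        then have "(1 / (b - a)) *\<^sub>R (?\<phi> b - ?\<phi> a) = (- (1 / t i)) *\<^sub>R (- (?\<phi> (t i) - ?\<phi> 0))"
          using elim by (simp add: a_def b_def)
        then show ?thesis by (simp only: scaleR_minus_left scaleR_minus_right) simp
      qed
      ultimately show ?case by simp
    qed
  qed
qed

lemma eventually_line_W: "x \<in> W \<Longrightarrow> h \<in> pts X \<Longrightarrow> \<forall>\<^sub>F t in at (0::real). x + t *\<^sub>R h \<in> W"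
  using limitinD[OF X.lim_line open_W, of x h] W_pts by auto

lemma D_add_head:
  assumes "hs \<in> lists (pts X)" "h \<in> pts X" "h2 \<in> pts X" "x \<in> W" "enat (length hs) < k"
  shows "D ((h + h2) # hs) x = D (h # hs) x + D (h2 # hs) x"
proof -
  let ?ps = "map (\<lambda>h. (\<lambda>_. h, h)) hs" and ?F = "at (0::real)"
  have ps: "lim_family (ftop X) ?F ?ps"
    using assms by (intro lim_family_const) auto
  have lx: "limitin (ftop X) (\<lambda>t. x + t *\<^sub>R h) x ?F"
    using assms W_pts by (intro X.lim_line) auto
  have "limitin (ftop Y)
     (\<lambda>t. (1 / t) *\<^sub>R (D hs (x + t *\<^sub>R h + t *\<^sub>R h2) - D hs (x + t *\<^sub>R h))) (D (h2 # hs) x) ?F"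
    using deriv_joint[OF ps lx assms(4), of "\<lambda>_. h2" h2 "\<lambda>t. t"] assms
    by (simp add: o_def eventually_at_filter)
  from Y.lim_add[OF deriv[OF assms(1,2,4,5)] this]
  have "limitin (ftop Y) (\<lambda>t. (1 / t) *\<^sub>R (D hs (x + t *\<^sub>R (h + h2)) - D hs x))
      (D (h # hs) x + D (h2 # hs) x) ?F"
    by (simp add: scaleR_add_right add.assoc flip: scaleR_add_right)
  with deriv[of hs "h + h2" x] assms show ?thesis
    by (intro Y.lim_unique[of _ _ ?F]) auto
qed

lemma D_scale_head:
  assumes "hs \<in> lists (pts X)" "h \<in> pts X" "x \<in> W" "enat (length hs) < k"
  shows "D ((a *\<^sub>R h) # hs) x = a *\<^sub>R D (h # hs) x"
proof -
  let ?ps = "map (\<lambda>h. (\<lambda>_. h, h)) hs" and ?F = "at (0::real)"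
  have ps: "lim_family (ftop X) ?F ?ps"
    using assms by (intro lim_family_const) auto
  have lim: "limitin (ftop Y) (\<lambda>t. (1 / t) *\<^sub>R (D hs (x + t *\<^sub>R a *\<^sub>R h) - D hs x))
      (D ((a *\<^sub>R h) # hs) x) ?F"
    using deriv[of hs "a *\<^sub>R h" x] assms by auto
  have pts: "D (h # hs) x \<in> pts Y"
    using assms by (intro D_pts) (auto simp: Suc_ile_eq)
  show ?thesis
  proof (cases "a = 0")
    case True
    with lim have "limitin (ftop Y) (\<lambda>t::real. 0) (D ((a *\<^sub>R h) # hs) x) ?F" by simp
    from Y.lim_unique[OF this, of 0] True show ?thesis by simp
  next
    case False
    have "((\<lambda>t. t * a) \<longlongrightarrow> 0) ?F"
      by (auto intro!: tendsto_eq_intros)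
    with False have "limitin (ftop Y) (\<lambda>t. (1 / (t * a)) *\<^sub>R (D hs (x + (t * a) *\<^sub>R h) - D hs x))
        (D (h # hs) x) ?F"
      using deriv_joint[OF ps, of "\<lambda>_. x" x "\<lambda>_. h" h "\<lambda>t. t * a"] assms W_pts
      by (simp add: o_def eventually_at_filter)
    from Y.lim_scale[OF tendsto_const[of a] this] False
    have "limitin (ftop Y) (\<lambda>t. (1 / t) *\<^sub>R (D hs (x + t *\<^sub>R a *\<^sub>R h) - D hs x))
        (a *\<^sub>R D (h # hs) x) ?F"
      by simp
    with lim show ?thesis
      by (intro Y.lim_unique[of _ _ ?F]) auto
  qed
qed

text \<open>
  Iterated derivatives are multilinear. In the direction of the last differentiation this is
  linearity of a first derivative; in the others it passes to the limit of the difference quotients.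
\<close>
lemma D_add:
  assumes "pre \<in> lists (pts X)" "post \<in> lists (pts X)" "h \<in> pts X" "h2 \<in> pts X" "x \<in> W"
    "enat (length pre + length post) < k"
  shows "D (pre @ (h + h2) # post) x = D (pre @ h # post) x + D (pre @ h2 # post) x"
  using assms
proof (induction pre arbitrary: x rule: list.induct)
  case Nil
  then show ?case by (simp add: D_add_head)
next
  case (Cons g pre)
  let ?q = "\<lambda>v t. (1 / t) *\<^sub>R (D (pre @ v # post) (x + t *\<^sub>R g) - D (pre @ v # post) x)"
  have lt: "enat (Suc (length pre + length post)) < k" "enat (length pre + length post) < k"
    using Cons.prems(6) by (auto elim: order.strict_trans[rotated])
  have lim: "limitin (ftop Y) (?q v) (D (g # pre @ v # post) x) (at 0)" if "v \<in> pts X" for v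
    using Cons.prems that lt by (intro deriv) auto
  have "\<forall>\<^sub>F t in at 0. x + t *\<^sub>R g \<in> W"
    using Cons.prems by (intro eventually_line_W) auto
  then have "\<forall>\<^sub>F t in at 0. ?q h t + ?q h2 t = ?q (h + h2) t"
  proof eventually_elim
    case (elim t)
    show ?case
      using Cons.IH[of x] Cons.IH[OF _ _ _ _ elim] Cons.prems lt
      by (simp add: algebra_simps flip: scaleR_add_right)
  qed
  from Y.lim_cong[OF Y.lim_add[OF lim lim] this refl] Cons.prems
  have "limitin (ftop Y) (?q (h + h2)) (D (g # pre @ h # post) x + D (g # pre @ h2 # post) x) (at 0)"
    by simp
  with lim[of "h + h2"] Cons.prems show ?case
    by (auto intro!: Y.lim_unique[of _ _ "at (0::real)"])
qed

lemma D_scale: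
  assumes "pre \<in> lists (pts X)" "post \<in> lists (pts X)" "h \<in> pts X" "x \<in> W"
    "enat (length pre + length post) < k"
  shows "D (pre @ (a *\<^sub>R h) # post) x = a *\<^sub>R D (pre @ h # post) x"
  using assms
proof (induction pre arbitrary: x rule: list.induct)
  case Nil
  then show ?case by (simp add: D_scale_head)
next
  case (Cons g pre)
  let ?q = "\<lambda>v t. (1 / t) *\<^sub>R (D (pre @ v # post) (x + t *\<^sub>R g) - D (pre @ v # post) x)"
  have lt: "enat (Suc (length pre + length post)) < k" "enat (length pre + length post) < k"
    using Cons.prems(5) by (auto elim: order.strict_trans[rotated])
  have lim: "limitin (ftop Y) (?q v) (D (g # pre @ v # post) x) (at 0)" if "v \<in> pts X" for v
    using Cons.prems that lt by (intro deriv) auto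
  have "\<forall>\<^sub>F t in at 0. x + t *\<^sub>R g \<in> W"
    using Cons.prems by (intro eventually_line_W) auto
  then have "\<forall>\<^sub>F t in at 0. a *\<^sub>R ?q h t = ?q (a *\<^sub>R h) t"
  proof eventually_elim
    case (elim t)
    show ?case
      using Cons.IH[of x] Cons.IH[OF _ _ _ elim] Cons.prems lt
      by (simp add: algebra_simps)
  qed
  from Y.lim_cong[OF Y.lim_scale[OF tendsto_const lim] this refl] Cons.prems
  have "limitin (ftop Y) (?q (a *\<^sub>R h)) (a *\<^sub>R D (g # pre @ h # post) x) (at 0)"
    by simp
  with lim[of "a *\<^sub>R h"] Cons.prems show ?case
    by (auto intro!: Y.lim_unique[of _ _ "at (0::real)"])
qed

lemma D_diff:
  assumes "pre \<in> lists (pts X)" "post \<in> lists (pts X)" "h \<in> pts X" "h2 \<in> pts X" "x \<in> W"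
    "enat (length pre + length post) < k"
  shows "D (pre @ (h - h2) # post) x = D (pre @ h # post) x - D (pre @ h2 # post) x"
  using D_add[OF assms(1,2), of "h - h2" h2 x] assms by (auto simp: algebra_simps)

end


section \<open>The higher chain rule\<close>

text \<open>
  All ways to add \<open>h\<close> to one of the blocks in \<open>Bs\<close>. A partial derivative of a term of the chain rule in one of its
  arguments is a derivative of that argument, hence adds the new direction to a block.
\<close>
primrec insert_each :: "'a \<Rightarrow> 'a list list \<Rightarrow> 'a list list list" where
  "insert_each h [] = []"
| "insert_each h (B # Bs) = ((h # B) # Bs) # map ((#) B) (insert_each h Bs)"

text \<open>
  The set partitions of a list of directions, the index set of the formula of Faa di Bruno. A new
  direction either forms a block of its own (the outer function is differentiated at
  its point) or joins an existing block (an argument is differentiated).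
\<close>
primrec partitions :: "'a list \<Rightarrow> 'a list list list" where
  "partitions [] = [[]]"
| "partitions (h # hs) = concat (map (\<lambda>Bs. ([h] # Bs) # insert_each h Bs) (partitions hs))"

text \<open>
  Forming partitions is natural in the entries. So the partitions of a list of families, evaluated at
  an index, are the partitions of the list of values.
\<close>
lemma insert_each_map:
  "insert_each (f h) (map (map f) Bs) = map (map (map f)) (insert_each h Bs)"
  by (induction Bs) (auto simp: o_def)

lemma partitions_map: "partitions (map f hs) = map (map (map f)) (partitions hs)"
  by (induction hs) (auto simp: map_concat o_def insert_each_map)

lemma insert_each_blocks:
  assumes "Bs' \<in> set (insert_each h Bs)"
  shows "length Bs' = length Bs"
    and "\<And>B. B \<in> set Bs' \<Longrightarrow> B \<in> set Bs \<or> (\<exists>B'\<in>set Bs. B = h # B')"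
  using assms by (induction Bs arbitrary: Bs') fastforce+

lemma partitions_blocks:
  assumes "Bs \<in> set (partitions hs)"
  shows "length Bs \<le> length hs"
    and "\<And>B. B \<in> set Bs \<Longrightarrow> set B \<subseteq> set hs \<and> length B \<le> length hs"
proof -
  have "length Bs \<le> length hs \<and> (\<forall>B\<in>set Bs. set B \<subseteq> set hs \<and> length B \<le> length hs)"
    using assms
  proof (induction hs arbitrary: Bs)
    case (Cons h hs)
    then obtain Bs0 where Bs0: "Bs0 \<in> set (partitions hs)"
      and Bs: "Bs = [h] # Bs0 \<or> Bs \<in> set (insert_each h Bs0)"
      by auto
    show ?case
      using Cons.IH[OF Bs0] Bs insert_each_blocks[of Bs h Bs0] by fastforce
  qed simp
  then show "length Bs \<le> length hs"
    and "\<And>B. B \<in> set Bs \<Longrightarrow> set B \<subseteq> set hs \<and> length B \<le> length hs"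
    by auto
qed

text \<open>
  Conversely, compatibility with limits of families yields continuity on the product: take the
  filter of punctured neighborhoods and the coordinate projections as families.
\<close>
lemma (in metrizable_lcs) continuous_map_by_limits:
  assumes "\<And>(F :: ('v \<times> (nat \<Rightarrow> 'v)) filter) ps x' x.
      \<lbrakk>lim_family (ftop X) F ps; length ps = n; limitin (ftop X) x' x F; x \<in> W\<rbrakk> \<Longrightarrow>
        limitin T (\<lambda>i. D (vals ps i) (x' i)) (D (map snd ps) x) F"
  shows "continuous_map
    (prod_topology (subtopology (ftop X) W) (product_topology (\<lambda>_. ftop X) {..<n})) T
    (\<lambda>(x, h). D (map h [0..<n]) x)"
  unfolding continuous_map_atin
proof
  let ?P = "product_topology (\<lambda>_::nat. ftop X) {..<n}"
  let ?T = "prod_topology (subtopology (ftop X) W) ?P"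
  fix p assume p: "p \<in> topspace ?T"
  define F where "F = atin ?T p"
  have "limitin (ftop X) (\<lambda>q. snd q j) (snd p j) F" if "j < n" for j
    unfolding F_def
  proof (rule limitin_continuous_map)
    show "continuous_map ?T (ftop X) (\<lambda>q. snd q j)"
      using continuous_map_compose[OF continuous_map_snd
          continuous_map_product_projection[of j "{..<n}" "\<lambda>_. ftop X"]] that
      by (simp add: o_def)
  qed (use p in auto)
  then have "lim_family (ftop X) F (map (\<lambda>j. (\<lambda>q. snd q j, snd p j)) [0..<n])"
    by (auto simp: lim_family_def)
  moreover have "limitin (subtopology (ftop X) W) fst (fst p) F"
    unfolding F_def by (rule limitin_continuous_map[OF continuous_map_fst p refl])
  then have "limitin (ftop X) fst (fst p) F" "fst p \<in> W"
    by (auto simp: limitin_subtopology)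
  ultimately show "limitin T (\<lambda>(x, h). D (map h [0..<n]) x)
      (case p of (x, h) \<Rightarrow> D (map h [0..<n]) x) (atin ?T p)"
    using assms[of F "map (\<lambda>j. (\<lambda>q. snd q j, snd p j)) [0..<n]" fst "fst p"]
    by (simp add: F_def o_def case_prod_unfold)
qed

lemma scaleR_sum_list: "a *\<^sub>R sum_list xs = (\<Sum>x\<leftarrow>xs. a *\<^sub>R x)" for xs :: "'a::real_vector list"
  by (induction xs) (auto simp: scaleR_add_right)

lemma sum_list_concat: "sum_list (concat xss) = (\<Sum>xs\<leftarrow>xss. sum_list xs)" for xss :: "'a::monoid_add list list"
  by (induction xss) auto

locale tower_composition =
  g: derivative_tower X Y k W Dg + f: derivative_tower Y Z k V Df
  for X :: "'u::real_vector frechet" and Y :: "'v::real_vector frechet"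
    and Z :: "'w::real_vector frechet" and k W V Dg Df +
  assumes maps_to: "x \<in> W \<Longrightarrow> Dg [] x \<in> V"
begin

text \<open>
  The term of a partition: every block is a derivative of the inner function and the blocks
  together are the directions of one derivative of the outer function.
\<close>
definition summand :: "'u list list \<Rightarrow> 'u \<Rightarrow> 'w" where
  "summand Bs x = Df (map (\<lambda>B. Dg B x) Bs) (Dg [] x)"

definition Dcomp :: "'u list \<Rightarrow> 'u \<Rightarrow> 'w" where
  "Dcomp hs x = (\<Sum>Bs\<leftarrow>partitions hs. summand Bs x)"

lemma Dcomp_Nil: "Dcomp [] x = Df [] (Dg [] x)"
  and Dcomp_single: "Dcomp [h] x = Df [Dg [h] x] (Dg [] x)"
  by (simp_all add: Dcomp_def summand_def)

lemma blocks_le: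
  assumes "Bs \<in> set (partitions hs)" "enat (length hs) \<le> k"
  shows "enat (length Bs) \<le> k" "B \<in> set Bs \<Longrightarrow> enat (length B) \<le> k"
  using partitions_blocks[OF assms(1)] assms(2) by (meson enat_ord_simps(1) order_trans)+

lemma Dcomp_lim:
  assumes ps: "lim_family (ftop X) F ps" and x: "limitin (ftop X) x' x F" "x \<in> W"
    and len: "enat (length ps) \<le> k"
  shows "limitin (ftop Z) (\<lambda>i. Dcomp (vals ps i) (x' i)) (Dcomp (map snd ps) x) F"
proof -
  have "limitin (ftop Z) (\<lambda>i. summand (map (\<lambda>P. vals P i) Ps) (x' i))
      (summand (map (map snd) Ps) x) F" if Ps: "Ps \<in> set (partitions ps)" for Ps
  proof -
    define qs where "qs = map (\<lambda>P. (\<lambda>i. Dg (vals P i) (x' i), Dg (map snd P) x)) Ps"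
    have "lim_family (ftop X) F P" if "P \<in> set Ps" for P
      using ps partitions_blocks(2)[OF Ps that] by (auto simp: lim_family_def)
    then have "limitin (ftop Y) (\<lambda>i. Dg (vals P i) (x' i)) (Dg (map snd P) x) F" if "P \<in> set Ps" for P
      using x blocks_le(2)[OF Ps len that] that by (intro g.D_lim) auto
    then have "lim_family (ftop Y) F qs"
      by (auto simp: qs_def lim_family_def)
    moreover have "limitin (ftop Y) (\<lambda>i. Dg [] (x' i)) (Dg [] x) F"
      using g.D_lim[of F "[]" x' x] x by (simp add: zero_enat_def[symmetric])
    ultimately show ?thesis
      using f.D_lim[of F qs "\<lambda>i. Dg [] (x' i)" "Dg [] x"] maps_to[OF x(2)] blocks_le[OF Ps len]
      by (simp add: summand_def qs_def o_def)
  qed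
  from f.Y.lim_sum_list[of "partitions ps", OF this] show ?thesis
    by (simp add: Dcomp_def partitions_map o_def)
qed

text \<open>
  The Leibniz rule for the multilinear form \<open>Df\<close> at a fixed point, with arguments \<open>Dg B\<close>.
  The increment is telescoped, changing one argument at a time; \<open>pre\<close> are the arguments that have
  already been moved back.
\<close>
lemma deriv_arguments:
  assumes "pre \<in> lists (pts Y)" "\<And>B. B \<in> set Bs \<Longrightarrow> B \<in> lists (pts X) \<and> enat (length B) < k"
    "h \<in> pts X" "x \<in> W" "y \<in> V" "enat (length pre + length Bs) \<le> k"
  shows "limitin (ftop Z)
    (\<lambda>t. (1 / t) *\<^sub>R (Df (pre @ map (\<lambda>B. Dg B (x + t *\<^sub>R h)) Bs) y - Df (pre @ map (\<lambda>B. Dg B x) Bs) y))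
    (\<Sum>Bs'\<leftarrow>insert_each h Bs. Df (pre @ map (\<lambda>B. Dg B x) Bs') y) (at 0)"
  using assms
proof (induction Bs arbitrary: pre rule: list.induct)
  case Nil
  then show ?case by simp
next
  case (Cons B Bs)
  let ?u = "\<lambda>t. Dg B (x + t *\<^sub>R h)" and ?rest = "\<lambda>t. map (\<lambda>B. Dg B (x + t *\<^sub>R h)) Bs"
    and ?base = "map (\<lambda>B. Dg B x) Bs"
  let ?q = "\<lambda>t. (1 / t) *\<^sub>R (?u t - Dg B x)"
  have B: "B \<in> lists (pts X)" "enat (length B) < k"
    and Bs: "\<And>B. B \<in> set Bs \<Longrightarrow> B \<in> lists (pts X) \<and> enat (length B) < k"
    using Cons.prems by auto
  have lt: "enat (length pre + length Bs) < k"
    using Cons.prems(6) by (simp add: Suc_ile_eq)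
  have pts: "Dg C x' \<in> pts Y" if "C \<in> insert B (set Bs)" "x' \<in> W" for C x'
  proof -
    have "C \<in> lists (pts X)" "enat (length C) \<le> k"
      using Cons.prems(2)[of C] that(1) by (auto simp: less_imp_le)
    then show ?thesis using g.D_pts that(2) by blast
  qed
  have lx: "limitin (ftop X) (\<lambda>t. x + t *\<^sub>R h) x (at (0::real))"
    using Cons.prems g.W_pts by (intro g.X.lim_line) auto
  have W: "\<forall>\<^sub>F t in at 0. x + t *\<^sub>R h \<in> W"
    using Cons.prems by (intro g.eventually_line_W) auto
  have "limitin (ftop Y) (\<lambda>t. Dg C (x + t *\<^sub>R h)) (Dg C x) (at (0::real))" if "C \<in> set Bs" for C
    using g.D_lim[OF lim_family_const lx Cons.prems(4), of C] Bs[OF that]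
    by (auto simp: o_def less_imp_le)
  then have rest: "lim_family (ftop Y) (at 0) (map (\<lambda>B. (\<lambda>t. Dg B (x + t *\<^sub>R h), Dg B x)) Bs)"
    by (auto simp: lim_family_def)
  have q: "limitin (ftop Y) ?q (Dg (h # B) x) (at 0)"
    using Cons.prems B by (intro g.deriv) auto
  have 1: "limitin (ftop Z) (\<lambda>t. Df (pre @ ?q t # ?rest t) y) (Df (pre @ Dg (h # B) x # ?base) y) (at 0)"
    using f.D_lim[of "at 0" "map (\<lambda>h. (\<lambda>_. h, h)) pre @ (?q, Dg (h # B) x) #
        map (\<lambda>B. (\<lambda>t. Dg B (x + t *\<^sub>R h), Dg B x)) Bs" "\<lambda>_. y" y]
      Cons.prems rest q f.W_pts lim_family_const[of pre "ftop Y" "at 0"]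
    by (auto simp: o_def)
  have 2: "limitin (ftop Z) (\<lambda>t. (1 / t) *\<^sub>R
      (Df (pre @ Dg B x # ?rest t) y - Df (pre @ Dg B x # ?base) y))
      (\<Sum>Bs'\<leftarrow>insert_each h Bs. Df (pre @ Dg B x # map (\<lambda>B. Dg B x) Bs') y) (at 0)"
    using Cons.IH[of "pre @ [Dg B x]"] Cons.prems pts Bs by auto
  have "\<forall>\<^sub>F t in at 0. Df (pre @ ?q t # ?rest t) y + (1 / t) *\<^sub>R
      (Df (pre @ Dg B x # ?rest t) y - Df (pre @ Dg B x # ?base) y) =
      (1 / t) *\<^sub>R (Df (pre @ ?u t # ?rest t) y - Df (pre @ Dg B x # ?base) y)"
    using W
  proof eventually_elim
    case (elim t)
    have "?rest t \<in> lists (pts Y)"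
      using pts[OF _ elim] by auto
    then have "Df (pre @ ?q t # ?rest t) y =
        (1 / t) *\<^sub>R (Df (pre @ ?u t # ?rest t) y - Df (pre @ Dg B x # ?rest t) y)"
      using Cons.prems pts[OF _ elim] pts[OF _ Cons.prems(4)] lt by (simp add: f.D_scale f.D_diff)
    then show ?case by (simp flip: scaleR_add_right)
  qed
  from f.Y.lim_cong[OF f.Y.lim_add[OF 1 2] this refl] show ?case
    by (simp add: o_def)
qed

text \<open>
  The increment of a term is split into the change of the point at constant arguments and the
  change of the arguments at constant point. The first is a difference quotient of \<open>Df\<close> with all
  data moving, the case for which \<open>deriv_joint\<close> was set up.
\<close>
lemma deriv_summand:
  assumes "\<And>B. B \<in> set Bs \<Longrightarrow> B \<in> lists (pts X) \<and> enat (length B) < k"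
    "h \<in> pts X" "x \<in> W" "enat (length Bs) < k"
  shows "limitin (ftop Z) (\<lambda>t. (1 / t) *\<^sub>R (summand Bs (x + t *\<^sub>R h) - summand Bs x))
    (summand ([h] # Bs) x + (\<Sum>Bs'\<leftarrow>insert_each h Bs. summand Bs' x)) (at 0)"
proof -
  let ?us = "\<lambda>t. map (\<lambda>B. Dg B (x + t *\<^sub>R h)) Bs" and ?base = "map (\<lambda>B. Dg B x) Bs"
  let ?q = "\<lambda>t. (1 / t) *\<^sub>R (Dg [] (x + t *\<^sub>R h) - Dg [] x)"
  have lx: "limitin (ftop X) (\<lambda>t. x + t *\<^sub>R h) x (at (0::real))"
    using assms g.W_pts by (intro g.X.lim_line) auto
  have "limitin (ftop Y) (\<lambda>t. Dg B (x + t *\<^sub>R h)) (Dg B x) (at (0::real))" if "B \<in> set Bs" for B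
    using g.D_lim[OF lim_family_const lx assms(3), of B] assms(1)[OF that]
    by (auto simp: o_def less_imp_le)
  then have us: "lim_family (ftop Y) (at 0) (map (\<lambda>B. (\<lambda>t. Dg B (x + t *\<^sub>R h), Dg B x)) Bs)"
    by (auto simp: lim_family_def)
  have k: "enat 0 < k"
    using assms(4) by (metis enat_ord_simps(1) le0 order.strict_trans1)
  have q: "limitin (ftop Y) ?q (Dg [h] x) (at 0)"
    using assms k by (intro g.deriv) auto
  have y: "Dg [] x \<in> V" "Dg [] x \<in> pts Y"
    using maps_to[OF assms(3)] f.W_pts by auto
  have "limitin (ftop Z) (\<lambda>t. (1 / t) *\<^sub>R (Df (?us t) (Dg [] x + t *\<^sub>R ?q t) - Df (?us t) (Dg [] x)))
      (summand ([h] # Bs) x) (at 0)"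
    using f.deriv_joint[OF us _ y(1) q tendsto_ident_at, of "\<lambda>_. Dg [] x"] y assms(4)
    by (simp add: summand_def o_def eventually_at_filter)
  moreover have "limitin (ftop Z) (\<lambda>t. (1 / t) *\<^sub>R (Df (?us t) (Dg [] x) - Df ?base (Dg [] x)))
      (\<Sum>Bs'\<leftarrow>insert_each h Bs. summand Bs' x) (at 0)"
    using deriv_arguments[of "[]" Bs h x "Dg [] x"] assms y by (simp add: summand_def less_imp_le)
  ultimately have "limitin (ftop Z)
      (\<lambda>t. (1 / t) *\<^sub>R (Df (?us t) (Dg [] x + t *\<^sub>R ?q t) - Df (?us t) (Dg [] x)) +
        (1 / t) *\<^sub>R (Df (?us t) (Dg [] x) - Df ?base (Dg [] x)))
      (summand ([h] # Bs) x + (\<Sum>Bs'\<leftarrow>insert_each h Bs. summand Bs' x)) (at 0)"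
    by (rule f.Y.lim_add)
  then show ?thesis
    by (rule f.Y.lim_cong)
       (auto simp: eventually_at_filter summand_def simp flip: scaleR_add_right)
qed

text \<open>
  The chain rule: the Faa di Bruno sums are the iterated derivatives of the composite, since the
  recursion for partitions mirrors the Leibniz rule for one term.
\<close>
sublocale comp: derivative_tower X Z k W Dcomp
proof
  show "openin (ftop X) W" by (rule g.open_W)
  show "limitin (ftop Z) (\<lambda>t. (1 / t) *\<^sub>R (Dcomp hs (x + t *\<^sub>R h) - Dcomp hs x)) (Dcomp (h # hs) x) (at 0)"
    if hs: "hs \<in> lists (pts X)" "h \<in> pts X" "x \<in> W" "enat (length hs) < k" for hs h x
  proof -
    have "limitin (ftop Z) (\<lambda>t. (1 / t) *\<^sub>R (summand Bs (x + t *\<^sub>R h) - summand Bs x))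
        (summand ([h] # Bs) x + (\<Sum>Bs'\<leftarrow>insert_each h Bs. summand Bs' x)) (at 0)"
      if Bs: "Bs \<in> set (partitions hs)" for Bs
      using partitions_blocks[OF Bs] hs
      by (intro deriv_summand) (auto elim: order.strict_trans1[rotated])
    then have lim: "limitin (ftop Z)
        (\<lambda>t. \<Sum>Bs\<leftarrow>partitions hs. (1 / t) *\<^sub>R (summand Bs (x + t *\<^sub>R h) - summand Bs x))
        (\<Sum>Bs\<leftarrow>partitions hs. summand ([h] # Bs) x + (\<Sum>Bs'\<leftarrow>insert_each h Bs. summand Bs' x)) (at 0)"
      by (rule f.Y.lim_sum_list)
    have "(\<Sum>Bs\<leftarrow>partitions hs. (1 / t) *\<^sub>R (summand Bs (x + t *\<^sub>R h) - summand Bs x)) =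
        (1 / t) *\<^sub>R (Dcomp hs (x + t *\<^sub>R h) - Dcomp hs x)" for t
      by (simp add: Dcomp_def scaleR_sum_list o_def flip: sum_list_subtractf)
    moreover have "(\<Sum>Bs\<leftarrow>partitions hs. summand ([h] # Bs) x + (\<Sum>Bs'\<leftarrow>insert_each h Bs. summand Bs' x)) =
        Dcomp (h # hs) x"
      by (simp add: Dcomp_def map_concat sum_list_concat o_def)
    ultimately show ?thesis
      using lim by simp
  qed
  show "continuous_map (prod_topology (subtopology (ftop X) W) (product_topology (\<lambda>_. ftop X) {..<n}))
      (ftop Z) (\<lambda>(x, h). Dcomp (map h [0..<n]) x)" if "enat n \<le> k" for n
    using that by (intro g.X.continuous_map_by_limits) (auto intro: Dcomp_lim)
qed

end


section \<open>Norm continuity of derivatives\<close>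

abbreviation (in metrizable_lcs) mnorm :: "'v \<Rightarrow> real" where
  "mnorm h \<equiv> mdist (fmetric X) h 0"

definition bounded_along :: "'v::real_vector frechet \<Rightarrow> 'i filter \<Rightarrow> ('i \<Rightarrow> 'v) \<Rightarrow> bool" where
  "bounded_along X F u \<longleftrightarrow> (\<exists>C. \<forall>\<^sub>F i in F. u i \<in> pts X \<and> mdist (fmetric X) (u i) 0 \<le> C)"

context metrizable_lcs
begin

lemma lim_zero_iff:
  "limitin (ftop X) u 0 F \<longleftrightarrow> (\<forall>\<epsilon>>0. \<forall>\<^sub>F i in F. u i \<in> pts X \<and> mnorm (u i) < \<epsilon>)"
  by (simp add: lim_iff)

lemma mdist_eq_mnorm: "x \<in> pts X \<Longrightarrow> y \<in> pts X \<Longrightarrow> mdist (fmetric X) x y = mnorm (x - y)"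
  using mdist_translate[of x y "- y"] scale_pts[of y "-1"] by simp

lemma bounded_along_common:
  assumes "\<And>u. u \<in> set us \<Longrightarrow> bounded_along X F u"
  shows "\<exists>C>0. \<forall>\<^sub>F i in F. \<forall>u\<in>set us. u i \<in> pts X \<and> mnorm (u i) \<le> C"
  using assms
proof (induction us)
  case Nil
  show ?case by (intro exI[of _ 1]) simp
next
  case (Cons u us)
  from Cons obtain C where C: "C > 0" "\<forall>\<^sub>F i in F. \<forall>u\<in>set us. u i \<in> pts X \<and> mnorm (u i) \<le> C"
    by auto
  obtain C' where C': "\<forall>\<^sub>F i in F. u i \<in> pts X \<and> mnorm (u i) \<le> C'"
    using Cons.prems[of u] by (auto simp: bounded_along_def)
  have "\<forall>\<^sub>F i in F. \<forall>v\<in>set (u # us). v i \<in> pts X \<and> mnorm (v i) \<le> max C C'"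
    using C(2) C' by eventually_elim (auto simp: le_max_iff_disj)
  with C(1) show ?case by (intro exI[of _ "max C C'"]) auto
qed

lemma lim_imp_bounded: "limitin (ftop X) u l F \<Longrightarrow> bounded_along X F u"
  unfolding bounded_along_def
proof (intro exI)
  assume u: "limitin (ftop X) u l F"
  then have "\<forall>\<^sub>F i in F. u i \<in> pts X \<and> mdist (fmetric X) (u i) l < 1"
    by (simp add: lim_iff)
  then show "\<forall>\<^sub>F i in F. u i \<in> pts X \<and> mnorm (u i) \<le> 1 + mnorm l"
  proof eventually_elim
    case (elim i)
    then show ?case using M.triangle[of "u i" l 0] lim_pts[OF u] by auto
  qed
qed

lemma bounded_add:
  assumes "bounded_along X F u" "bounded_along X F v"
  shows "bounded_along X F (\<lambda>i. u i + v i)"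
proof -
  obtain C C' where "\<forall>\<^sub>F i in F. u i \<in> pts X \<and> mnorm (u i) \<le> C"
      "\<forall>\<^sub>F i in F. v i \<in> pts X \<and> mnorm (v i) \<le> C'"
    using assms by (auto simp: bounded_along_def)
  then have "\<forall>\<^sub>F i in F. u i + v i \<in> pts X \<and> mnorm (u i + v i) \<le> C + C'"
  proof eventually_elim
    case (elim i)
    then show ?case using mdist_add_le[of "u i" "v i" 0 0] by auto
  qed
  then show ?thesis by (auto simp: bounded_along_def)
qed

lemma lim_scale_bounded:
  assumes norm: "norm_metric X" and c: "(c \<longlongrightarrow> 0) F" and u: "bounded_along X F u"
  shows "limitin (ftop X) (\<lambda>i. c i *\<^sub>R u i) 0 F"
  unfolding lim_zero_iff
proof (intro allI impI)
  fix \<epsilon> :: real assume "\<epsilon> > 0"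
  obtain C where C: "C > 0" "\<forall>\<^sub>F i in F. \<forall>v\<in>set [u]. v i \<in> pts X \<and> mnorm (v i) \<le> C"
    using bounded_along_common[of "[u]" F] u by auto
  have "\<forall>\<^sub>F i in F. \<bar>c i\<bar> < \<epsilon> / C"
    using tendstoD[OF c, of "\<epsilon> / C"] \<open>\<epsilon> > 0\<close> C(1) by simp
  with C(2) show "\<forall>\<^sub>F i in F. c i *\<^sub>R u i \<in> pts X \<and> mnorm (c i *\<^sub>R u i) < \<epsilon>"
  proof eventually_elim
    case (elim i)
    then have "mnorm (c i *\<^sub>R u i) = \<bar>c i\<bar> * mnorm (u i)"
      using norm by (simp add: norm_metric_def)
    also have "\<dots> \<le> \<bar>c i\<bar> * C"
      using elim by (intro mult_left_mono) auto
    also have "\<dots> < \<epsilon>"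
      using elim(2) C(1) by (simp add: field_simps)
    finally show ?case using elim by auto
  qed
qed

end

context derivative_tower
begin

lemma D_scale_all:
  assumes "pre \<in> lists (pts X)" "hs \<in> lists (pts X)" "x \<in> W" "enat (length pre + length hs) \<le> k"
  shows "D (pre @ map ((*\<^sub>R) c) hs) x = c ^ length hs *\<^sub>R D (pre @ hs) x"
  using assms
proof (induction hs arbitrary: pre rule: list.induct)
  case (Cons h hs)
  have "D (pre @ (c *\<^sub>R h) # map ((*\<^sub>R) c) hs) x = c *\<^sub>R D (pre @ h # map ((*\<^sub>R) c) hs) x"
    using Cons.prems by (intro D_scale) (auto simp: Suc_ile_eq)
  also have "D (pre @ h # map ((*\<^sub>R) c) hs) x = c ^ length hs *\<^sub>R D (pre @ h # hs) x"
    using Cons.IH[of "pre @ [h]"] Cons.prems by simp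
  finally show ?case by simp
qed simp

text \<open>
  A continuous multilinear map is bounded: it is bounded on small arguments by continuity, and
  all arguments can be scaled by a common factor.
\<close>
lemma D_bounded:
  assumes normX: "norm_metric X" and normY: "norm_metric Y"
    and us: "\<And>u. u \<in> set us \<Longrightarrow> bounded_along X F u" and x: "x \<in> W" and len: "enat (length us) \<le> k"
  shows "bounded_along Y F (\<lambda>i. D (map (\<lambda>u. u i) us) x)"
proof -
  define n where "n = length us"
  define z where "z = D (replicate n 0) x"
  have z: "z \<in> pts Y"
    unfolding z_def using x len by (intro D_pts) (auto simp: n_def)
  \<comment> \<open>Continuity at the zero directions bounds \<open>D\<close> on small directions.\<close>
  have "\<exists>\<delta>>0. \<forall>hs\<in>lists (pts X). length hs = n \<longrightarrow> (\<forall>h\<in>set hs. X.mnorm h \<le> \<delta>) \<longrightarrow>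
      mdist (fmetric Y) (D hs x) z < 1"
  proof (rule ccontr)
    assume neg: "\<not> ?thesis"
    have "\<exists>hs\<in>lists (pts X). length hs = n \<and> (\<forall>h\<in>set hs. X.mnorm h \<le> 1 / real (Suc m)) \<and>
        \<not> mdist (fmetric Y) (D hs x) z < 1" for m
      using neg[simplified, rule_format, of "1 / real (Suc m)"] by auto
    then obtain hs where hs: "\<And>m. hs m \<in> lists (pts X)" "\<And>m. length (hs m) = n"
      "\<And>m h. h \<in> set (hs m) \<Longrightarrow> X.mnorm h \<le> 1 / real (Suc m)"
      "\<And>m. \<not> mdist (fmetric Y) (D (hs m) x) z < 1"
      by metis
    define ps where "ps = map (\<lambda>j. (\<lambda>m. hs m ! j, 0::'v)) [0..<n]"
    have "limitin (ftop X) (\<lambda>m. hs m ! j) 0 sequentially" if "j < n" for j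
      unfolding X.lim_zero_iff
    proof (intro allI impI)
      fix \<epsilon> :: real assume "\<epsilon> > 0"
      then have "\<forall>\<^sub>F m in sequentially. 1 / real (Suc m) < \<epsilon>"
        using order_tendstoD(2)[OF LIMSEQ_inverse_real_of_nat] by (simp add: inverse_eq_divide)
      then show "\<forall>\<^sub>F m in sequentially. hs m ! j \<in> pts X \<and> X.mnorm (hs m ! j) < \<epsilon>"
      proof eventually_elim
        case (elim m)
        have "hs m ! j \<in> set (hs m)" using hs(2) that by simp
        with hs(1)[of m] hs(3)[of "hs m ! j" m] elim show ?case by auto
      qed
    qed
    then have "lim_family (ftop X) sequentially ps"
      by (auto simp: lim_family_def ps_def)
    moreover have "vals ps m = hs m" for m
      using hs(2)[of m] by (intro nth_equalityI) (auto simp: ps_def)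
    moreover have "map snd ps = replicate n 0"
      by (intro nth_equalityI) (auto simp: ps_def)
    ultimately have "limitin (ftop Y) (\<lambda>m. D (hs m) x) z sequentially"
      using D_lim[of sequentially ps "\<lambda>_. x" x] x W_pts len by (simp add: z_def ps_def n_def)
    then have "\<forall>\<^sub>F m in sequentially. D (hs m) x \<in> pts Y \<and> mdist (fmetric Y) (D (hs m) x) z < 1"
      by (simp add: Y.lim_iff)
    with hs(4) show False by simp
  qed
  then obtain \<delta> where \<delta>: "\<delta> > 0" "\<And>hs. \<lbrakk>hs \<in> lists (pts X); length hs = n; \<forall>h\<in>set hs. X.mnorm h \<le> \<delta>\<rbrakk> \<Longrightarrow>
      mdist (fmetric Y) (D hs x) z < 1"
    by blast
  obtain C where C: "C > 0" "\<forall>\<^sub>F i in F. \<forall>u\<in>set us. u i \<in> pts X \<and> X.mnorm (u i) \<le> C"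
    using X.bounded_along_common[of us F] us by blast
  from C(2) have "\<forall>\<^sub>F i in F. D (map (\<lambda>u. u i) us) x \<in> pts Y \<and>
      Y.mnorm (D (map (\<lambda>u. u i) us) x) \<le> (C / \<delta>) ^ n * (1 + Y.mnorm z)"
  proof eventually_elim
    case (elim i)
    define hs where "hs = map (\<lambda>u. (\<delta> / C) *\<^sub>R u i) us"
    have hs: "hs \<in> lists (pts X)" "length hs = n"
      using elim by (auto simp: hs_def n_def)
    have "map ((*\<^sub>R) (C / \<delta>)) hs = map (\<lambda>u. u i) us"
      using \<delta>(1) C(1) by (simp add: hs_def o_def)
    then have D: "D (map (\<lambda>u. u i) us) x = (C / \<delta>) ^ n *\<^sub>R D hs x"
      using D_scale_all[of "[]" hs x "C / \<delta>"] hs x len by (simp add: n_def)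
    have Dhs: "D hs x \<in> pts Y"
      using hs x len by (intro D_pts) (auto simp: n_def)
    have "X.mnorm h \<le> \<delta>" if h: "h \<in> set hs" for h
    proof -
      obtain u where u: "u \<in> set us" "h = (\<delta> / C) *\<^sub>R u i"
        using h by (auto simp: hs_def)
      then have "X.mnorm h = \<delta> / C * X.mnorm (u i)"
        using normX elim \<delta>(1) C(1) by (simp add: norm_metric_def)
      also have "\<dots> \<le> \<delta> / C * C"
        using elim u \<delta>(1) C(1) by (intro mult_left_mono) auto
      finally show ?thesis using C(1) by simp
    qed
    then have "mdist (fmetric Y) (D hs x) z < 1"
      using \<delta>(2) hs by blast
    then have "Y.mnorm (D hs x) \<le> 1 + Y.mnorm z"
      using Y.M.triangle[of "D hs x" z 0] Dhs z by auto
    then have "(C / \<delta>) ^ n * Y.mnorm (D hs x) \<le> (C / \<delta>) ^ n * (1 + Y.mnorm z)"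
      using \<delta>(1) C(1) by (intro mult_left_mono) auto
    then show ?case
      using normY Dhs \<delta>(1) C(1) by (simp add: D norm_metric_def)
  qed
  then show ?thesis by (auto simp: bounded_along_def)
qed

text \<open>
  If one argument tends to zero, normalize it and move its norm out by homogeneity: there remains
  a bounded value times a factor that tends to zero.
\<close>
lemma D_small_argument:
  assumes normX: "norm_metric X" and normY: "norm_metric Y"
    and us: "\<And>u. u \<in> set pre \<union> set post \<Longrightarrow> bounded_along X F u"
    and e: "limitin (ftop X) e 0 F" and x: "x \<in> W" and len: "enat (length pre + length post) < k"
  shows "limitin (ftop Y) (\<lambda>i. D (map (\<lambda>u. u i) pre @ e i # map (\<lambda>u. u i) post) x) 0 F"
proof -
  \<comment> \<open>Where \<open>e\<close> vanishes, division by zero makes \<open>e'\<close> vanish too.\<close>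
  define e' where "e' i = (1 / X.mnorm (e i)) *\<^sub>R e i" for i
  have ee': "X.mnorm (e i) *\<^sub>R e' i = e i" if "e i \<in> pts X" for i
    using that by (auto simp: e'_def)
  have ev: "\<forall>\<^sub>F i in F. e i \<in> pts X"
    using e by (rule X.lim_eventually_pts)
  have "\<forall>\<^sub>F i in F. e' i \<in> pts X \<and> X.mnorm (e' i) \<le> 1"
    using ev by eventually_elim (use normX in \<open>auto simp: e'_def norm_metric_def\<close>)
  then have "bounded_along X F e'"
    by (auto simp: bounded_along_def)
  then have "bounded_along Y F (\<lambda>i. D (map (\<lambda>u. u i) (pre @ e' # post)) x)"
    using us x len by (intro D_bounded normX normY) (auto simp: Suc_ile_eq)
  moreover have "((\<lambda>i. X.mnorm (e i)) \<longlongrightarrow> 0) F"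
    using e by (auto simp: X.lim_zero_iff tendsto_iff elim!: eventually_mono)
  ultimately have lim: "limitin (ftop Y) (\<lambda>i. X.mnorm (e i) *\<^sub>R D (map (\<lambda>u. u i) (pre @ e' # post)) x) 0 F"
    using normY by (intro Y.lim_scale_bounded)
  obtain C where C: "\<forall>\<^sub>F i in F. \<forall>u\<in>set (e' # pre @ post). u i \<in> pts X \<and> X.mnorm (u i) \<le> C"
    using X.bounded_along_common[of "e' # pre @ post" F] us \<open>bounded_along X F e'\<close> by auto
  show ?thesis
  proof (rule Y.lim_cong[OF lim _ refl])
    show "\<forall>\<^sub>F i in F. X.mnorm (e i) *\<^sub>R D (map (\<lambda>u. u i) (pre @ e' # post)) x =
        D (map (\<lambda>u. u i) pre @ e i # map (\<lambda>u. u i) post) x"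
      using ev C
    proof eventually_elim
      case (elim i)
      have "map (\<lambda>u. u i) pre \<in> lists (pts X)" "map (\<lambda>u. u i) post \<in> lists (pts X)" "e' i \<in> pts X"
        using elim(2) by auto
      then show ?case
        using D_scale[of "map (\<lambda>u. u i) pre" "map (\<lambda>u. u i) post" "e' i" x "X.mnorm (e i)"]
          x len ee'[OF elim(1)] by simp
    qed
  qed
qed

text \<open>
  Telescoping, one argument at a time; \<open>pre\<close> collects the arguments that have already been exchanged.
\<close>
lemma D_close_arguments:
  assumes normX: "norm_metric X" and normY: "norm_metric Y"
    and "\<And>u. u \<in> set pre \<Longrightarrow> bounded_along X F u"
    and "\<And>u v. (u, v) \<in> set ps \<Longrightarrow> bounded_along X F v \<and> limitin (ftop X) (\<lambda>i. u i - v i) 0 F"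
    and x: "x \<in> W" and "enat (length pre + length ps) \<le> k"
  shows "limitin (ftop Y) (\<lambda>i. D (map (\<lambda>u. u i) pre @ map (\<lambda>p. fst p i) ps) x -
    D (map (\<lambda>u. u i) pre @ map (\<lambda>p. snd p i) ps) x) 0 F"
  using assms(3,4,6)
proof (induction ps arbitrary: pre)
  case Nil
  then show ?case by simp
next
  case (Cons p ps)
  obtain u v where p: "p = (u, v)" by force
  let ?pre = "\<lambda>i. map (\<lambda>u. u i) pre" and ?us = "\<lambda>i. map (\<lambda>p. fst p i) ps"
    and ?vs = "\<lambda>i. map (\<lambda>p. snd p i) ps"
  have bd: "bounded_along X F u'" if "(u', v') \<in> set (p # ps)" for u' v'
    using X.bounded_add[OF X.lim_imp_bounded, of "\<lambda>i. u' i - v' i" 0 F v'] Cons.prems(2)[OF that]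
    by simp
  have uv: "bounded_along X F u" "bounded_along X F v" "limitin (ftop X) (\<lambda>i. u i - v i) 0 F"
    using bd[of u v] Cons.prems(2)[of u v] p by auto
  have us: "bounded_along X F w" if "w \<in> set (map fst ps)" for w
    using that bd by (metis (no_types, lifting) imageE list.set_map list.set_intros(2) prod.collapse)
  have all: "bounded_along X F w" if "w \<in> set pre \<union> set (map fst ps)" for w
    using that us Cons.prems(1) by (simp only: Un_iff) blast
  have "limitin (ftop Y) (\<lambda>i. D (?pre i @ (u i - v i) # map (\<lambda>u. u i) (map fst ps)) x) 0 F"
    using Cons.prems(3) by (intro D_small_argument normX normY all uv(3) x) (simp_all add: Suc_ile_eq)
  moreover have "limitin (ftop Y) (\<lambda>i. D (?pre i @ v i # ?us i) x - D (?pre i @ v i # ?vs i) x) 0 F"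
    using Cons.IH[of "pre @ [v]"] Cons.prems uv by auto
  ultimately have lim: "limitin (ftop Y)
      (\<lambda>i. D (?pre i @ (u i - v i) # ?us i) x + (D (?pre i @ v i # ?us i) x - D (?pre i @ v i # ?vs i) x)) 0 F"
    using Y.lim_add by (fastforce simp: o_def)
  obtain C where C: "\<forall>\<^sub>F i in F. \<forall>w\<in>set (u # v # pre @ map fst ps). w i \<in> pts X \<and> X.mnorm (w i) \<le> C"
    using X.bounded_along_common[of "u # v # pre @ map fst ps" F] uv us Cons.prems(1) by auto
  have "\<forall>\<^sub>F i in F. D (?pre i @ (u i - v i) # ?us i) x + (D (?pre i @ v i # ?us i) x - D (?pre i @ v i # ?vs i) x)
      = D (?pre i @ u i # ?us i) x - D (?pre i @ v i # ?vs i) x"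
    using C
  proof eventually_elim
    case (elim i)
    then have "?pre i \<in> lists (pts X)" "?us i \<in> lists (pts X)" "u i \<in> pts X" "v i \<in> pts X"
      by (simp_all add: in_lists_conv_set ball_Un)
    then show ?case
      using D_diff[of "?pre i" "?us i" "u i" "v i" x] x Cons.prems(3) by (simp add: Suc_ile_eq)
  qed
  from Y.lim_cong[OF lim this refl] show ?case
    by (simp add: p)
qed

text \<open>
  The additional condition on maps between normed spaces: the derivatives depend continuously on
  the point, uniformly for directions in the unit ball.
\<close>
definition norm_continuous :: bool where
  "norm_continuous \<longleftrightarrow>
     (\<forall>n. enat n \<le> k \<longrightarrow> (\<forall>x\<in>W. \<forall>\<epsilon>>0. \<exists>\<delta>>0. \<forall>y\<in>W. mdist (fmetric X) x y < \<delta> \<longrightarrow>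
       (\<forall>hs\<in>lists (mcball_of (fmetric X) 0 1). length hs = n \<longrightarrow> mdist (fmetric Y) (D hs x) (D hs y) \<le> \<epsilon>)))"

text \<open>
  Uniformity on the unit ball amounts to convergence along moving bounded directions. In this
  form the condition can be carried through the terms of the chain rule.
\<close>
lemma norm_continuous_lim:
  assumes "norm_continuous" and normX: "norm_metric X" and normY: "norm_metric Y"
    and us: "\<And>u. u \<in> set us \<Longrightarrow> bounded_along X F u" and len: "enat (length us) \<le> k"
    and x: "limitin (ftop X) x' x F" "x \<in> W"
  shows "limitin (ftop Y) (\<lambda>i. D (map (\<lambda>u. u i) us) (x' i) - D (map (\<lambda>u. u i) us) x) 0 F"
  unfolding Y.lim_zero_iff
proof (intro allI impI)
  fix \<epsilon> :: real assume "\<epsilon> > 0"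
  define n where "n = length us"
  obtain C where C: "C > 0" "\<forall>\<^sub>F i in F. \<forall>u\<in>set us. u i \<in> pts X \<and> X.mnorm (u i) \<le> C"
    using X.bounded_along_common[of us F] us by blast
  have "\<epsilon> / (2 * C ^ n) > 0" using \<open>\<epsilon> > 0\<close> C by simp
  then obtain \<delta> where \<delta>: "\<delta> > 0" "\<And>y hs. \<lbrakk>y \<in> W; mdist (fmetric X) x y < \<delta>;
      hs \<in> lists (mcball_of (fmetric X) 0 1); length hs = n\<rbrakk> \<Longrightarrow>
      mdist (fmetric Y) (D hs x) (D hs y) \<le> \<epsilon> / (2 * C ^ n)"
    using assms(1) len x(2) unfolding norm_continuous_def n_def by metis
  have "\<forall>\<^sub>F i in F. x' i \<in> W"
    using limitinD[OF x(1) open_W] x by auto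
  moreover have "\<forall>\<^sub>F i in F. x' i \<in> pts X \<and> mdist (fmetric X) (x' i) x < \<delta>"
    using x(1) \<delta>(1) by (simp add: X.lim_iff)
  ultimately show "\<forall>\<^sub>F i in F. D (map (\<lambda>u. u i) us) (x' i) - D (map (\<lambda>u. u i) us) x \<in> pts Y \<and>
      Y.mnorm (D (map (\<lambda>u. u i) us) (x' i) - D (map (\<lambda>u. u i) us) x) < \<epsilon>"
    using C(2)
  proof eventually_elim
    case (elim i)
    define hs where "hs = map (\<lambda>u. (1 / C) *\<^sub>R u i) us"
    have ball: "hs \<in> lists (mcball_of (fmetric X) 0 1)"
    proof (intro in_listsI ballI)
      fix h assume "h \<in> set hs"
      then obtain u where u: "u \<in> set us" "h = (1 / C) *\<^sub>R u i"
        by (auto simp: hs_def)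
      then have "X.mnorm h = 1 / C * X.mnorm (u i)"
        using normX elim C(1) by (simp add: norm_metric_def)
      also have "\<dots> \<le> 1 / C * C"
        using elim u C(1) by (intro mult_left_mono) auto
      finally have "X.mnorm h \<le> 1" using C(1) by simp
      with u elim show "h \<in> mcball_of (fmetric X) 0 1"
        by (auto simp: X.M.commute)
    qed
    then have hs: "hs \<in> lists (pts X)" "length hs = n"
      by (auto simp: n_def hs_def)
    have map: "map ((*\<^sub>R) C) hs = map (\<lambda>u. u i) us"
      using C(1) by (simp add: hs_def o_def)
    have D: "D (map (\<lambda>u. u i) us) y = C ^ n *\<^sub>R D hs y" "D hs y \<in> pts Y" if "y \<in> W" for y
      using D_scale_all[of "[]" hs y C] D_pts[of hs y] hs that len map by (simp_all add: n_def)
    have "mdist (fmetric Y) (D hs (x' i)) (D hs x) \<le> \<epsilon> / (2 * C ^ n)"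
      using \<delta>(2)[OF elim(1) _ ball hs(2)] elim by (simp add: X.M.commute Y.M.commute)
    then have "Y.mnorm (D hs (x' i) - D hs x) \<le> \<epsilon> / (2 * C ^ n)"
      using D(2) elim x by (simp flip: Y.mdist_eq_mnorm)
    then have "C ^ n * Y.mnorm (D hs (x' i) - D hs x) \<le> C ^ n * (\<epsilon> / (2 * C ^ n))"
      using C(1) by (intro mult_left_mono) auto
    also have "\<dots> < \<epsilon>"
      using C(1) \<open>\<epsilon> > 0\<close> by simp
    finally have "C ^ n * Y.mnorm (D hs (x' i) - D hs x) < \<epsilon>" .
    moreover have "D (map (\<lambda>u. u i) us) (x' i) - D (map (\<lambda>u. u i) us) x = C ^ n *\<^sub>R (D hs (x' i) - D hs x)"
      using D elim x by (simp add: scaleR_diff_right)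
    moreover have "D hs (x' i) - D hs x \<in> pts Y"
      using D elim x by auto
    ultimately show ?case
      using normY C(1) by (simp add: norm_metric_def)
  qed
qed

lemma norm_continuousI:
  assumes "norm_metric X"
    and lim: "\<And>us x' x. \<lbrakk>\<And>u. u \<in> set us \<Longrightarrow> bounded_along X sequentially u; enat (length us) \<le> k;
        limitin (ftop X) x' x sequentially; x \<in> W\<rbrakk> \<Longrightarrow>
      limitin (ftop Y) (\<lambda>i. D (map (\<lambda>u. u i) us) (x' i) - D (map (\<lambda>u. u i) us) x) 0 sequentially"
  shows norm_continuous
  unfolding norm_continuous_def
proof (rule ccontr)
  assume "\<not> (\<forall>n. enat n \<le> k \<longrightarrow> (\<forall>x\<in>W. \<forall>\<epsilon>>0. \<exists>\<delta>>0. \<forall>y\<in>W. mdist (fmetric X) x y < \<delta> \<longrightarrow>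
       (\<forall>hs\<in>lists (mcball_of (fmetric X) 0 1). length hs = n \<longrightarrow> mdist (fmetric Y) (D hs x) (D hs y) \<le> \<epsilon>)))"
  then obtain n x \<epsilon> where n: "enat n \<le> k" and x: "x \<in> W" and "\<epsilon> > 0" and
    neg: "\<And>\<delta>. \<delta> > 0 \<Longrightarrow> \<exists>y\<in>W. mdist (fmetric X) x y < \<delta> \<and>
      (\<exists>hs\<in>lists (mcball_of (fmetric X) 0 1). length hs = n \<and> \<not> mdist (fmetric Y) (D hs x) (D hs y) \<le> \<epsilon>)"
    by metis
  have "\<exists>y hs. y \<in> W \<and> mdist (fmetric X) x y < 1 / real (Suc m) \<and> hs \<in> lists (mcball_of (fmetric X) 0 1) \<and>
      length hs = n \<and> \<not> mdist (fmetric Y) (D hs x) (D hs y) \<le> \<epsilon>" for m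
    using neg[of "1 / real (Suc m)"] by auto
  then obtain y hs where y: "\<And>m. y m \<in> W" "\<And>m. mdist (fmetric X) x (y m) < 1 / real (Suc m)"
    and hs: "\<And>m. hs m \<in> lists (mcball_of (fmetric X) 0 1)" "\<And>m. length (hs m) = n"
    and far: "\<And>m. \<not> mdist (fmetric Y) (D (hs m) x) (D (hs m) (y m)) \<le> \<epsilon>"
    by metis
  define us where "us = map (\<lambda>j m. hs m ! j) [0..<n]"
  have "bounded_along X sequentially u" if u: "u \<in> set us" for u
  proof -
    obtain j where j: "j < n" "u = (\<lambda>m. hs m ! j)" using u by (auto simp: us_def)
    have "u m \<in> pts X \<and> X.mnorm (u m) \<le> 1" for m
    proof -
      have "u m \<in> set (hs m)" using j hs(2) by simp
      then have "u m \<in> mcball_of (fmetric X) 0 1" using hs(1)[of m] by blast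
      then show ?thesis by (simp add: X.M.commute)
    qed
    then show ?thesis unfolding bounded_along_def by (intro exI[of _ 1] always_eventually allI)
  qed
  moreover have "limitin (ftop X) y x sequentially"
    unfolding X.lim_iff
  proof (intro conjI allI impI)
    fix \<eta> :: real assume "\<eta> > 0"
    then have "\<forall>\<^sub>F m in sequentially. 1 / real (Suc m) < \<eta>"
      using order_tendstoD(2)[OF LIMSEQ_inverse_real_of_nat] by (simp add: inverse_eq_divide)
    then show "\<forall>\<^sub>F m in sequentially. y m \<in> pts X \<and> mdist (fmetric X) (y m) x < \<eta>"
      by eventually_elim (use y W_pts X.M.commute in \<open>auto intro: order.strict_trans\<close>)
  qed (use x W_pts in auto)
  ultimately have "limitin (ftop Y)
      (\<lambda>m. D (map (\<lambda>u. u m) us) (y m) - D (map (\<lambda>u. u m) us) x) 0 sequentially"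
    using n x by (intro lim) (auto simp: us_def)
  moreover have "map (\<lambda>u. u m) us = hs m" for m
    using hs(2)[of m] by (intro nth_equalityI) (auto simp: us_def)
  ultimately have "\<forall>\<^sub>F m in sequentially. Y.mnorm (D (hs m) (y m) - D (hs m) x) < \<epsilon>"
    using \<open>\<epsilon> > 0\<close> by (auto simp: Y.lim_zero_iff elim: eventually_mono)
  moreover have "\<not> Y.mnorm (D (hs m) (y m) - D (hs m) x) < \<epsilon>" for m
  proof -
    have "hs m \<in> lists (pts X)" using hs(1)[of m] by auto
    then have "D (hs m) (y m) \<in> pts Y" "D (hs m) x \<in> pts Y"
      using D_pts hs(2)[of m] y(1) x n by auto
    then show ?thesis
      using far[of m] Y.M.commute[of "D (hs m) x"] by (simp flip: Y.mdist_eq_mnorm)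
  qed
  ultimately show False by simp
qed

end

text \<open>
  In each term, first the point of the outer derivative moves while its arguments are merely bounded,
  and then the arguments move, which are close by norm continuity of the inner derivatives.
\<close>
lemma (in tower_composition) norm_continuous_Dcomp:
  assumes g: "g.norm_continuous" and f: "f.norm_continuous"
    and nX: "norm_metric X" and nY: "norm_metric Y" and nZ: "norm_metric Z"
  shows "comp.norm_continuous"
proof (rule comp.norm_continuousI[OF nX])
  fix us :: "(nat \<Rightarrow> 'u) list" and x' x
  assume us: "\<And>u. u \<in> set us \<Longrightarrow> bounded_along X sequentially u" and len: "enat (length us) \<le> k"
    and x: "limitin (ftop X) x' x sequentially" "x \<in> W"
  let ?at = "\<lambda>i. map (\<lambda>u. u i)"
  have y: "Dg [] x \<in> V" "limitin (ftop Y) (\<lambda>i. Dg [] (x' i)) (Dg [] x) sequentially"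
    using g.D_lim[of sequentially "[]" x' x] x maps_to by (auto simp: zero_enat_def[symmetric])
  have "limitin (ftop Z) (\<lambda>i. summand (map (?at i) Us) (x' i) - summand (map (?at i) Us) x) 0 sequentially"
    if Us: "Us \<in> set (partitions us)" for Us
  proof -
    let ?f = "\<lambda>U i. Dg (?at i U) (x' i)" and ?g = "\<lambda>U i. Dg (?at i U) x"
    have lenU: "enat (length Us) \<le> k" and lenB: "\<And>U. U \<in> set Us \<Longrightarrow> enat (length U) \<le> k"
      using blocks_le[OF Us len] by auto
    have bd: "bounded_along Y sequentially (?g U)"
      and close: "limitin (ftop Y) (\<lambda>i. ?f U i - ?g U i) 0 sequentially" if "U \<in> set Us" for U
      using g.D_bounded[OF nX nY, of U] g.norm_continuous_lim[OF g nX nY, of U] us x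
        partitions_blocks(2)[OF Us that] lenB[OF that] by blast+
    have bf: "bounded_along Y sequentially (?f U)" if "U \<in> set Us" for U
      using g.Y.bounded_add[OF g.Y.lim_imp_bounded[OF close[OF that]] bd[OF that]] by simp
    have "limitin (ftop Z) (\<lambda>i. Df (?at i (map ?f Us)) (Dg [] (x' i)) - Df (?at i (map ?f Us)) (Dg [] x)) 0 sequentially"
      using bf lenU y by (intro f.norm_continuous_lim[OF f nY nZ]) auto
    moreover have "limitin (ftop Z) (\<lambda>i. Df (map (\<lambda>U. ?f U i) Us) (Dg [] x) - Df (map (\<lambda>U. ?g U i) Us) (Dg [] x)) 0 sequentially"
      using f.D_close_arguments[OF nY nZ, of "[]" sequentially "map (\<lambda>U. (?f U, ?g U)) Us" "Dg [] x"]
        bd close lenU y by (auto simp: o_def)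
    ultimately show ?thesis
      using f.Y.lim_add by (fastforce simp: summand_def o_def)
  qed
  then have "limitin (ftop Z) (\<lambda>i. \<Sum>Us\<leftarrow>partitions us. summand (map (?at i) Us) (x' i) - summand (map (?at i) Us) x)
      (\<Sum>Us\<leftarrow>partitions us. 0) sequentially"
    by (rule f.Y.lim_sum_list)
  then show "limitin (ftop Z) (\<lambda>i. Dcomp (?at i us) (x' i) - Dcomp (?at i us) x) 0 sequentially"
    by (simp add: Dcomp_def partitions_map o_def flip: sum_list_subtractf)
qed


section \<open>The chain rule for functions between open sets of Frechet spaces\<close>

definition complex_linear_tower ::
  "enat \<Rightarrow> 'v::real_vector frechet \<Rightarrow> 'v set \<Rightarrow> 'w::real_vector frechet \<Rightarrow> ('v list \<Rightarrow> 'v \<Rightarrow> 'w) \<Rightarrow> bool" where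
  "complex_linear_tower k X W Y D \<longleftrightarrow>
     (\<forall>I J. imul X = Some I \<longrightarrow> imul Y = Some J \<longrightarrow> 1 \<le> k \<longrightarrow>
       (\<forall>x\<in>W. \<forall>h\<in>pts X. D [I h] x = J (D [h] x)))"

lemma diff_on_iff_tower:
  assumes "metrizable_lcs X" "metrizable_lcs Y" "openin (ftop X) W"
  shows "diff_on k X W Y g \<longleftrightarrow>
    (\<exists>D. derivative_tower X Y k W D \<and> (\<forall>x\<in>W. D [] x = g x) \<and>
      (norm_metric X \<and> norm_metric Y \<longrightarrow> derivative_tower.norm_continuous X Y k W D) \<and>
      complex_linear_tower k X W Y D)"
  unfolding diff_on_def
proof (rule iff_exI)
  fix D
  have "derivative_tower X Y k W D \<longleftrightarrow>
      (\<forall>hs\<in>lists (pts X). \<forall>h\<in>pts X. \<forall>x\<in>W. enat (length hs) < k \<longrightarrow>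
         limitin (ftop Y) (\<lambda>t. (1 / t) *\<^sub>R (D hs (x + t *\<^sub>R h) - D hs x)) (D (h # hs) x) (at 0)) \<and>
      (\<forall>n. enat n \<le> k \<longrightarrow> continuous_map
         (prod_topology (subtopology (ftop X) W) (product_topology (\<lambda>_. ftop X) {..<n}))
         (ftop Y) (\<lambda>(x, h). D (map h [0..<n]) x))"
    using assms unfolding derivative_tower_def derivative_tower_axioms_def by blast
  moreover note derivative_tower.norm_continuous_def[of X Y k W D]
  ultimately show "(\<forall>x\<in>W. D [] x = g x) \<and>
      (\<forall>hs\<in>lists (pts X). \<forall>h\<in>pts X. \<forall>x\<in>W. enat (length hs) < k \<longrightarrow>
         limitin (ftop Y) (\<lambda>t. (1 / t) *\<^sub>R (D hs (x + t *\<^sub>R h) - D hs x)) (D (h # hs) x) (at 0)) \<and>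
      (\<forall>n. enat n \<le> k \<longrightarrow> continuous_map
         (prod_topology (subtopology (ftop X) W) (product_topology (\<lambda>_. ftop X) {..<n}))
         (ftop Y) (\<lambda>(x, h). D (map h [0..<n]) x)) \<and>
      (norm_metric X \<and> norm_metric Y \<longrightarrow>
         (\<forall>n. enat n \<le> k \<longrightarrow> (\<forall>x\<in>W. \<forall>\<epsilon>>0. \<exists>\<delta>>0. \<forall>y\<in>W. mdist (fmetric X) x y < \<delta> \<longrightarrow>
            (\<forall>hs\<in>lists (mcball_of (fmetric X) 0 1). length hs = n \<longrightarrow>
               mdist (fmetric Y) (D hs x) (D hs y) \<le> \<epsilon>)))) \<and>
      (\<forall>I J. imul X = Some I \<longrightarrow> imul Y = Some J \<longrightarrow> 1 \<le> k \<longrightarrow>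
         (\<forall>x\<in>W. \<forall>h\<in>pts X. D [I h] x = J (D [h] x))) \<longleftrightarrow>
    derivative_tower X Y k W D \<and> (\<forall>x\<in>W. D [] x = g x) \<and>
      (norm_metric X \<and> norm_metric Y \<longrightarrow> derivative_tower.norm_continuous X Y k W D) \<and>
      complex_linear_tower k X W Y D"
    unfolding complex_linear_tower_def by (cases "derivative_tower X Y k W D", simp, blast)
qed

lemma derivative_tower_subset:
  assumes "derivative_tower X Y k W D" and W': "openin (ftop X) W'" "W' \<subseteq> W"
  shows "derivative_tower X Y k W' D"
proof -
  interpret derivative_tower X Y k W D by (rule assms)
  show ?thesis
  proof
    show "continuous_map
        (prod_topology (subtopology (ftop X) W') (product_topology (\<lambda>_. ftop X) {..<n}))
        (ftop Y) (\<lambda>(x, h). D (map h [0..<n]) x)" if "enat n \<le> k" for n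
      using that W' by (intro X.continuous_map_by_limits D_lim) auto
  qed (use W' deriv in auto)
qed

lemma diff_on_subset:
  assumes X: "metrizable_lcs X" and Y: "metrizable_lcs Y" and W: "openin (ftop X) W"
    and W': "openin (ftop X) W'" "W' \<subseteq> W" and g: "diff_on k X W Y g"
  shows "diff_on k X W' Y g"
proof -
  obtain D where D: "derivative_tower X Y k W D" "\<forall>x\<in>W. D [] x = g x"
    "norm_metric X \<and> norm_metric Y \<longrightarrow> derivative_tower.norm_continuous X Y k W D"
    "complex_linear_tower k X W Y D"
    using g unfolding diff_on_iff_tower[OF X Y W] by blast
  have D': "derivative_tower X Y k W' D"
    using derivative_tower_subset[OF D(1) W'] .
  have "norm_metric X \<and> norm_metric Y \<longrightarrow> derivative_tower.norm_continuous X Y k W' D"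
    using D(3) W'(2) unfolding derivative_tower.norm_continuous_def[OF D(1)]
      derivative_tower.norm_continuous_def[OF D'] by (meson subsetD)
  then show ?thesis
    unfolding diff_on_iff_tower[OF X Y W'(1)]
    using D D' W' by (intro exI[of _ D]) (auto simp: complex_linear_tower_def)
qed

lemma diff_on_continuous_map:
  assumes X: "metrizable_lcs X" and Y: "metrizable_lcs Y" and W: "openin (ftop X) W"
    and g: "diff_on k X W Y g"
  shows "continuous_map (subtopology (ftop X) W) (ftop Y) g"
proof -
  obtain D where D: "derivative_tower X Y k W D" "\<forall>x\<in>W. D [] x = g x"
    using g unfolding diff_on_iff_tower[OF X Y W] by blast
  interpret derivative_tower X Y k W D by (rule D)
  have "continuous_map (subtopology (ftop X) W) (ftop Y) (D [])"
    unfolding continuous_map_atin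
  proof
    fix x assume x: "x \<in> topspace (subtopology (ftop X) W)"
    have "limitin (subtopology (ftop X) W) (\<lambda>y. y) x (atin (subtopology (ftop X) W) x)"
      using limitin_continuous_map[OF continuous_map_id x refl] by (simp add: id_def)
    then show "limitin (ftop Y) (D []) (D [] x) (atin (subtopology (ftop X) W) x)"
      using D_lim[of _ "[]" "\<lambda>y. y" x] by (simp add: limitin_subtopology zero_enat_def[symmetric])
  qed
  then show ?thesis
    by (rule continuous_map_eq) (use D(2) in auto)
qed

text \<open>
  The chain rule for functions of class \<open>C\<^sup>k\<close>. The conditions on norms and imaginary units
  make the middle space normed or complex whenever norm continuity or complex linearity is demanded
  of the composite; class \<open>C\<^sup>k\<close> through a middle space without norm would not give the norm continuity.
\<close>
lemma diff_on_compose: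
  assumes X: "metrizable_lcs X" and Y: "metrizable_lcs Y" and Z: "metrizable_lcs Z"
    and W: "openin (ftop X) W" and V: "openin (ftop Y) V"
    and g: "diff_on k X W Y g" and f: "diff_on k Y V Z f" and gV: "\<And>x. x \<in> W \<Longrightarrow> g x \<in> V"
    and norm: "norm_metric X \<Longrightarrow> norm_metric Z \<Longrightarrow> norm_metric Y"
    and imul: "imul X \<noteq> None \<Longrightarrow> imul Z \<noteq> None \<Longrightarrow> imul Y \<noteq> None"
  shows "diff_on k X W Z (\<lambda>x. f (g x))"
proof -
  obtain Dg where Dg: "derivative_tower X Y k W Dg" "\<forall>x\<in>W. Dg [] x = g x"
    "norm_metric X \<and> norm_metric Y \<longrightarrow> derivative_tower.norm_continuous X Y k W Dg"
    "complex_linear_tower k X W Y Dg"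
    using g unfolding diff_on_iff_tower[OF X Y W] by blast
  obtain Df where Df: "derivative_tower Y Z k V Df" "\<forall>x\<in>V. Df [] x = f x"
    "norm_metric Y \<and> norm_metric Z \<longrightarrow> derivative_tower.norm_continuous Y Z k V Df"
    "complex_linear_tower k Y V Z Df"
    using f unfolding diff_on_iff_tower[OF Y Z V] by blast
  interpret tower_composition X Y Z k W V Dg Df
    using Dg Df gV by (simp add: tower_composition_def tower_composition_axioms_def)
  have "complex_linear_tower k X W Z Dcomp"
    unfolding complex_linear_tower_def
  proof (intro allI impI ballI)
    fix I J x h
    assume *: "imul X = Some I" "imul Z = Some J" "1 \<le> k" "x \<in> W" "h \<in> pts X"
    obtain I' where "imul Y = Some I'" using imul * by auto
    moreover have "Dg [h] x \<in> pts Y"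
      using * by (intro g.D_pts) (auto simp: one_enat_def)
    ultimately show "Dcomp [I h] x = J (Dcomp [h] x)"
      using * Dg(4) Df(4) maps_to[OF *(4)] unfolding complex_linear_tower_def Dcomp_single by metis
  qed
  moreover have "norm_metric X \<and> norm_metric Z \<longrightarrow> comp.norm_continuous"
    using norm_continuous_Dcomp norm Dg(3) Df(3) by blast
  moreover have "\<forall>x\<in>W. Dcomp [] x = f (g x)"
    using Dg(2) Df(2) maps_to by (simp add: Dcomp_Nil)
  ultimately show ?thesis
    unfolding diff_on_iff_tower[OF X Z W] using comp.derivative_tower_axioms by blast
qed

lemma diff_on_id:
  assumes X: "metrizable_lcs X" and W: "openin (ftop X) W"
  shows "diff_on k X W X (\<lambda>x. x)"
proof -
  interpret metrizable_lcs X by (rule X)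
  \<comment> \<open>The derivative of the identity is constant, so derivatives of order two and more vanish.\<close>
  define D :: "'a list \<Rightarrow> 'a \<Rightarrow> 'a" where
    "D hs x = (case hs of [] \<Rightarrow> x | [h] \<Rightarrow> h | _ \<Rightarrow> 0)" for hs x
  have D: "derivative_tower X X k W D"
  proof
    show "limitin (ftop X) (\<lambda>t. (1 / t) *\<^sub>R (D hs (x + t *\<^sub>R h) - D hs x)) (D (h # hs) x) (at 0)"
      if "h \<in> pts X" for hs h x
    proof (rule limitin_eventually)
      show "D (h # hs) x \<in> topspace (ftop X)"
        using that by (auto simp: D_def split: list.split)
      show "\<forall>\<^sub>F t in at 0. (1 / t) *\<^sub>R (D hs (x + t *\<^sub>R h) - D hs x) = D (h # hs) x"
        by (auto simp: D_def eventually_at_filter split: list.split)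
    qed
    show "continuous_map
        (prod_topology (subtopology (ftop X) W) (product_topology (\<lambda>_. ftop X) {..<n}))
        (ftop X) (\<lambda>(x, h). D (map h [0..<n]) x)" for n
    proof (rule continuous_map_by_limits)
      fix F :: "('a \<times> (nat \<Rightarrow> 'a)) filter" and ps x' x
      assume "lim_family (ftop X) F ps" "limitin (ftop X) x' x F"
      then show "limitin (ftop X) (\<lambda>i. D (vals ps i) (x' i)) (D (map snd ps) x) F"
        by (cases ps rule: remdups_adj.cases) (auto simp: D_def)
    qed
  qed (use W in auto)
  have "derivative_tower.norm_continuous X X k W D"
    unfolding derivative_tower.norm_continuous_def[OF D]
  proof (intro allI impI ballI)
    fix n x and \<epsilon> :: real assume x: "x \<in> W" and "\<epsilon> > 0"
    have pts: "x \<in> pts X" "0 \<in> pts X" if "x \<in> W" for x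
      using that openin_subset[OF W] by auto
    have "mdist (fmetric X) (D hs x) (D hs y) \<le> \<epsilon>"
      if "y \<in> W" "mdist (fmetric X) x y < \<epsilon>" "hs \<in> lists (mcball_of (fmetric X) 0 1)" for y hs
      using that x pts \<open>\<epsilon> > 0\<close> by (auto simp: D_def split: list.split)
    then show "\<exists>\<delta>>0. \<forall>y\<in>W. mdist (fmetric X) x y < \<delta> \<longrightarrow>
        (\<forall>hs\<in>lists (mcball_of (fmetric X) 0 1). length hs = n \<longrightarrow>
          mdist (fmetric X) (D hs x) (D hs y) \<le> \<epsilon>)"
      using \<open>\<epsilon> > 0\<close> by blast
  qed
  then show ?thesis
    unfolding diff_on_iff_tower[OF X X W] using D
    by (intro exI[of _ D]) (auto simp: complex_linear_tower_def D_def)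
qed

lemma imul_complexify [simp]: "imul (complexify X) = Some (\<lambda>(u, v). (- v, u))"
  and fmetric_complexify [simp]: "fmetric (complexify X) = prod_metric (fmetric X) (fmetric X)"
  by (simp_all add: complexify_def)

lemma metrizable_lcs_complexify:
  assumes "metrizable_lcs X"
  shows "metrizable_lcs (complexify X)"
proof -
  interpret metrizable_lcs X by (rule assms)
  show ?thesis
  proof
    show "subspace (pts (complexify X))"
      using subspace_Times[OF subspace_pts subspace_pts] by simp
    show "mdist (fmetric (complexify X)) (x + z) (y + z) = mdist (fmetric (complexify X)) x y"
      if "x \<in> pts (complexify X)" "y \<in> pts (complexify X)" "z \<in> pts (complexify X)" for x y z
      using that by (auto simp: prod_dist_def mdist_translate)
    have "continuous_map (prod_topology euclideanreal (prod_topology (ftop X) (ftop X))) (ftop X)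
        (\<lambda>p. fst p *\<^sub>R \<pi> (snd p))"
      if "continuous_map (prod_topology (ftop X) (ftop X)) (ftop X) \<pi>" for \<pi>
    proof -
      have "continuous_map (prod_topology euclideanreal (prod_topology (ftop X) (ftop X)))
          (prod_topology euclideanreal (ftop X)) (\<lambda>p. (fst p, \<pi> (snd p)))"
        using continuous_map_compose[OF continuous_map_snd that]
        by (simp add: continuous_map_pairwise continuous_map_fst o_def)
      from continuous_map_compose[OF this continuous_scale] show ?thesis
        by (simp add: o_def)
    qed
    from this[OF continuous_map_fst] this[OF continuous_map_snd]
    show "continuous_map (prod_topology euclideanreal (ftop (complexify X))) (ftop (complexify X))
        (\<lambda>(a, x). a *\<^sub>R x)"
      by (simp add: continuous_map_pairwise o_def case_prod_unfold)
    show "\<exists>K. openin (ftop (complexify X)) K \<and> convex K \<and> 0 \<in> K \<and>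
        K \<subseteq> mball_of (fmetric (complexify X)) 0 r" if "r > 0" for r
    proof -
      obtain K where K: "openin (ftop X) K" "convex K" "0 \<in> K" "K \<subseteq> mball_of (fmetric X) 0 (r / 2)"
        using small_convex[of "r / 2"] \<open>r > 0\<close> by auto
      have "prod_dist (mdist (fmetric X)) (mdist (fmetric X)) (0, 0) (u, v) < r" if "u \<in> K" "v \<in> K" for u v
      proof -
        have "prod_dist (mdist (fmetric X)) (mdist (fmetric X)) (0, 0) (u, v)
            \<le> mdist (fmetric X) 0 u + mdist (fmetric X) 0 v"
          unfolding prod_dist_def by (simp add: sqrt_sum_squares_le_sum)
        also have "\<dots> < r"
          using subsetD[OF K(4) that(1)] subsetD[OF K(4) that(2)] by simp
        finally show ?thesis .
      qed
      then have "K \<times> K \<subseteq> mball_of (fmetric (complexify X)) 0 r"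
        using openin_subset[OF K(1)] by (auto simp: zero_prod_def)
      then show ?thesis
        using K by (intro exI[of _ "K \<times> K"]) (auto simp: openin_prod_Times_iff convex_Times zero_prod_def)
    qed
  qed
qed

lemma smooth_on_real_analytic:
  assumes "imul X = None"
  shows "smooth_on Analytic X W Y g \<longleftrightarrow>
    (\<forall>x\<in>W. \<exists>W' G. openin (ftop (complexify X)) W' \<and> (x, 0) \<in> W' \<and>
       diff_on 1 (complexify X) W' (complexify Y) G \<and>
       (\<forall>y\<in>W. (y, 0) \<in> W' \<longrightarrow> G (y, 0) = (g y, 0)))"
  unfolding smooth_on.simps using assms by presburger

lemma smooth_on_subset:
  assumes X: "metrizable_lcs X" and W: "openin (ftop X) W"
    and W': "openin (ftop X) W'" "W' \<subseteq> W" and g: "smooth_on k X W X g"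
  shows "smooth_on k X W' X g"
proof (cases k)
  case (Diff n)
  with g diff_on_subset[OF X X W W'] show ?thesis by simp
next
  case Analytic
  then show ?thesis
    using g diff_on_subset[OF X X W W', of 1] W'(2) by (auto split: if_splits) (meson subsetD)+
qed

lemma smooth_on_id:
  assumes X: "metrizable_lcs X" and W: "openin (ftop X) W"
  shows "smooth_on k X W X (\<lambda>x. x)"
proof (cases k)
  case (Diff n)
  with diff_on_id[OF X W] show ?thesis by simp
next
  case Analytic
  have "diff_on 1 (complexify X) (pts (complexify X)) (complexify X) (\<lambda>x. x)"
    using openin_topspace[of "ftop (complexify X)"]
    by (intro diff_on_id metrizable_lcs_complexify X) simp
  moreover have "openin (ftop (complexify X)) (pts (complexify X))"
    using openin_topspace[of "ftop (complexify X)"] by simp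
  moreover have "(x, 0) \<in> pts (complexify X)" if "x \<in> W" for x
    using that openin_subset[OF W] metrizable_lcs.zero_pts[OF X] by auto
  ultimately show ?thesis
    using Analytic diff_on_id[OF X W, of 1] by auto
qed

lemma openin_preimage_within:
  assumes "continuous_map (subtopology S W) T f" "openin S W" "openin T V"
  shows "openin S {x \<in> W. f x \<in> V}"
proof -
  have "openin (subtopology S W) {x \<in> topspace (subtopology S W). f x \<in> V}"
    using assms by (intro openin_continuous_map_preimage)
  moreover have "{x \<in> topspace (subtopology S W). f x \<in> V} = {x \<in> W. f x \<in> V}"
    using openin_subset[OF assms(2)] by auto
  ultimately show ?thesis
    using assms(2) openin_trans_full by metis
qed

text \<open>
  In the real analytic case the composite of two holomorphic extensions extends the composite. The
  domain \<open>W'\<close> keeps the first extension inside the domain of the second and inside \<open>V\<close>; the trace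
  of \<open>W'\<close> on the real points is the open set that is sought.
\<close>
lemma smooth_on_compose_locally:
  assumes X: "metrizable_lcs X" and W: "openin (ftop X) W" and V: "openin (ftop X) V"
    and f: "smooth_on k X W X f" and g: "smooth_on k X V X g"
    and x: "x \<in> W" "f x \<in> V"
  shows "\<exists>U. openin (ftop X) U \<and> x \<in> U \<and> U \<subseteq> W \<and> f ` U \<subseteq> V \<and> smooth_on k X U X (\<lambda>y. g (f y))"
proof -
  have differentiable: ?thesis
    if f': "diff_on n X W X f" and g': "diff_on n X V X g"
      and smooth: "\<And>U h. diff_on n X U X h \<Longrightarrow> smooth_on k X U X h" for n
  proof -
    define U where "U = {y \<in> W. f y \<in> V}"
    have U: "openin (ftop X) U" "U \<subseteq> W"
      using openin_preimage_within[OF diff_on_continuous_map[OF X X W f'] W V] by (auto simp: U_def)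
    have "diff_on n X U X (\<lambda>y. g (f y))"
      by (rule diff_on_compose[OF X X X U(1) V diff_on_subset[OF X X W U f'] g']) (simp_all add: U_def)
    with U x smooth show ?thesis by (intro exI[of _ U]) (auto simp: U_def)
  qed
  consider n where "k = Diff n" | "k = Analytic" "imul X \<noteq> None" | "k = Analytic" "imul X = None"
    by (cases k) auto
  then show ?thesis
  proof cases
    case (1 n)
    then show ?thesis using f g by (intro differentiable[of n]) auto
  next
    case 2
    then show ?thesis using f g by (intro differentiable[of 1]) auto
  next
    case 3
    let ?X = "complexify X"
    note CX = metrizable_lcs_complexify[OF X]
    interpret metrizable_lcs X by (rule X)
    have an: "smooth_on Analytic X W X f" "smooth_on Analytic X V X g"
      using f g 3(1) by simp_all
    obtain W1 G1 where W1: "openin (ftop ?X) W1" "(x, 0) \<in> W1"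
      and G1: "diff_on 1 ?X W1 ?X G1" "\<forall>y\<in>W. (y, 0) \<in> W1 \<longrightarrow> G1 (y, 0) = (f y, 0)"
      using bspec[OF iffD1[OF smooth_on_real_analytic[OF 3(2)] an(1)] x(1)] by (elim exE conjE)
    obtain W2 G2 where W2: "openin (ftop ?X) W2" "(f x, 0) \<in> W2"
      and G2: "diff_on 1 ?X W2 ?X G2" "\<forall>y\<in>V. (y, 0) \<in> W2 \<longrightarrow> G2 (y, 0) = (g y, 0)"
      using bspec[OF iffD1[OF smooth_on_real_analytic[OF 3(2)] an(2)] x(2)] by (elim exE conjE)
    define W' where "W' = {p \<in> W1. G1 p \<in> W2 \<inter> (V \<times> pts X)}"
    have "openin (ftop ?X) (V \<times> pts X)"
      using V openin_topspace[of "ftop X"] by (simp add: openin_prod_Times_iff)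
    then have "openin (ftop ?X) (W2 \<inter> (V \<times> pts X))"
      using W2(1) by blast
    from openin_preimage_within[OF diff_on_continuous_map[OF CX CX W1(1) G1(1)] W1(1) this]
    have W': "openin (ftop ?X) W'" "W' \<subseteq> W1"
      by (auto simp: W'_def)
    have G: "diff_on 1 ?X W' ?X (\<lambda>p. G2 (G1 p))"
      by (rule diff_on_compose[OF CX CX CX W'(1) W2(1) diff_on_subset[OF CX CX W1(1) W' G1(1)] G2(1)])
         (simp_all add: W'_def)
    define U where "U = {y \<in> W. (y, 0) \<in> W'}"
    have fU: "f y \<in> V" "(f y, 0) \<in> W2" "G1 (y, 0) = (f y, 0)" if "y \<in> U" for y
      using that G1(2) by (auto simp: U_def W'_def)
    have "continuous_map (ftop X) (ftop ?X) (\<lambda>y. (y, 0))"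
      by (simp add: continuous_map_pairwise o_def)
    then have "continuous_map (subtopology (ftop X) W) (ftop ?X) (\<lambda>y. (y, 0))"
      by (rule continuous_map_from_subtopology)
    from openin_preimage_within[OF this W W'(1)] have "openin (ftop X) U"
      by (simp add: U_def)
    moreover have "x \<in> U"
      using x W1(2) W2(2) G1(2) by (auto simp: U_def W'_def)
    moreover have "smooth_on k X U X (\<lambda>y. g (f y))"
      unfolding 3(1) smooth_on_real_analytic[OF 3(2)]
    proof (intro ballI exI conjI impI)
      show "(y, 0) \<in> W'" if "y \<in> U" for y
        using that by (simp add: U_def)
      show "G2 (G1 (y, 0)) = (g (f y), 0)" if "y \<in> U" for y
        using fU[OF that] G2(2) by simp
    qed (use W'(1) G in blast)+
    ultimately show ?thesis
      using fU by (intro exI[of _ U]) (auto simp: U_def)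
  qed
qed


section \<open>Functions of class \<open>C\<^sup>k\<close> between open sets of linear spaces\<close>

lemma subtopology_open_topspace: "openin S A \<Longrightarrow> topspace (subtopology S A) = A"
  using openin_subset[of S A] by auto

lemma continuous_map_subtopologies_mono:
  assumes "continuous_map (subtopology E A) (subtopology E' B) f" "A' \<subseteq> A" "f ` A' \<subseteq> B'"
  shows "continuous_map (subtopology E A') (subtopology E' B') f"
proof -
  have "continuous_map (subtopology E A') E' f"
    using assms by (metis continuous_map_from_subtopology_mono continuous_map_into_fulltopology)
  then show ?thesis
    using assms(3) by (auto simp: continuous_map_in_subtopology)
qed

lemma Ck_fun_id:
  assumes C: "frechet_space (ambient C)" and A: "openin (ltop C) A"
  shows "Ck_fun k C A C A (restrict id A)"
  unfolding Ck_fun_def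
proof (intro conjI impI ballI)
  show "continuous_map (subtopology (ltop C) A) (subtopology (ltop C) A) (restrict id A)"
    by (rule continuous_map_eq[OF continuous_map_id])
       (simp add: subtopology_open_topspace[OF A])
  fix x assume "x \<in> A"
  have top: "openin (ftop (ambient C)) (pts (ambient C))"
    using openin_topspace[of "ftop (ambient C)"] by simp
  have "x \<in> pts (ambient C)"
    using \<open>x \<in> A\<close> openin_subset[OF A] by auto
  with smooth_on_id[OF frechet_space_metrizable_lcs[OF C] top] top
  show "\<exists>W g. openin (ftop (ambient C)) W \<and> x \<in> W \<and> smooth_on k (ambient C) W (ambient C) g \<and>
      (\<forall>y\<in>A \<inter> W. g y = restrict id A y)"
    by (intro exI[of _ "pts (ambient C)"] exI[of _ "\<lambda>x. x"]) auto
qed (use A in auto)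

lemma Ck_fun_image: "Ck_fun k C A C' B f \<Longrightarrow> f ` A \<subseteq> B"
  unfolding Ck_fun_def
  by (metis continuous_map_image_subset_topspace subtopology_open_topspace)

lemma Ck_fun_restrict:
  assumes f: "Ck_fun k C A C' B f" and A': "openin (ltop C) A'" "A' \<subseteq> A"
    and B': "openin (ltop C') B'" "f ` A' \<subseteq> B'"
  shows "Ck_fun k C A' C' B' (restrict f A')"
  unfolding Ck_fun_def
proof (intro conjI impI ballI)
  have "continuous_map (subtopology (ltop C) A') (subtopology (ltop C') B') f"
    using f A' B' unfolding Ck_fun_def by (blast intro: continuous_map_subtopologies_mono)
  then show "continuous_map (subtopology (ltop C) A') (subtopology (ltop C') B') (restrict f A')"
    by (rule continuous_map_eq) (simp add: subtopology_open_topspace[OF A'(1)])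
  fix x assume "k \<noteq> Diff 0" "x \<in> A'"
  then obtain W g where "openin (ftop (ambient C)) W" "x \<in> W"
      "smooth_on k (ambient C) W (ambient C') g" "\<forall>y\<in>A \<inter> W. g y = f y"
    using f A'(2) unfolding Ck_fun_def by blast
  then show "\<exists>W g. openin (ftop (ambient C)) W \<and> x \<in> W \<and> smooth_on k (ambient C) W (ambient C') g \<and>
      (\<forall>y\<in>A' \<inter> W. g y = restrict f A' y)"
    using A'(2) by (intro exI[of _ W] exI[of _ g]) auto
qed (use A' B' in auto)

lemma Ck_fun_compose:
  assumes C: "frechet_space (ambient C)"
    and f: "Ck_fun k C A C B f" and g: "Ck_fun k C B C D g"
  shows "Ck_fun k C A C D (compose A g f)"
  unfolding Ck_fun_def
proof (intro conjI impI ballI)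
  have A: "openin (ltop C) A" and D: "openin (ltop C) D"
    using f g by (simp_all add: Ck_fun_def)
  then show "openin (ltop C) A" "openin (ltop C) D" by auto
  have "continuous_map (subtopology (ltop C) A) (subtopology (ltop C) D) (g \<circ> f)"
    using f g unfolding Ck_fun_def by (blast intro: continuous_map_compose)
  then show "continuous_map (subtopology (ltop C) A) (subtopology (ltop C) D) (compose A g f)"
    by (rule continuous_map_eq) (simp add: subtopology_open_topspace[OF A] compose_def)
  fix x assume k: "k \<noteq> Diff 0" and x: "x \<in> A"
  let ?X = "ambient C"
  have fx: "f x \<in> B" using Ck_fun_image[OF f] x by auto
  obtain W f' where W: "openin (ftop ?X) W" "x \<in> W" "smooth_on k ?X W ?X f'" "\<forall>y\<in>A \<inter> W. f' y = f y"
    using f k x unfolding Ck_fun_def by blast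
  obtain V g' where V: "openin (ftop ?X) V" "f x \<in> V" "smooth_on k ?X V ?X g'" "\<forall>y\<in>B \<inter> V. g' y = g y"
    using g k fx unfolding Ck_fun_def by blast
  have "f' x \<in> V" using V(2) W(2,4) x by auto
  from smooth_on_compose_locally[OF frechet_space_metrizable_lcs[OF C] W(1) V(1) W(3) V(3) W(2) this]
  obtain U where U: "openin (ftop ?X) U" "x \<in> U" "U \<subseteq> W" "f' ` U \<subseteq> V"
    "smooth_on k ?X U ?X (\<lambda>y. g' (f' y))"
    by blast
  have "g' (f' y) = compose A g f y" if "y \<in> A \<inter> U" for y
  proof -
    have "f' y = f y" "f' y \<in> V" "f y \<in> B"
      using that U(3,4) W(4) Ck_fun_image[OF f] by auto
    then show ?thesis using V(4) that by (simp add: compose_def)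
  qed
  with U show "\<exists>W g'. openin (ftop ?X) W \<and> x \<in> W \<and> smooth_on k ?X W ?X g' \<and>
      (\<forall>y\<in>A \<inter> W. g' y = compose A g f y)"
    by (intro exI[of _ U] exI[of _ "\<lambda>y. g' (f' y)"]) auto
qed simp

text \<open>
  Being \<open>C\<^sup>k\<close> is local, apart from continuity and the codomain. This is the gluing axiom of model spaces.
\<close>
lemma Ck_fun_glue:
  assumes C: "frechet_space (ambient C)"
    and "openin (ltop C) U" "openin (ltop C) V" "f \<in> extensional U"
    and "continuous_map (subtopology (ltop C) U) (subtopology (ltop C) V) f"
    and pieces: "\<And>x. x \<in> U \<Longrightarrow> \<exists>A B h. x \<in> A \<and> Ck_fun k C A C B h \<and> (\<forall>y\<in>A. f y = h y)"
  shows "Ck_fun k C U C V f"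
  unfolding Ck_fun_def
proof (intro conjI impI ballI)
  let ?X = "ambient C"
  fix x assume k: "k \<noteq> Diff 0" and "x \<in> U"
  then obtain A B h where A: "x \<in> A" "Ck_fun k C A C B h" "\<forall>y\<in>A. f y = h y"
    using pieces by blast
  then obtain W g where W: "openin (ftop ?X) W" "x \<in> W" "smooth_on k ?X W ?X g" "\<forall>y\<in>A \<inter> W. g y = h y"
    using k unfolding Ck_fun_def by blast
  \<comment> \<open>The extension agrees with \<open>f\<close> only on \<open>A\<close>, so it is cut down to an ambient open set that
    meets \<open>points C\<close> in \<open>A\<close>.\<close>
  obtain T where T: "openin (ftop ?X) T" "A = T \<inter> points C"
    using A(2) unfolding Ck_fun_def openin_subtopology by blast
  have "smooth_on k ?X (W \<inter> T) ?X g"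
    using smooth_on_subset[OF frechet_space_metrizable_lcs[OF C] W(1) _ _ W(3)] W(1) T(1) by auto
  moreover have "U \<subseteq> points C"
    using openin_subset[OF assms(2)] by auto
  ultimately show "\<exists>W g. openin (ftop ?X) W \<and> x \<in> W \<and> smooth_on k ?X W ?X g \<and> (\<forall>y\<in>U \<inter> W. g y = f y)"
    using W T A by (intro exI[of _ "W \<inter> T"] exI[of _ g]) auto
qed (use assms in auto)

section \<open>Trivial model spaces\<close>

lemma Triv_simps [simp]:
  "mtop (Triv E) = E" "nbds (Triv E) = {A. openin E A}"
  "f \<in> mor (Triv E) A B \<longleftrightarrow> openin E A \<and> openin E B \<and> f \<in> extensional A \<and>
     continuous_map (subtopology E A) (subtopology E B) f"
  by (simp_all add: Triv_def)

lemma Trivk_simps [simp]: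
  "mtop (Trivk k C) = ltop C" "nbds (Trivk k C) = {A. openin (ltop C) A}"
  "f \<in> mor (Trivk k C) A B \<longleftrightarrow> Ck_fun k C A C B f"
  by (simp_all add: Trivk_def)

lemma continuous_map_compose_on:
  assumes "continuous_map (subtopology E A) S f" "continuous_map S T g"
  shows "continuous_map (subtopology E A) T (compose A g f)"
  by (rule continuous_map_eq[OF continuous_map_compose[OF assms]]) (simp add: compose_def)

lemma model_space_Triv: "model_space (Triv E)"
  unfolding model_space_def Triv_simps mem_Collect_eq
proof (intro conjI allI ballI impI; (elim conjE)?)
  show "continuous_map (subtopology E A) (subtopology E A) (restrict id A)" for A
    by (rule continuous_map_eq[OF continuous_map_id]) simp
  show "\<Union>{A. openin E A} = topspace E"
    using openin_subset by blast
  show "continuous_map (subtopology E A') (subtopology E A) (restrict id A')" if "A' \<subseteq> A" for A A'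
    using that continuous_map_subtopologies_mono[OF continuous_map_id[of "subtopology E A"], of A' A]
    by (simp add: continuous_map_id)
qed (auto intro: continuous_map_compose_on continuous_map_subtopologies_mono)

lemma model_space_Trivk:
  assumes C: "frechet_space (ambient C)"
  shows "model_space (Trivk k C)"
  unfolding model_space_def
proof (intro conjI allI ballI impI)
  show "openin (mtop (Trivk k C)) A" if "A \<in> nbds (Trivk k C)" for A
    using that by simp
  show "A \<in> nbds (Trivk k C)" "B \<in> nbds (Trivk k C)" "f \<in> extensional A"
    "continuous_map (subtopology (mtop (Trivk k C)) A) (subtopology (mtop (Trivk k C)) B) f"
    if "f \<in> mor (Trivk k C) A B" for A B f
    using that by (simp_all add: Ck_fun_def)
  show "restrict id A \<in> mor (Trivk k C) A A" if "A \<in> nbds (Trivk k C)" for A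
    using Ck_fun_id[OF C] that by simp
  show "compose A g f \<in> mor (Trivk k C) A D"
    if "f \<in> mor (Trivk k C) A B" "g \<in> mor (Trivk k C) B D" for A B D f g
    using Ck_fun_compose[OF C] that by simp
  show "\<Union>(nbds (Trivk k C)) = topspace (mtop (Trivk k C))"
    using openin_subset[of "ltop C"] openin_topspace[of "ltop C"] by (simp del: openin_topspace) blast
  show "A \<inter> B \<in> nbds (Trivk k C)" if "A \<in> nbds (Trivk k C)" "B \<in> nbds (Trivk k C)" for A B
    using that by (simp add: openin_Int)
  show "restrict f A' \<in> mor (Trivk k C) A' B'"
    if "f \<in> mor (Trivk k C) A B" "A' \<in> nbds (Trivk k C)" "B' \<in> nbds (Trivk k C)"
      "A' \<subseteq> A" "B' \<subseteq> B" "f ` A' \<subseteq> B'" for A B A' B' f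
    using Ck_fun_restrict[of k C A C B f A' B'] that by simp
  show "restrict id A' \<in> mor (Trivk k C) A' A"
    if "A \<in> nbds (Trivk k C)" "A' \<in> nbds (Trivk k C)" "A' \<subseteq> A" for A A'
  proof -
    have "restrict (restrict id A) A' = restrict id A'" "restrict id A ` A' \<subseteq> A"
      using that(3) by (auto simp: restrict_def fun_eq_iff)
    then show ?thesis
      using Ck_fun_restrict[OF Ck_fun_id[OF C, of A k], of A' A] that by simp
  qed
  fix \<F> U V f
  assume \<F>: "\<forall>(A, B, h)\<in>\<F>. h \<in> mor (Trivk k C) A B" "U = (\<Union>(A, B, h)\<in>\<F>. A)"
      "\<forall>(A, B, h)\<in>\<F>. \<forall>x\<in>A. f x = h x"
    and UV: "U \<in> nbds (Trivk k C)" "V \<in> nbds (Trivk k C)" "f \<in> extensional U"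
      "continuous_map (subtopology (mtop (Trivk k C)) U) (subtopology (mtop (Trivk k C)) V) f"
  have "\<exists>A B h. x \<in> A \<and> Ck_fun k C A C B h \<and> (\<forall>y\<in>A. f y = h y)" if "x \<in> U" for x
  proof -
    obtain A B h where "(A, B, h) \<in> \<F>" "x \<in> A"
      using \<open>x \<in> U\<close> unfolding \<F>(2) by auto
    moreover from this have "Ck_fun k C A C B h" "\<forall>y\<in>A. f y = h y"
      using \<F>(1,3) by auto
    ultimately show ?thesis by blast
  qed
  then show "f \<in> mor (Trivk k C) U V"
    using Ck_fun_glue[OF C] UV by simp
qed

section \<open>Atlases and their morphisms in trivial model spaces\<close>

lemma model_iso_Trivk:
  assumes "Ck_diffeo k C A C B f"
  shows "model_iso (Trivk k C) A B f"
proof -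
  obtain g where f: "Ck_fun k C A C B f" and g: "Ck_fun k C B C A g"
    and inv: "\<forall>x\<in>A. g (f x) = x" "\<forall>y\<in>B. f (g y) = y"
    using assms unfolding Ck_diffeo_def by blast
  have "compose A g f = restrict id A" "compose B f g = restrict id B"
    using inv by (auto simp: compose_def restrict_def)
  with f g show ?thesis
    unfolding model_iso_def by auto
qed

text \<open>
  Where all open sets are model neighborhoods, a model function is just a continuous function.
\<close>
lemma model_function_open_nbds:
  assumes M: "nbds M = {A. openin (mtop M) A}" and N: "nbds N = {A. openin (mtop N) A}"
    and f: "f \<in> extensional (topspace (mtop M))" "continuous_map (mtop M) (mtop N) f"
  shows "model_function M N f"
  unfolding model_function_def
  using f openin_continuous_map_preimage[OF f(2)] continuous_map_image_subset_topspace[OF f(2)]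
    openin_subset[of "mtop M"]
  by (auto simp: M N intro!: exI[of _ "topspace (mtop N)"]) blast

lemma nbds_restrict_model_open:
  assumes "nbds M = {A. openin (mtop M) A}" "openin (mtop M) U"
  shows "nbds (restrict_model M U) = {A. openin (mtop (restrict_model M U)) A}"
  using assms by (auto simp: restrict_model_def openin_open_subtopology)

lemma m_chart_Triv:
  assumes "Ck_chart E C c"
  shows "m_chart (Triv E) (Trivk k C) c"
proof -
  obtain U V \<phi> where c: "c = (U, V, \<phi>)" by (cases c)
  have U: "openin E U" and V: "openin (ltop C) V" and ext: "\<phi> \<in> extensional U"
    and homeo: "homeomorphic_map (subtopology E U) (subtopology (ltop C) V) \<phi>"
    using assms by (auto simp: Ck_chart_def c)
  let ?M = "restrict_model (Triv E) U" and ?N = "restrict_model (Trivk k C) V"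
  have top: "mtop ?M = subtopology E U" "mtop ?N = subtopology (ltop C) V"
    by (simp_all add: restrict_model_def)
  have space: "topspace (mtop ?M) = U" "topspace (mtop ?N) = V"
    unfolding top using U V by (simp_all only: subtopology_open_topspace)
  have nbds: "nbds ?M = {A. openin (mtop ?M) A}" "nbds ?N = {A. openin (mtop ?N) A}"
    using U V by (intro nbds_restrict_model_open; simp)+
  obtain \<psi> where \<psi>: "homeomorphic_maps (mtop ?M) (mtop ?N) \<phi> \<psi>"
    using homeo unfolding top homeomorphic_map_maps by blast
  then have inv: "continuous_map (mtop ?M) (mtop ?N) \<phi>" "continuous_map (mtop ?N) (mtop ?M) \<psi>"
    "\<forall>x\<in>U. \<psi> (\<phi> x) = x" "\<forall>y\<in>V. \<phi> (\<psi> y) = y" "\<phi> ` U \<subseteq> V"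
    using continuous_map_image_subset_topspace[of "mtop ?M" "mtop ?N" \<phi>]
    unfolding homeomorphic_maps_def space by auto
  have "continuous_map (mtop ?N) (mtop ?M) (restrict \<psi> V)"
    using inv(2) by (rule continuous_map_eq) (simp add: space)
  then have "model_function ?N ?M (restrict \<psi> V)"
    by (intro model_function_open_nbds nbds) (simp add: space)
  moreover have "model_function ?M ?N \<phi>"
    by (intro model_function_open_nbds nbds inv) (simp add: space ext)
  ultimately have "model_homeo ?M ?N \<phi>"
    unfolding model_homeo_def space using inv
    by (intro conjI exI[of _ "restrict \<psi> V"]) (auto simp: image_subset_iff)
  with U V show ?thesis
    by (simp add: m_chart_def c)
qed

lemma m_atlas_Triv:
  assumes "frechet_space (ambient C)" "Ck_atlas k E C \<A>"
  shows "m_atlas (Triv E) (Trivk k C) \<A>"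
  unfolding m_atlas_def
proof (intro conjI ballI)
  show "m_compatible (Trivk k C) c c'" if "c \<in> \<A>" "c' \<in> \<A>" for c c'
  proof -
    have "Ck_compatible k C c c'"
      using assms(2) that by (simp add: Ck_atlas_def)
    then show ?thesis
      by (auto simp: Ck_compatible_def m_compatible_def intro: model_iso_Trivk)
  qed
qed (use assms in \<open>auto simp: Ck_atlas_def intro: model_space_Triv model_space_Trivk m_chart_Triv\<close>)

lemma local_morphism_mono:
  assumes "local_morphism OE\<^sub>1 OC\<^sub>1 OE\<^sub>2 OC\<^sub>2 isom E f\<^sub>0 f\<^sub>1 c c'"
    and "\<And>V V' f. isom V V' f \<Longrightarrow> isom' V V' f"
  shows "local_morphism OE\<^sub>1 OC\<^sub>1 OE\<^sub>2 OC\<^sub>2 isom' E f\<^sub>0 f\<^sub>1 c c'"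
  unfolding local_morphism_def Let_def case_prod_unfold
proof (rule ballI, goal_cases)
  case (1 x)
  from bspec[OF assms(1)[unfolded local_morphism_def Let_def case_prod_unfold] 1]
  show ?case
    by (elim bexE exE conjE) (intro bexI exI conjI; (assumption | rule assms(2)); assumption?)
qed

lemma topspace_ltop: "linear_space C \<Longrightarrow> topspace (ltop C) = points C"
  by (auto simp: linear_space_def)

lemma m_morphism_Triv:
  assumes "linear_space C\<^sub>1" and "Ck_morphism k (\<A>\<^sub>1, E\<^sub>1, C\<^sub>1) (\<A>\<^sub>2, E\<^sub>2, C\<^sub>2) f"
  shows "m_morphism (\<A>\<^sub>1, Triv E\<^sub>1, Trivk k C\<^sub>1) (\<A>\<^sub>2, Triv E\<^sub>2, Trivk k C\<^sub>2) f"
proof -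
  obtain f\<^sub>0 f\<^sub>1 where f: "f = (f\<^sub>0, f\<^sub>1)" by force
  have f\<^sub>0: "f\<^sub>0 \<in> extensional (topspace E\<^sub>1)" "continuous_map E\<^sub>1 E\<^sub>2 f\<^sub>0"
    and f\<^sub>1: "Ck_fun k C\<^sub>1 (points C\<^sub>1) C\<^sub>2 (points C\<^sub>2) f\<^sub>1"
    and loc: "\<And>c\<^sub>1 c\<^sub>2. \<lbrakk>c\<^sub>1 \<in> \<A>\<^sub>1; c\<^sub>2 \<in> \<A>\<^sub>2\<rbrakk> \<Longrightarrow> local_morphism {U. openin E\<^sub>1 U} {V. openin (ltop C\<^sub>1) V}
        {U. openin E\<^sub>2 U} {V. openin (ltop C\<^sub>2) V} (\<lambda>V V'. Ck_diffeo k C\<^sub>2 V C\<^sub>2 V') (topspace E\<^sub>1) f\<^sub>0 f\<^sub>1 c\<^sub>1 c\<^sub>2"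
    using assms(2) by (auto simp: Ck_morphism_def f)
  have "model_function (Triv E\<^sub>1) (Triv E\<^sub>2) f\<^sub>0"
    using f\<^sub>0 by (intro model_function_open_nbds) auto
  moreover have "model_function (Trivk k C\<^sub>1) (Trivk k C\<^sub>2) f\<^sub>1"
    using f\<^sub>1 topspace_ltop[OF assms(1)]
    by (intro model_function_open_nbds) (auto simp: Ck_fun_def subtopology_subtopology)
  moreover have "local_morphism {U. openin E\<^sub>1 U} {V. openin (ltop C\<^sub>1) V} {U. openin E\<^sub>2 U}
      {V. openin (ltop C\<^sub>2) V} (model_iso (Trivk k C\<^sub>2)) (topspace E\<^sub>1) f\<^sub>0 f\<^sub>1 c\<^sub>1 c\<^sub>2"
    if "c\<^sub>1 \<in> \<A>\<^sub>1" "c\<^sub>2 \<in> \<A>\<^sub>2" for c\<^sub>1 c\<^sub>2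
    using loc[OF that] by (rule local_morphism_mono) (rule model_iso_Trivk)
  ultimately show ?thesis
    by (simp add: m_morphism_def f)
qed

section \<open>Identity morphisms\<close>

text \<open>
  For the identity of an atlas the two charts differ by a transition function on the
  overlap, and this is the isomorphism that the definition of an atlas morphism asks for. The
  argument is shared by both kinds of atlases.
\<close>
lemma local_morphism_identity:
  assumes inj: "inj_on \<phi>\<^sub>2 U\<^sub>2" and U: "U\<^sub>1 \<subseteq> E" and \<phi>: "\<phi>\<^sub>1 ` U\<^sub>1 \<subseteq> V\<^sub>1" "\<phi>\<^sub>2 ` U\<^sub>2 \<subseteq> V\<^sub>2" "V\<^sub>1 \<subseteq> P"
    and overlap: "U\<^sub>1 \<inter> U\<^sub>2 \<noteq> {} \<Longrightarrow> U\<^sub>1 \<inter> U\<^sub>2 \<in> OE \<and> \<phi>\<^sub>1 ` (U\<^sub>2 \<inter> U\<^sub>1) \<in> OC \<and> \<phi>\<^sub>2 ` (U\<^sub>2 \<inter> U\<^sub>1) \<in> OC \<and>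
      isom (\<phi>\<^sub>2 ` (U\<^sub>2 \<inter> U\<^sub>1)) (\<phi>\<^sub>1 ` (U\<^sub>2 \<inter> U\<^sub>1)) (transition (U\<^sub>2, V\<^sub>2, \<phi>\<^sub>2) (U\<^sub>1, V\<^sub>1, \<phi>\<^sub>1))"
  shows "local_morphism OE OC OE OC isom E (restrict id E) (restrict id P) (U\<^sub>1, V\<^sub>1, \<phi>\<^sub>1) (U\<^sub>2, V\<^sub>2, \<phi>\<^sub>2)"
  unfolding local_morphism_def Let_def prod.case
proof (rule ballI)
  let ?I = "U\<^sub>1 \<inter> U\<^sub>2" and ?t = "transition (U\<^sub>2, V\<^sub>2, \<phi>\<^sub>2) (U\<^sub>1, V\<^sub>1, \<phi>\<^sub>1)"
  have I: "U\<^sub>1 \<inter> {x \<in> E. restrict id E x \<in> U\<^sub>2} = ?I"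
    using U by auto
  fix x assume "x \<in> U\<^sub>1 \<inter> {x \<in> E. restrict id E x \<in> U\<^sub>2}"
  then have x: "x \<in> ?I" unfolding I .
  have P: "\<phi>\<^sub>1 u \<in> P" "u \<in> E" "\<phi>\<^sub>1 u \<in> V\<^sub>1" "\<phi>\<^sub>2 u \<in> V\<^sub>2" if "u \<in> ?I" for u
    using that U \<phi> by auto
  have t: "?t (\<phi>\<^sub>2 u) = \<phi>\<^sub>1 u" if "u \<in> ?I" for u
    using that inj by (simp add: transition_def)
  have ov: "?I \<in> OE" "\<phi>\<^sub>1 ` ?I \<in> OC" "\<phi>\<^sub>2 ` ?I \<in> OC" "isom (\<phi>\<^sub>2 ` ?I) (\<phi>\<^sub>1 ` ?I) ?t"
    using overlap x by (auto simp: Int_commute)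
  show "\<exists>U\<^sub>1'\<in>OE. \<exists>V\<^sub>1'\<in>OC. \<exists>U\<^sub>2'\<in>OE. \<exists>V\<^sub>2'\<in>OC. \<exists>V\<^sub>2''\<in>OC. \<exists>f'.
       U\<^sub>1' \<subseteq> U\<^sub>1 \<inter> {x \<in> E. restrict id E x \<in> U\<^sub>2} \<and> V\<^sub>1' \<subseteq> V\<^sub>1 \<and> U\<^sub>2' \<subseteq> U\<^sub>2 \<and> V\<^sub>2' \<subseteq> V\<^sub>2 \<and> isom V\<^sub>2' V\<^sub>2'' f' \<and>
       x \<in> U\<^sub>1' \<and> restrict id P (\<phi>\<^sub>1 x) \<in> V\<^sub>2'' \<and> restrict id E ` U\<^sub>1' \<subseteq> U\<^sub>2' \<and> \<phi>\<^sub>1 ` U\<^sub>1' \<subseteq> V\<^sub>1' \<and>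
       restrict id P ` V\<^sub>1' \<subseteq> V\<^sub>2'' \<and> \<phi>\<^sub>2 ` U\<^sub>2' \<subseteq> V\<^sub>2' \<and>
       (\<forall>u\<in>U\<^sub>1'. f' (\<phi>\<^sub>2 (restrict id E u)) = restrict id P (\<phi>\<^sub>1 u))"
    unfolding I using ov x P t
    by (intro bexI[of _ ?I] bexI[of _ "\<phi>\<^sub>1 ` ?I"] bexI[of _ "\<phi>\<^sub>2 ` ?I"] exI[of _ ?t] conjI) auto
qed

lemma Ck_morphism_identity:
  assumes C: "linear_space C" and \<A>: "Ck_atlas k E C \<A>"
  shows "Ck_morphism k (\<A>, E, C) (\<A>, E, C) (restrict id (topspace E), restrict id (points C))"
  unfolding Ck_morphism_def prod.case
proof (intro conjI ballI)
  show "continuous_map E E (restrict id (topspace E))"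
    by (rule continuous_map_eq[OF continuous_map_id]) simp
  have "openin (ltop C) (points C)"
    using openin_topspace[of "ltop C"] unfolding topspace_ltop[OF C] .
  then show "Ck_fun k C (points C) C (points C) (restrict id (points C))"
    using C by (intro Ck_fun_id) (simp_all add: linear_space_def)
  fix c\<^sub>1 c\<^sub>2 assume c: "c\<^sub>1 \<in> \<A>" "c\<^sub>2 \<in> \<A>"
  obtain U\<^sub>1 V\<^sub>1 \<phi>\<^sub>1 U\<^sub>2 V\<^sub>2 \<phi>\<^sub>2 where eq: "c\<^sub>1 = (U\<^sub>1, V\<^sub>1, \<phi>\<^sub>1)" "c\<^sub>2 = (U\<^sub>2, V\<^sub>2, \<phi>\<^sub>2)"
    by (cases c\<^sub>1, cases c\<^sub>2)
  have "Ck_chart E C c\<^sub>1" "Ck_chart E C c\<^sub>2" and compat: "Ck_compatible k C c\<^sub>2 c\<^sub>1"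
    using \<A> c by (auto simp: Ck_atlas_def)
  then have U: "openin E U\<^sub>1" "openin E U\<^sub>2" and V: "openin (ltop C) V\<^sub>1"  "openin (ltop C) V\<^sub>2"
    and homeo: "homeomorphic_map (subtopology E U\<^sub>1) (subtopology (ltop C) V\<^sub>1) \<phi>\<^sub>1"
      "homeomorphic_map (subtopology E U\<^sub>2) (subtopology (ltop C) V\<^sub>2) \<phi>\<^sub>2"
    by (auto simp: Ck_chart_def eq)
  have sub: "U\<^sub>1 \<subseteq> topspace E" "V\<^sub>1 \<subseteq> points C"
    using openin_subset[OF U(1)] openin_subset[OF V(1)] by auto
  have surj: "\<phi>\<^sub>1 ` U\<^sub>1 = V\<^sub>1" "\<phi>\<^sub>2 ` U\<^sub>2 = V\<^sub>2"
    using homeomorphic_imp_surjective_map[OF homeo(1)] homeomorphic_imp_surjective_map[OF homeo(2)]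
    unfolding subtopology_open_topspace[OF U(1)] subtopology_open_topspace[OF U(2)]
      subtopology_open_topspace[OF V(1)] subtopology_open_topspace[OF V(2)] .
  have inj: "inj_on \<phi>\<^sub>2 U\<^sub>2"
    using homeomorphic_imp_injective_map[OF homeo(2)] unfolding subtopology_open_topspace[OF U(2)] .
  show "local_morphism {U. openin E U} {V. openin (ltop C) V} {U. openin E U} {V. openin (ltop C) V}
      (\<lambda>V. Ck_diffeo k C V C) (topspace E) (restrict id (topspace E)) (restrict id (points C)) c\<^sub>1 c\<^sub>2"
    unfolding eq
  proof (rule local_morphism_identity[OF inj sub(1) _ _ sub(2)])
    assume "U\<^sub>1 \<inter> U\<^sub>2 \<noteq> {}"
    then have "Ck_diffeo k C (\<phi>\<^sub>2 ` (U\<^sub>2 \<inter> U\<^sub>1)) C (\<phi>\<^sub>1 ` (U\<^sub>2 \<inter> U\<^sub>1)) (transition (U\<^sub>2, V\<^sub>2, \<phi>\<^sub>2) (U\<^sub>1, V\<^sub>1, \<phi>\<^sub>1))"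
      using compat by (auto simp: Ck_compatible_def eq)
    moreover from this have "openin (ltop C) (\<phi>\<^sub>2 ` (U\<^sub>2 \<inter> U\<^sub>1))" "openin (ltop C) (\<phi>\<^sub>1 ` (U\<^sub>2 \<inter> U\<^sub>1))"
      by (simp_all add: Ck_diffeo_def Ck_fun_def)
    ultimately show "U\<^sub>1 \<inter> U\<^sub>2 \<in> {U. openin E U} \<and> \<phi>\<^sub>1 ` (U\<^sub>2 \<inter> U\<^sub>1) \<in> {V. openin (ltop C) V} \<and>
        \<phi>\<^sub>2 ` (U\<^sub>2 \<inter> U\<^sub>1) \<in> {V. openin (ltop C) V} \<and>
        Ck_diffeo k C (\<phi>\<^sub>2 ` (U\<^sub>2 \<inter> U\<^sub>1)) C (\<phi>\<^sub>1 ` (U\<^sub>2 \<inter> U\<^sub>1)) (transition (U\<^sub>2, V\<^sub>2, \<phi>\<^sub>2) (U\<^sub>1, V\<^sub>1, \<phi>\<^sub>1))"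
      using U by (simp add: openin_Int)
  qed (simp_all add: surj)
qed simp

lemma model_space_nbds:
  assumes "model_space S"
  shows "A \<in> nbds S \<Longrightarrow> openin (mtop S) A"
    and "A \<in> nbds S \<Longrightarrow> B \<in> nbds S \<Longrightarrow> A \<inter> B \<in> nbds S"
    and "f \<in> mor S A B \<Longrightarrow> A \<in> nbds S \<and> B \<in> nbds S"
proof -
  note S = assms[unfolded model_space_def]
  show "A \<in> nbds S \<Longrightarrow> openin (mtop S) A"
    using conjunct1[OF S] by (rule bspec)
  show "A \<in> nbds S \<Longrightarrow> B \<in> nbds S \<Longrightarrow> A \<inter> B \<in> nbds S"
    using S[THEN conjunct2, THEN conjunct2, THEN conjunct2, THEN conjunct2, THEN conjunct2, THEN conjunct1]
    by (elim ballE) auto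
  show "f \<in> mor S A B \<Longrightarrow> A \<in> nbds S \<and> B \<in> nbds S"
    using S[THEN conjunct2, THEN conjunct1] by blast
qed

lemma model_function_identity:
  assumes S: "model_space S"
  shows "model_function S S (restrict id (topspace (mtop S)))"
  unfolding model_function_def
proof (intro conjI ballI)
  show "continuous_map (mtop S) (mtop S) (restrict id (topspace (mtop S)))"
    by (rule continuous_map_eq[OF continuous_map_id]) simp
  fix A assume A: "A \<in> nbds S"
  then have sub: "A \<subseteq> topspace (mtop S)"
    using model_space_nbds(1)[OF S] openin_subset by blast
  then have "{x \<in> topspace (mtop S). restrict id (topspace (mtop S)) x \<in> A} = A"
    by auto
  with A show "{x \<in> topspace (mtop S). restrict id (topspace (mtop S)) x \<in> A} \<in> nbds S"
    by simp
  from A sub show "\<exists>B\<in>nbds S. restrict id (topspace (mtop S)) ` A \<subseteq> B"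
    by (intro bexI[of _ A]) auto
qed simp

lemma m_morphism_identity:
  assumes \<A>: "m_atlas E C \<A>"
  shows "m_morphism (\<A>, E, C) (\<A>, E, C)
    (restrict id (topspace (mtop E)), restrict id (topspace (mtop C)))"
  unfolding m_morphism_def prod.case
proof (intro conjI ballI)
  have E: "model_space E" and C: "model_space C"
    using \<A> by (auto simp: m_atlas_def)
  then show "model_function E E (restrict id (topspace (mtop E)))"
    "model_function C C (restrict id (topspace (mtop C)))"
    by (simp_all add: model_function_identity)
  fix c\<^sub>1 c\<^sub>2 assume c: "c\<^sub>1 \<in> \<A>" "c\<^sub>2 \<in> \<A>"
  obtain U\<^sub>1 V\<^sub>1 \<phi>\<^sub>1 U\<^sub>2 V\<^sub>2 \<phi>\<^sub>2 where eq: "c\<^sub>1 = (U\<^sub>1, V\<^sub>1, \<phi>\<^sub>1)" "c\<^sub>2 = (U\<^sub>2, V\<^sub>2, \<phi>\<^sub>2)"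
    by (cases c\<^sub>1, cases c\<^sub>2)
  have chart: "U \<subseteq> topspace (mtop E)" "V \<subseteq> topspace (mtop C)" "\<phi> ` U \<subseteq> V" "inj_on \<phi> U" "U \<in> nbds E"
    if "(U, V, \<phi>) \<in> \<A>" for U V \<phi>
  proof -
    have UV: "U \<in> nbds E" "V \<in> nbds C" and "model_homeo (restrict_model E U) (restrict_model C V) \<phi>"
      using \<A> that by (auto simp: m_atlas_def m_chart_def)
    then obtain g where \<phi>: "continuous_map (subtopology (mtop E) U) (subtopology (mtop C) V) \<phi>"
      and g: "\<forall>x\<in>topspace (subtopology (mtop E) U). g (\<phi> x) = x"
      by (auto simp: model_homeo_def model_function_def restrict_model_def)
    have open_UV: "openin (mtop E) U" "openin (mtop C) V"
      using UV model_space_nbds(1) E C by auto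
    from g show "inj_on \<phi> U"
      unfolding subtopology_open_topspace[OF open_UV(1)] by (metis inj_on_inverseI)
    show "\<phi> ` U \<subseteq> V"
      using continuous_map_image_subset_topspace[OF \<phi>]
      unfolding subtopology_open_topspace[OF open_UV(1)] subtopology_open_topspace[OF open_UV(2)] .
    show "U \<subseteq> topspace (mtop E)" "V \<subseteq> topspace (mtop C)" "U \<in> nbds E"
      using open_UV openin_subset UV by auto
  qed
  have compat: "m_compatible C c\<^sub>2 c\<^sub>1"
    using \<A> c by (simp add: m_atlas_def)
  note c\<^sub>1 = chart[OF c(1)[unfolded eq]] and c\<^sub>2 = chart[OF c(2)[unfolded eq]]
  show "local_morphism (nbds E) (nbds C) (nbds E) (nbds C) (model_iso C) (topspace (mtop E))
      (restrict id (topspace (mtop E))) (restrict id (topspace (mtop C))) c\<^sub>1 c\<^sub>2"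
    unfolding eq
  proof (rule local_morphism_identity[OF c\<^sub>2(4) c\<^sub>1(1) c\<^sub>1(3) c\<^sub>2(3) c\<^sub>1(2)])
    assume "U\<^sub>1 \<inter> U\<^sub>2 \<noteq> {}"
    then have iso: "model_iso C (\<phi>\<^sub>2 ` (U\<^sub>2 \<inter> U\<^sub>1)) (\<phi>\<^sub>1 ` (U\<^sub>2 \<inter> U\<^sub>1)) (transition (U\<^sub>2, V\<^sub>2, \<phi>\<^sub>2) (U\<^sub>1, V\<^sub>1, \<phi>\<^sub>1))"
      using compat by (auto simp: m_compatible_def eq)
    then have "\<phi>\<^sub>2 ` (U\<^sub>2 \<inter> U\<^sub>1) \<in> nbds C \<and> \<phi>\<^sub>1 ` (U\<^sub>2 \<inter> U\<^sub>1) \<in> nbds C"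
      using model_space_nbds(3)[OF C] unfolding model_iso_def by blast
    with iso show "U\<^sub>1 \<inter> U\<^sub>2 \<in> nbds E \<and> \<phi>\<^sub>1 ` (U\<^sub>2 \<inter> U\<^sub>1) \<in> nbds C \<and> \<phi>\<^sub>2 ` (U\<^sub>2 \<inter> U\<^sub>1) \<in> nbds C \<and>
        model_iso C (\<phi>\<^sub>2 ` (U\<^sub>2 \<inter> U\<^sub>1)) (\<phi>\<^sub>1 ` (U\<^sub>2 \<inter> U\<^sub>1)) (transition (U\<^sub>2, V\<^sub>2, \<phi>\<^sub>2) (U\<^sub>1, V\<^sub>1, \<phi>\<^sub>1))"
      using model_space_nbds(2)[OF E c\<^sub>1(5) c\<^sub>2(5)] by simp
  qed
qed

section \<open>Categories of atlases and the functor\<close>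

lemma compose_restrict_id:
  "f \<in> extensional A \<Longrightarrow> compose A f (restrict id A) = f"
  "f \<in> extensional A \<Longrightarrow> f \<in> A \<rightarrow> B \<Longrightarrow> compose A (restrict id B) f = f"
  by (auto simp: compose_def fun_eq_iff extensional_def)

lemma atlas_cat_simps [simp]:
  "Ob (atlas_cat pE pC objs morph) = objs"
  "(f, o\<^sub>1, o\<^sub>2) \<in> Arr (atlas_cat pE pC objs morph) \<longleftrightarrow> o\<^sub>1 \<in> objs \<and> o\<^sub>2 \<in> objs \<and> morph o\<^sub>1 o\<^sub>2 f"
  "src (atlas_cat pE pC objs morph) (f, o\<^sub>1, o\<^sub>2) = o\<^sub>1"
  "tgt (atlas_cat pE pC objs morph) (f, o\<^sub>1, o\<^sub>2) = o\<^sub>2"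
  "ident (atlas_cat pE pC objs morph) (\<A>, E, C) =
     ((restrict id (pE E), restrict id (pC C)), (\<A>, E, C), (\<A>, E, C))"
  "comp (atlas_cat pE pC objs morph) ((g\<^sub>0, g\<^sub>1), o\<^sub>2, o\<^sub>3) ((f\<^sub>0, f\<^sub>1), (\<A>, E, C), o\<^sub>2') =
     ((compose (pE E) g\<^sub>0 f\<^sub>0, compose (pC C) g\<^sub>1 f\<^sub>1), (\<A>, E, C), o\<^sub>3)"
  by (simp_all add: atlas_cat_def)

lemma atlas_cat_arrowE:
  assumes "f \<in> Arr (atlas_cat pE pC objs morph)"
  obtains f\<^sub>0 f\<^sub>1 \<A> E C \<A>' E' C' where "f = ((f\<^sub>0, f\<^sub>1), (\<A>, E, C), (\<A>', E', C'))"
    "(\<A>, E, C) \<in> objs" "(\<A>', E', C') \<in> objs" "morph (\<A>, E, C) (\<A>', E', C') (f\<^sub>0, f\<^sub>1)"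
  using assms by (cases f) auto

text \<open>
  The laws concern only the underlying extensional functions; being a morphism enters through
  its domain and codomain.
\<close>
lemma cat_axioms_atlas_cat:
  assumes ident: "\<And>\<A> E C. (\<A>, E, C) \<in> objs \<Longrightarrow>
      morph (\<A>, E, C) (\<A>, E, C) (restrict id (pE E), restrict id (pC C))"
    and maps: "\<And>\<A> E C \<A>' E' C' f\<^sub>0 f\<^sub>1. \<lbrakk>(\<A>, E, C) \<in> objs; (\<A>', E', C') \<in> objs;
      morph (\<A>, E, C) (\<A>', E', C') (f\<^sub>0, f\<^sub>1)\<rbrakk> \<Longrightarrow>
      f\<^sub>0 \<in> extensional (pE E) \<and> f\<^sub>0 \<in> pE E \<rightarrow> pE E' \<and> f\<^sub>1 \<in> extensional (pC C) \<and> f\<^sub>1 \<in> pC C \<rightarrow> pC C'"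
  shows "cat_axioms (atlas_cat pE pC objs morph)" (is "cat_axioms ?K")
proof -
  have arrowE: thesis
    if arr: "f \<in> Arr ?K" and elim: "\<And>f\<^sub>0 f\<^sub>1 \<A> E C \<A>' E' C'. \<lbrakk>f = ((f\<^sub>0, f\<^sub>1), (\<A>, E, C), (\<A>', E', C'));
      (\<A>, E, C) \<in> objs; (\<A>', E', C') \<in> objs; f\<^sub>0 \<in> extensional (pE E); f\<^sub>0 \<in> pE E \<rightarrow> pE E';
      f\<^sub>1 \<in> extensional (pC C); f\<^sub>1 \<in> pC C \<rightarrow> pC C'\<rbrakk> \<Longrightarrow> thesis" for f thesis
  proof -
    obtain f\<^sub>0 f\<^sub>1 \<A> E C \<A>' E' C' where f: "f = ((f\<^sub>0, f\<^sub>1), (\<A>, E, C), (\<A>', E', C'))"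
      "(\<A>, E, C) \<in> objs" "(\<A>', E', C') \<in> objs" "morph (\<A>, E, C) (\<A>', E', C') (f\<^sub>0, f\<^sub>1)"
      using arr by (rule atlas_cat_arrowE)
    with elim maps[OF f(2-4)] show thesis by blast
  qed
  show ?thesis
    unfolding cat_axioms_def
  proof (intro conjI ballI impI)
    fix f assume f: "f \<in> Arr ?K"
    then show "src ?K f \<in> Ob ?K" "tgt ?K f \<in> Ob ?K"
      by (auto elim!: arrowE)
    from f show "comp ?K f (ident ?K (src ?K f)) = f" "comp ?K (ident ?K (tgt ?K f)) f = f"
      by (auto elim!: arrowE simp: compose_restrict_id)
  next
    fix a assume "a \<in> Ob ?K"
    then show "ident ?K a \<in> Arr ?K" "src ?K (ident ?K a) = a" "tgt ?K (ident ?K a) = a"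
      by (cases a; simp add: ident)+
  next
    fix f g assume "f \<in> Arr ?K" "g \<in> Arr ?K" "tgt ?K f = src ?K g"
    then show "src ?K (comp ?K g f) = src ?K f" "tgt ?K (comp ?K g f) = tgt ?K g"
      by (auto elim!: arrowE)
  next
    fix f g h assume "f \<in> Arr ?K" "g \<in> Arr ?K" "h \<in> Arr ?K" "tgt ?K f = src ?K g" "tgt ?K g = src ?K h"
    then show "comp ?K h (comp ?K g f) = comp ?K (comp ?K h g) f"
      by (auto elim!: arrowE intro!: compose_assoc)
  qed
qed

lemma cat_axioms_Atlk:
  assumes "\<forall>C\<in>\<C>. linear_space C"
  shows "cat_axioms (Atlk k \<E> \<C>)"
  unfolding Atlk_def
proof (rule cat_axioms_atlas_cat, goal_cases)
  case (1 \<A> E C)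
  with assms show ?case by (auto intro: Ck_morphism_identity)
next
  case (2 \<A> E C \<A>' E' C' f\<^sub>0 f\<^sub>1)
  then have "f\<^sub>0 \<in> extensional (topspace E)" "continuous_map E E' f\<^sub>0"
    and f\<^sub>1: "Ck_fun k C (points C) C' (points C') f\<^sub>1"
    by (auto simp: Ck_morphism_def)
  moreover from f\<^sub>1 have "f\<^sub>1 \<in> extensional (points C)" "f\<^sub>1 \<in> points C \<rightarrow> points C'"
    using Ck_fun_image[OF f\<^sub>1] by (auto simp: Ck_fun_def)
  ultimately show ?case
    by (auto simp: continuous_map_def)
qed

lemma cat_axioms_Atl: "cat_axioms (Atl \<E> \<C>)"
  unfolding Atl_def
proof (rule cat_axioms_atlas_cat, goal_cases)
  case (1 \<A> E C)
  then show ?case by (auto intro: m_morphism_identity)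
next
  case (2 \<A> E C \<A>' E' C' f\<^sub>0 f\<^sub>1)
  then show ?case
    by (auto simp: m_morphism_def model_function_def continuous_map_def)
qed

theorem theorem10p33:
  fixes \<E> :: "'e topology set" and \<C> :: "'v::real_vector linspace set" and k :: smoothness
  assumes "\<forall>C\<in>\<C>. linear_space C"
  shows "is_functor (Atlk k \<E> \<C>) (Atl (Triv ` \<E>) (Trivk k ` \<C>)) (F_ob k) (F_arr k)"
  unfolding is_functor_def
proof (intro conjI ballI impI)
  let ?K = "Atlk k \<E> \<C>" and ?L = "Atl (Triv ` \<E>) (Trivk k ` \<C>)"
  show "cat_axioms ?K" "cat_axioms ?L"
    using cat_axioms_Atlk[OF assms] cat_axioms_Atl by auto
  have linear: "linear_space C" if "C \<in> \<C>" for C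
    using assms that by blast
  then have frechet: "frechet_space (ambient C)" if "C \<in> \<C>" for C
    using that by (simp add: linear_space_def)
  have points: "pts (ambient C) \<inter> points C = points C" if "C \<in> \<C>" for C
    using linear[OF that] by (auto simp: linear_space_def)
  show "F_ob k a \<in> Ob ?L" if "a \<in> Ob ?K" for a
    using that frechet by (auto simp: Atlk_def Atl_def F_ob_def m_atlas_Triv)
  show "F_arr k f \<in> Arr ?L" "src ?L (F_arr k f) = F_ob k (src ?K f)"
    "tgt ?L (F_arr k f) = F_ob k (tgt ?K f)" if "f \<in> Arr ?K" for f
    using that frechet unfolding Atlk_def
    by (auto elim!: atlas_cat_arrowE simp: Atl_def F_arr_def F_ob_def m_atlas_Triv
        intro!: m_morphism_Triv[OF linear])
  show "F_arr k (ident ?K a) = ident ?L (F_ob k a)" if "a \<in> Ob ?K" for a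
    using that by (auto simp: Atlk_def Atl_def F_arr_def F_ob_def points)
  show "F_arr k (comp ?K g f) = comp ?L (F_arr k g) (F_arr k f)"
    if "f \<in> Arr ?K" "g \<in> Arr ?K" for f g
    using that unfolding Atlk_def
    by (auto elim!: atlas_cat_arrowE simp: Atl_def F_arr_def points)
qed

end
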